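(* Let $1\le p<\infty$ and let $\mathcal{D}=\mathrm{Diff}(\mathbb{D}^2,\partial\mathbb{D}^2,\mathrm{area})$. For each $n\in\mathbb{N}$ there is a bi-Lipschitz embedding $\mathbb{R}^n\to(\mathcal{D},\mathbf{d}_p)$. Moreover, for each $n\in\mathbb{N}$ there is a bi-Lipschitz embedding $\mathbb{R}^n\to(\mathrm{Ker}(\mathcal{C}),\mathbf{d}_p)$, where $\mathcal{C}\colon\mathcal{D}\to\mathbb{R}$ is the Calabi homomorphism.
   Context: Group. $\mathbb{D}^2$ is the closed unit disc in the Euclidean plane. $\mathcal{D}$ is the group of smooth area-preserving diffeomorphisms of $\mathbb{D}^2$ that equal the identity near the boundary. Calabi homomorphism. Every $g\in\mathcal{D}$ is the time-one map of the flow of a smooth time-dependent Hamiltonian $H_t\colon\mathbb{D}^2\to\mathbb{R}$, $t\in[0,1]$, vanishing near $\partial\mathbb{D}^2$; the Calabi homomorphism $\mathcal{C}\colon\mathcal{D}\to\mathbb{R}$ is $\mathcal{C}(g)=2\int_0^1\int_{\mathbb{D}^2}H_t(x)\,dx\,dt$, which is well defined (the normalizing constant is irrelevant for the kernel). $L^p$-metric. For a smooth isotopy $\{g_t\}_{t\in[0,1]}\subset\mathcal{D}$ put $\mathcal{L}_p\{g_t\}=\int_0^1\left(\int_{\mathbb{D}^2}\|\dot g_t(x)\|^p\,dx\right)^{1/p}dt$, with $\|\cdot\|$ the Euclidean norm. Define $\mathbf{d}_p(g_0,g_1)=\inf\mathcal{L}_p\{g_t\}$, the infimum over all smooth isotopies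 in $\mathcal{D}$ from $g_0$ to $g_1$ (a right-invariant metric); $\mathrm{Ker}(\mathcal{C})$ carries the restriction of $\mathbf{d}_p$. Put $\|g\|_p=\mathbf{d}_p(\mathrm{Id},g)$. Bi-Lipschitz embedding. For $G=\mathcal{D}$ or $G=\mathrm{Ker}(\mathcal{C})$, a bi-Lipschitz embedding $\mathbb{R}^n\to(G,\mathbf{d}_p)$ is an injective group homomorphism $\Psi\colon\mathbb{R}^n\to G$ for which there is a constant $A\ge1$ with $A^{-1}\|v\|\le\|\Psi(v)\|_p\le A\|v\|$ for all $v\in\mathbb{R}^n$, where $\|v\|$ is the $\ell^1$-norm (equivalently, any norm) on the additive group $\mathbb{R}^n$. *)

theory Defs
  imports "HOL-Analysis.Analysis" "HOL-Algebra.Coset"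
begin

text \<open>
  Derivatives are taken within the domain \<open>S\<close>. They are unique when \<open>S\<close> is convex with nonempty
  interior; this covers the two domains used below, the closed disc and its product with the
  closed time interval.
\<close>

primrec C_k_on :: "nat \<Rightarrow> 'a::euclidean_space set \<Rightarrow> ('a \<Rightarrow> 'b::real_normed_vector) \<Rightarrow> bool" where
  "C_k_on 0 S f \<longleftrightarrow> continuous_on S f"
| "C_k_on (Suc k) S f \<longleftrightarrow>
     (\<exists>f'. (\<forall>x\<in>S. (f has_derivative f' x) (at x within S)) \<and> (\<forall>v. C_k_on k S (\<lambda>x. f' x v)))"

definition smooth_on :: "'a::euclidean_space set \<Rightarrow> ('a \<Rightarrow> 'b::real_normed_vector) \<Rightarrow> bool" where
  "smooth_on S f \<longleftrightarrow> (\<forall>k. C_k_on k S f)"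

type_synonym plane = "real ^ 2"

abbreviation disc :: "plane set" where
  "disc \<equiv> cball 0 1"

text \<open>
  Smoothness in the time variable is joint smoothness on the closed set \<open>{0..1} \<times> disc\<close>, with
  one-sided derivatives at the end points of the time interval.
\<close>

definition smooth_family :: "(real \<Rightarrow> plane \<Rightarrow> 'b::real_normed_vector) \<Rightarrow> bool" where
  "smooth_family h \<longleftrightarrow> smooth_on ({0..1} \<times> disc) (\<lambda>(t, x). h t x)"

definition disc_diffeo :: "(plane \<Rightarrow> plane) \<Rightarrow> bool" where
  "disc_diffeo g \<longleftrightarrow>
     bij_betw g disc disc \<and> smooth_on disc g \<and> smooth_on disc (inv_into disc g)"

definition area_preserving :: "(plane \<Rightarrow> plane) \<Rightarrow> bool" where
  "area_preserving g \<longleftrightarrow>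
     (\<forall>A \<in> sets lebesgue. A \<subseteq> disc \<longrightarrow> emeasure lebesgue (g ` A) = emeasure lebesgue A)"

definition identity_near_boundary :: "(plane \<Rightarrow> plane) \<Rightarrow> bool" where
  "identity_near_boundary g \<longleftrightarrow> (\<exists>r<1. \<forall>x\<in>disc. r \<le> norm x \<longrightarrow> g x = x)"

text \<open>
  Maps of the disc are represented by total functions on the plane. The values outside the disc
  carry no information; they are normalised to the identity, so that equality of functions is
  equality of maps of the disc and composition of functions is the group operation.
\<close>

definition disc_diffeos :: "(plane \<Rightarrow> plane) set" where
  "disc_diffeos =
     {g. disc_diffeo g \<and> area_preserving g \<and> identity_near_boundary g \<and> (\<forall>x. x \<notin> disc \<longrightarrow> g x = x)}"

definition disc_group :: "(plane \<Rightarrow> plane) monoid" where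
  "disc_group = \<lparr>carrier = disc_diffeos, mult = (\<circ>), one = id\<rparr>"

definition additive_group :: "'a::ab_group_add monoid" where
  "additive_group = \<lparr>carrier = UNIV, mult = (+), one = 0\<rparr>"

subsection \<open>The Calabi homomorphism\<close>

text \<open>The opposite sign convention for the vector field only changes the sign of \<open>calabi\<close>.\<close>

definition hamiltonian_field :: "(plane \<Rightarrow> real) \<Rightarrow> plane \<Rightarrow> plane" where
  "hamiltonian_field h x =
     (let h' = frechet_derivative h (at x within disc) in vector [h' (axis 2 1), - h' (axis 1 1)])"

definition hamiltonian_on_disc :: "(real \<Rightarrow> plane \<Rightarrow> real) \<Rightarrow> bool" where
  "hamiltonian_on_disc H \<longleftrightarrow>
     smooth_family H \<and> (\<exists>r<1. \<forall>t\<in>{0..1}. \<forall>x\<in>disc. r \<le> norm x \<longrightarrow> H t x = 0)"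

definition hamiltonian_flow :: "(real \<Rightarrow> plane \<Rightarrow> real) \<Rightarrow> (real \<Rightarrow> plane \<Rightarrow> plane) \<Rightarrow> bool" where
  "hamiltonian_flow H \<phi> \<longleftrightarrow>
     (\<forall>x\<in>disc. \<phi> 0 x = x \<and>
        (\<forall>t\<in>{0..1}. \<phi> t x \<in> disc \<and>
           ((\<lambda>s. \<phi> s x) has_vector_derivative hamiltonian_field (H t) (\<phi> t x))
             (at t within {0..1})))"

definition generates :: "(real \<Rightarrow> plane \<Rightarrow> real) \<Rightarrow> (plane \<Rightarrow> plane) \<Rightarrow> bool" where
  "generates H g \<longleftrightarrow>
     hamiltonian_on_disc H \<and> (\<exists>\<phi>. hamiltonian_flow H \<phi> \<and> (\<forall>x\<in>disc. \<phi> 1 x = g x))"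

text \<open>On \<open>disc_diffeos\<close> the value exists and does not depend on the generating Hamiltonian.\<close>

definition calabi :: "(plane \<Rightarrow> plane) \<Rightarrow> real" where
  "calabi g =
     (THE c. \<exists>H. generates H g \<and> c = 2 * integral {0..1} (\<lambda>t. integral disc (\<lambda>x. H t x)))"

definition calabi_kernel_group :: "(plane \<Rightarrow> plane) monoid" where
  "calabi_kernel_group = disc_group\<lparr>carrier := kernel disc_group additive_group calabi\<rparr>"

subsection \<open>The metric\<close>

definition isotopy :: "(real \<Rightarrow> plane \<Rightarrow> plane) \<Rightarrow> bool" where
  "isotopy g \<longleftrightarrow> smooth_family g \<and> (\<forall>t\<in>{0..1}. g t \<in> disc_diffeos)"

definition Lp_length :: "real \<Rightarrow> (real \<Rightarrow> plane \<Rightarrow> plane) \<Rightarrow> real" where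
  "Lp_length p g =
     integral {0..1} (\<lambda>t.
       (integral disc (\<lambda>x. norm (vector_derivative (\<lambda>s. g s x) (at t within {0..1})) powr p))
         powr (1 / p))"

definition Lp_dist :: "real \<Rightarrow> (plane \<Rightarrow> plane) \<Rightarrow> (plane \<Rightarrow> plane) \<Rightarrow> real" where
  "Lp_dist p g\<^sub>0 g\<^sub>1 = Inf {Lp_length p g |g. isotopy g \<and> g 0 = g\<^sub>0 \<and> g 1 = g\<^sub>1}"

definition Lp_norm :: "real \<Rightarrow> (plane \<Rightarrow> plane) \<Rightarrow> real" where
  "Lp_norm p g = Lp_dist p id g"

subsection \<open>Bi-Lipschitz embeddings\<close>

definition l1_norm :: "real ^ 'n \<Rightarrow> real" where
  "l1_norm v = (\<Sum>i\<in>UNIV. \<bar>v $ i\<bar>)"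

text \<open>
  For a subgroup \<open>G\<close> of \<open>disc_group\<close>, with the metric restricted from \<open>disc_group\<close>: the isotopies in
  \<open>Lp_norm\<close> need not stay in \<open>G\<close>.
\<close>

definition bi_lipschitz_embedding ::
    "real \<Rightarrow> (plane \<Rightarrow> plane) monoid \<Rightarrow> (real ^ 'n \<Rightarrow> plane \<Rightarrow> plane) \<Rightarrow> bool" where
  "bi_lipschitz_embedding p G \<Psi> \<longleftrightarrow>
     \<Psi> \<in> mon additive_group G \<and>
     (\<exists>A\<ge>1. \<forall>v. inverse A * l1_norm v \<le> Lp_norm p (\<Psi> v) \<and> Lp_norm p (\<Psi> v) \<le> A * l1_norm v)"

end

theory Submission
  imports Defs
begin

text \<open>
  The embedding sends \<open>v\<close> to the twist that rotates the circle of radius \<open>\<bar>x\<bar>\<close> by the angle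
  \<open>\<Sum>i. v\<^sub>i f\<^sub>i (\<bar>x\<bar>\<^sup>2)\<close>, where the \<open>f\<^sub>i\<close> are bump functions with disjoint supports away from the centre.

  For an isotopy \<open>g\<^sub>t\<close> from the identity let \<open>w (x, y)\<close> be the total angle by which \<open>g\<^sub>t x - g\<^sub>t y\<close> turns.
  Two isotopies with the same end give values of \<open>w\<close> that differ by a multiple of \<open>2\<pi>\<close>; the difference is
  continuous in \<open>y\<close> and is smaller than \<open>2\<pi>\<close> for \<open>y\<close> on the boundary circle, so \<open>w\<close> depends on \<open>g\<^sub>1\<close> alone.
  Since \<open>\<bar>w (x, y)\<bar>\<close> is at most the time integral of \<open>(\<bar>g'\<^sub>t x\<bar> + \<bar>g'\<^sub>t y\<bar>) / \<bar>g\<^sub>t x - g\<^sub>t y\<bar>\<close>, \<open>g\<^sub>t\<close> preserves area and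
  \<open>1 / \<bar>z\<bar>\<close> is integrable in the plane, the integral of \<open>\<bar>w\<bar>\<close> over pairs of points is at most a constant times
  the length of the isotopy. For a twist \<open>\<bar>w (x, y)\<bar>\<close> is at least half the rotation angle of \<open>y\<close> when \<open>x\<close> is near the
  centre, which gives the linear lower bound.

  For the kernel of the Calabi homomorphism the \<open>f\<^sub>i\<close> are chosen so that the twists have generating Hamiltonians of
  mean zero. That all Hamiltonians generating a map have the same integral follows from Fathi's observation that
  this integral is, up to a constant, the integral of \<open>w\<close>. The singular kernel is regularised here to
  \<open>z / (\<bar>z\<bar>\<^sup>2 + \<epsilon>\<^sup>2)\<close>, and the area preservation of a Hamiltonian flow is obtained from the Euler scheme, so that no
  differentiability of the flow in the initial point is needed.
\<close>

section \<open>Smooth functions\<close>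

text \<open>The obstacle is the lower bound. Points of the disc move by at most 2, so displacement
  cannot show that a twist is far from the identity, and an isotopy that ends at the twist need not
  look like a rotation. Turning angles of pairs have no such bound, and the L1 speed controls them;
  every p is reduced to p = 1. Twists about a common centre commute and their angles add, which
  gives a homomorphism. With disjoint supports the absolute value of a combination is the sum of the
  absolute values, so the l1 norm appears in both estimates. The radial Hamiltonian F(|x|^2)
  generates the twist with angle -2 F'. For F the derivative of \<rho> m(\<rho>), with a bump m, 2
  F(|x|^2) is the divergence of m(|x|^2) x and has integral 0. In the Calabi part an integration by
  parts moves the derivative from h to the kernel z / |z|^2, whose divergence is a multiple of the
  Dirac measure at 0. The regularised kernel is continuous, its divergence is a mollifier with mass
  bounded below, and paired with a Lipschitz field it stays bounded uniformly in \<epsilon>, so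
  dominated convergence applies.\<close>

lemma C_k_on_Suc_imp: "C_k_on (Suc k) S f \<Longrightarrow> C_k_on k S f"
proof (induction k arbitrary: f)
  case 0
  then show ?case
    by (auto simp: continuous_on_eq_continuous_within intro: has_derivative_continuous)
next
  case (Suc k)
  then obtain f' where "\<forall>x\<in>S. (f has_derivative f' x) (at x within S)"
    and "\<And>v. C_k_on (Suc k) S (\<lambda>x. f' x v)"
    by (auto simp del: C_k_on.simps simp: C_k_on.simps(2)[of "Suc k"])
  then show ?case
    using Suc.IH by auto
qed

lemma C_k_on_cong:
  assumes "\<And>x. x \<in> S \<Longrightarrow> f x = g x"
  shows "C_k_on k S f \<longleftrightarrow> C_k_on k S g"
proof (cases k)
  case 0
  then show ?thesis
    using assms by (simp cong: continuous_on_cong)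
next
  case (Suc n)
  have "(f has_derivative D) (at x within S) \<longleftrightarrow> (g has_derivative D) (at x within S)" if "x \<in> S" for x D
    using assms that by (metis has_derivative_transform)
  then show ?thesis
    by (simp add: Suc)
qed

lemma C_k_on_const: "C_k_on k S (\<lambda>x. c)"
proof (induction k arbitrary: c)
  case (Suc k)
  show ?case
    unfolding C_k_on.simps by (intro exI[of _ "\<lambda>x v. 0"]) (auto simp: Suc)
qed simp

lemma C_k_on_linear:
  assumes "bounded_linear f"
  shows "C_k_on k S f"
proof (cases k)
  case 0
  then show ?thesis
    using assms by (simp add: linear_continuous_on)
next
  case (Suc n)
  show ?thesis
    unfolding Suc C_k_on.simps
    by (intro exI[of _ "\<lambda>x. f"]) (auto simp: C_k_on_const bounded_linear_imp_has_derivative assms)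
qed

lemma C_k_on_add:
  "C_k_on k S f \<Longrightarrow> C_k_on k S g \<Longrightarrow> C_k_on k S (\<lambda>x. f x + g x)"
proof (induction k arbitrary: f g)
  case 0
  then show ?case
    by (simp add: continuous_on_add)
next
  case (Suc k)
  then obtain f' g' where "\<forall>x\<in>S. (f has_derivative f' x) (at x within S)"
    "\<forall>x\<in>S. (g has_derivative g' x) (at x within S)"
    "\<And>v. C_k_on k S (\<lambda>x. f' x v)" "\<And>v. C_k_on k S (\<lambda>x. g' x v)"
    by auto
  then show ?case
    unfolding C_k_on.simps using Suc.IH
    by (intro exI[of _ "\<lambda>x v. f' x v + g' x v"]) (auto intro!: has_derivative_add)
qed

text \<open>Leibniz rule; products, scalar multiples and inner products of smooth maps are
  instances.\<close>

lemma C_k_on_bilinear: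
  assumes "bounded_bilinear B"
  shows "C_k_on k S f \<Longrightarrow> C_k_on k S g \<Longrightarrow> C_k_on k S (\<lambda>x. B (f x) (g x))"
proof (induction k arbitrary: f g)
  case 0
  then show ?case
    using bounded_bilinear.continuous_on[OF assms] by auto
next
  case (Suc k)
  then obtain f' g' where *: "\<forall>x\<in>S. (f has_derivative f' x) (at x within S)"
    "\<forall>x\<in>S. (g has_derivative g' x) (at x within S)"
    "\<And>v. C_k_on k S (\<lambda>x. f' x v)" "\<And>v. C_k_on k S (\<lambda>x. g' x v)"
    by auto
  have "C_k_on k S f" "C_k_on k S g"
    using Suc.prems C_k_on_Suc_imp by blast+
  then show ?case
    unfolding C_k_on.simps using *
    by (intro exI[of _ "\<lambda>x v. B (f x) (g' x v) + B (f' x v) (g x)"])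
      (auto intro!: bounded_bilinear.FDERIV[OF assms] C_k_on_add Suc.IH)
qed

lemma C_k_on_sum:
  assumes "\<And>i. i \<in> I \<Longrightarrow> C_k_on k S (f i)"
  shows "C_k_on k S (\<lambda>x. \<Sum>i\<in>I. f i x)"
proof (cases "finite I")
  case True
  then show ?thesis
    using assms by (induction I) (auto intro: C_k_on_add C_k_on_const)
qed (simp add: C_k_on_const)

text \<open>Since the outer function has a real argument, the chain rule writes the derivative as
  \<open>f' x v *\<^sub>R \<phi>' (f x) 1\<close>, a product in which \<open>\<phi>'\<close> has one
  order less. The induction therefore runs over all outer functions.\<close>

lemma C_k_on_compose_real:
  fixes \<phi> :: "real \<Rightarrow> 'b::real_normed_vector"
  shows "C_k_on k UNIV \<phi> \<Longrightarrow> C_k_on k S f \<Longrightarrow> C_k_on k S (\<lambda>x. \<phi> (f x))"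
proof (induction k arbitrary: \<phi>)
  case 0
  then show ?case
    using continuous_on_compose2 by fastforce
next
  case (Suc k)
  then obtain f' \<phi>' where *: "\<forall>x\<in>S. (f has_derivative f' x) (at x within S)"
    "\<forall>x. (\<phi> has_derivative \<phi>' x) (at x)"
    "\<And>v. C_k_on k S (\<lambda>x. f' x v)" "\<And>v. C_k_on k UNIV (\<lambda>x. \<phi>' x v)"
    by auto
  have f: "C_k_on k S f"
    using Suc.prems C_k_on_Suc_imp by blast
  have "\<phi>' (f x) (f' x v) = f' x v *\<^sub>R \<phi>' (f x) 1" for x v
    by (metis "*"(2) has_derivative_linear linear_scale mult.right_neutral real_scaleR_def)
  moreover have "((\<lambda>x. \<phi> (f x)) has_derivative (\<lambda>v. \<phi>' (f x) (f' x v))) (at x within S)" if "x \<in> S" for x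
    by (rule has_derivative_compose[OF *(1)[rule_format, OF that] *(2)[rule_format]])
  ultimately show ?case
    unfolding C_k_on.simps using * f
    by (intro exI[of _ "\<lambda>x v. \<phi>' (f x) (f' x v)"])
      (auto intro!: C_k_on_bilinear[OF bounded_bilinear_scaleR] Suc.IH)
qed

lemma smooth_on_cong: "(\<And>x. x \<in> S \<Longrightarrow> f x = g x) \<Longrightarrow> smooth_on S f \<longleftrightarrow> smooth_on S g"
  unfolding smooth_on_def using C_k_on_cong by blast

lemma smooth_on_const: "smooth_on S (\<lambda>x. c)"
  and smooth_on_linear: "bounded_linear f \<Longrightarrow> smooth_on S f"
  and smooth_on_add: "smooth_on S f1 \<Longrightarrow> smooth_on S f2 \<Longrightarrow> smooth_on S (\<lambda>x. f1 x + f2 x)"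
  and smooth_on_mult: "smooth_on S g1 \<Longrightarrow> smooth_on S g2 \<Longrightarrow> smooth_on S (\<lambda>x. g1 x * g2 x :: real)"
  and smooth_on_scaleR: "smooth_on S g1 \<Longrightarrow> smooth_on S f2 \<Longrightarrow> smooth_on S (\<lambda>x. g1 x *\<^sub>R f2 x)"
  and smooth_on_inner: "smooth_on S h1 \<Longrightarrow> smooth_on S h2 \<Longrightarrow> smooth_on S (\<lambda>x. h1 x \<bullet> h2 x)"
  and smooth_on_compose_real: "smooth_on UNIV \<phi> \<Longrightarrow> smooth_on S g1 \<Longrightarrow> smooth_on S (\<lambda>x. \<phi> (g1 x))"
  unfolding smooth_on_def
  by (auto intro: C_k_on_const C_k_on_linear C_k_on_add C_k_on_bilinear[OF bounded_bilinear_mult]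
      C_k_on_bilinear[OF bounded_bilinear_scaleR] C_k_on_bilinear[OF bounded_bilinear_inner] C_k_on_compose_real)

lemma smooth_on_sum: "(\<And>i. i \<in> I \<Longrightarrow> smooth_on S (f i)) \<Longrightarrow> smooth_on S (\<lambda>x. \<Sum>i\<in>I. f i x)"
  unfolding smooth_on_def by (auto intro: C_k_on_sum)

lemma smooth_on_imp_continuous_on: "smooth_on S f \<Longrightarrow> continuous_on S f"
  unfolding smooth_on_def by (metis C_k_on.simps(1))

lemma smooth_on_deriv:
  fixes f :: "real \<Rightarrow> real"
  assumes "smooth_on UNIV f"
  shows "(f has_real_derivative deriv f x) (at x)" and "smooth_on UNIV (deriv f)"
proof -
  have *: "C_k_on k UNIV (deriv f) \<and> (f has_real_derivative deriv f x) (at x)" for k x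
  proof -
    obtain f' where f': "\<And>x. (f has_derivative f' x) (at x)" and "\<And>v. C_k_on k UNIV (\<lambda>x. f' x v)"
      using assms unfolding smooth_on_def by (metis C_k_on.simps(2) UNIV_I)
    have D: "(f has_real_derivative f' x 1) (at x)" for x
    proof -
      have "f' x = (*) (f' x 1)"
        using has_derivative_linear[OF f'[of x]]
        by (auto simp: fun_eq_iff) (metis linear_scale mult.commute mult.right_neutral real_scaleR_def)
      then show ?thesis
        using f' by (metis has_field_derivative_def)
    qed
    then have "deriv f x = f' x 1" for x
      by (rule DERIV_imp_deriv)
    then show ?thesis
      using \<open>C_k_on k UNIV (\<lambda>x. f' x 1)\<close> D by presburger
  qed
  show "(f has_real_derivative deriv f x) (at x)" "smooth_on UNIV (deriv f)"
    using * unfolding smooth_on_def by auto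
qed

text \<open>All members gain one order at once: if every member is of class C^k, so is every
  derivative, being a combination of two members. The instances are cosine with sine, and the
  functions \<open>flat n\<close>.\<close>

lemma smooth_on_real_family:
  fixes f :: "'i \<Rightarrow> real \<Rightarrow> real"
  assumes D: "\<And>i x. i \<in> I \<Longrightarrow> (f i has_real_derivative f' i x) (at x)"
    and f': "\<And>i. i \<in> I \<Longrightarrow> \<exists>j\<in>I. \<exists>k\<in>I. \<exists>c d. f' i = (\<lambda>x. c * f j x + d * f k x)"
    and "i \<in> I"
  shows "smooth_on UNIV (f i)"
proof -
  have "C_k_on k UNIV (f i)" if "i \<in> I" for k i
    using that
  proof (induction k arbitrary: i)
    case 0
    then show ?case
      using D DERIV_isCont by (force simp: continuous_on_eq_continuous_at)
  next
    case (Suc k)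
    obtain j l c d where j: "j \<in> I" "l \<in> I" "f' i = (\<lambda>x. c * f j x + d * f l x)"
      using f'[OF Suc.prems] by blast
    have f'C: "C_k_on k UNIV (f' i)"
      unfolding j(3)
      by (intro C_k_on_add C_k_on_bilinear[OF bounded_bilinear_mult] C_k_on_const Suc.IH j)
    have "(f i has_derivative (\<lambda>v. f' i x * v)) (at x)" for x
      using D[OF Suc.prems] by (simp add: has_field_derivative_def)
    moreover have "C_k_on k UNIV (\<lambda>x. f' i x * v)" for v
      by (rule C_k_on_bilinear[OF bounded_bilinear_mult f'C C_k_on_const])
    ultimately show ?case
      unfolding C_k_on.simps by (intro exI[of _ "\<lambda>x v. f' i x * v"]) auto
  qed
  with \<open>i \<in> I\<close> show ?thesis
    unfolding smooth_on_def by blast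
qed

section \<open>Trigonometric functions and smooth bump functions\<close>

lemma smooth_on_cos_sin: "smooth_on UNIV (cos :: real \<Rightarrow> real)" "smooth_on UNIV (sin :: real \<Rightarrow> real)"
proof -
  let ?f = "\<lambda>i::bool. if i then cos else sin :: real \<Rightarrow> real"
  let ?f' = "\<lambda>i::bool. if i then (\<lambda>x. - sin x) else cos :: real \<Rightarrow> real"
  have "smooth_on UNIV (?f i)" for i
  proof (rule smooth_on_real_family[where I = UNIV and f' = ?f'])
    show "(?f i has_real_derivative ?f' i x) (at x)" for i x
      by (auto intro: DERIV_cos DERIV_sin)
    have "?f' i = (\<lambda>x. (if i then 0 else 1) * ?f True x + (if i then -1 else 0) * ?f False x)" for i
      by auto
    then show "\<exists>j\<in>UNIV. \<exists>k\<in>UNIV. \<exists>c d. ?f' i = (\<lambda>x. c * ?f j x + d * ?f k x)" for i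
      by blast
  qed auto
  from this[of True] this[of False] show "smooth_on UNIV (cos :: real \<Rightarrow> real)" "smooth_on UNIV (sin :: real \<Rightarrow> real)"
    by auto
qed

text \<open>The family \<open>flat n\<close> spans a space of functions that is closed under differentiation.\<close>

definition flat :: "nat \<Rightarrow> real \<Rightarrow> real" where
  "flat n x = (if 0 < x then (1 / x) ^ n * exp (- (1 / x)) else 0)"

text \<open>Substituting y = 1/x turns the right-hand limit into the decay of y^n exp(-y) at
  infinity; on the left the function is 0.\<close>

lemma flat_tendsto_0: "(flat n \<longlongrightarrow> 0) (at 0)"
proof -
  have "((\<lambda>y::real. y ^ n * exp (- y)) \<longlongrightarrow> 0) at_top"
    using tendsto_power_div_exp_0[of n] by (simp add: exp_minus field_simps)
  then have "((\<lambda>x::real. inverse x ^ n * exp (- inverse x)) \<longlongrightarrow> 0) (at_right 0)"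
    using filterlim_compose[OF _ filterlim_inverse_at_top_right] by blast
  then have "(flat n \<longlongrightarrow> 0) (at_right 0)"
    by (rule Lim_transform_eventually)
      (auto simp: flat_def eventually_at_right_less inverse_eq_divide eventually_at_filter)
  moreover have "(flat n \<longlongrightarrow> 0) (at_left 0)"
    by (rule Lim_transform_eventually[OF tendsto_const]) (auto simp: flat_def eventually_at_filter)
  ultimately show ?thesis
    by (simp add: filterlim_split_at)
qed

lemma flat_has_derivative:
  "(flat n has_real_derivative flat (n + 2) x - real n * flat (n + 1) x) (at x)"
proof (cases "x = 0")
  case True
  \<comment> \<open>At 0 the difference quotient of \<open>flat n\<close> is exactly
    \<open>flat (n + 1)\<close>, so the limit already computed is the derivative.\<close>
  have "(\<lambda>h. (flat n (0 + h) - flat n 0) / h) = flat (n + 1)"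
    by (auto simp: flat_def fun_eq_iff)
  then show ?thesis
    using flat_tendsto_0[of "n + 1"] True by (simp add: DERIV_def) (simp add: flat_def)
next
  case False
  then consider "x < 0" | "x > 0"
    by linarith
  then show ?thesis
  proof cases
    case 1
    have "((\<lambda>x. 0) has_real_derivative 0) (at x)"
      by simp
    then have "(flat n has_real_derivative 0) (at x)"
      by (rule has_field_derivative_transform_within_open[where S = "{..<0}"])
         (use 1 in \<open>auto simp: flat_def\<close>)
    then show ?thesis
      using 1 by (simp add: flat_def)
  next
    case 2
    let ?D = "(1 / x) ^ n * (exp (- (1 / x)) * (1 / x ^ 2)) + (real n * (1 / x) ^ (n - 1) * (- (1 / x ^ 2))) * exp (- (1 / x))"
    have "((\<lambda>x. (1 / x) ^ n * exp (- (1 / x))) has_real_derivative ?D) (at x)"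
      using 2 by (auto intro!: derivative_eq_intros simp: power2_eq_square)
    then have "(flat n has_real_derivative ?D) (at x)"
      by (rule has_field_derivative_transform_within_open[where S = "{0<..}"])
         (use 2 in \<open>auto simp: flat_def\<close>)
    moreover have "?D = flat (n + 2) x - real n * flat (n + 1) x"
      using 2 by (cases n) (auto simp: flat_def field_simps power2_eq_square)
    ultimately show ?thesis
      by simp
  qed
qed

lemma smooth_on_flat: "smooth_on UNIV (flat n)"
proof (rule smooth_on_real_family[where I = UNIV])
  show "(flat i has_real_derivative flat (i + 2) x - real i * flat (i + 1) x) (at x)" for i x
    by (rule flat_has_derivative)
  show "\<exists>j\<in>UNIV. \<exists>k\<in>UNIV. \<exists>c d. (\<lambda>x. flat (i + 2) x - real i * flat (i + 1) x) = (\<lambda>x. c * flat j x + d * flat k x)" for i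
    by (rule bexI[of _ "i + 2"], rule bexI[of _ "i + 1"], rule exI[of _ 1], rule exI[of _ "- real i"]) auto
qed auto

text \<open>The classical cut-off: exp(-1/(x-a)) exp(-1/(b-x)) strictly between \<open>a\<close> and
  \<open>b\<close>, and 0 elsewhere.\<close>

definition bump :: "real \<Rightarrow> real \<Rightarrow> real \<Rightarrow> real" where
  "bump a b x = flat 0 (x - a) * flat 0 (b - x)"

lemma smooth_on_bump: "smooth_on UNIV (bump a b)"
proof -
  have "smooth_on UNIV (\<lambda>x. x + (- a))" "smooth_on UNIV (\<lambda>x. b + (-1) * x)"
    by (intro smooth_on_add smooth_on_mult smooth_on_const smooth_on_linear bounded_linear_ident)+
  then show ?thesis
    unfolding bump_def[abs_def]
    by (intro smooth_on_mult smooth_on_compose_real[OF smooth_on_flat]) auto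
qed

lemma bump_eq_0_iff: "bump a b x = 0 \<longleftrightarrow> \<not> (a < x \<and> x < b)"
  by (auto simp: bump_def flat_def)

section \<open>Twist maps\<close>

lemma inner_plane: "(x::plane) \<bullet> y = x $ 1 * y $ 1 + x $ 2 * y $ 2"
  by (simp add: inner_vec_def sum_2)

text \<open>Rotation by a quarter turn: multiplication by i when the plane is read as the complex
  numbers.\<close>

definition J :: "plane \<Rightarrow> plane" where
  "J x = vector [- x $ 2, x $ 1]"

lemma J_nth [simp]: "J x $ 1 = - x $ 2" "J x $ 2 = x $ 1"
  by (simp_all add: J_def)

lemma plane_eq_iff: "(x::plane) = y \<longleftrightarrow> x $ 1 = y $ 1 \<and> x $ 2 = y $ 2"
  by (simp add: vec_eq_iff forall_2)

lemma linear_J: "linear J"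
  by (rule linearI) (auto simp: plane_eq_iff)

lemma bounded_linear_J: "bounded_linear J"
  using linear_J by (simp add: linear_conv_bounded_linear)

lemma J_simps [simp]: "J (J x) = - x" "x \<bullet> J x = 0" "J x \<bullet> x = 0" "norm (J x) = norm x" "J x \<bullet> J x = x \<bullet> x"
  by (auto simp: plane_eq_iff inner_plane norm_eq_sqrt_inner algebra_simps)

text \<open>The angle is a function of the squared radius, a polynomial in x, so smoothness of
  \<open>a\<close> alone gives smoothness at the centre.\<close>

definition twist :: "(real \<Rightarrow> real) \<Rightarrow> plane \<Rightarrow> plane" where
  "twist a x = cos (a (x \<bullet> x)) *\<^sub>R x + sin (a (x \<bullet> x)) *\<^sub>R J x"

lemma twist_inner_self [simp]: "twist a x \<bullet> twist a x = x \<bullet> x"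
proof -
  define c s where "c = cos (a (x \<bullet> x))" and "s = sin (a (x \<bullet> x))"
  have "c\<^sup>2 + s\<^sup>2 = 1"
    by (simp add: c_def s_def)
  moreover have "twist a x \<bullet> twist a x = (c\<^sup>2 + s\<^sup>2) * (x \<bullet> x)"
    by (simp add: twist_def flip: c_def s_def)
      (simp add: inner_plane power2_eq_square algebra_simps)
  ultimately show ?thesis
    by simp
qed

lemma norm_twist [simp]: "norm (twist a x) = norm x"
  by (simp add: norm_eq_sqrt_inner)

text \<open>The inner twist preserves x \<bullet> x, so both angles are read off at the same value
  and add up.\<close>

lemma twist_add: "twist (\<lambda>\<rho>. a \<rho> + b \<rho>) x = twist a (twist b x)"
proof -
  have "twist a (twist b x) = cos (a (x \<bullet> x)) *\<^sub>R twist b x + sin (a (x \<bullet> x)) *\<^sub>R J (twist b x)"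
    by (simp add: twist_def[of a])
  then show ?thesis
    by (simp add: twist_def[of _ x] cos_add sin_add plane_eq_iff algebra_simps)
qed

lemma twist_eq_self: "a (x \<bullet> x) = 0 \<Longrightarrow> twist a x = x"
  by (simp add: twist_def)

lemma twist_inverse: "twist (\<lambda>\<rho>. - a \<rho>) (twist a x) = x" "twist a (twist (\<lambda>\<rho>. - a \<rho>) x) = x"
  by (simp_all flip: twist_add add: twist_eq_self)

lemma smooth_on_twist:
  assumes "smooth_on UNIV a"
  shows "smooth_on S (twist a)"
    and "smooth_on T (\<lambda>(t, x). twist (\<lambda>\<rho>. t * a \<rho>) x)"
proof -
  show "smooth_on S (twist a)"
    unfolding twist_def[abs_def]
    by (intro smooth_on_add smooth_on_scaleR smooth_on_inner assms
        smooth_on_compose_real[OF smooth_on_cos_sin(1)] smooth_on_compose_real[OF smooth_on_cos_sin(2)]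
        smooth_on_compose_real[OF assms] smooth_on_linear bounded_linear_J bounded_linear_ident)
  have "smooth_on T (\<lambda>z. J (snd z))"
    by (intro smooth_on_linear bounded_linear_compose[OF bounded_linear_J] bounded_linear_snd)
  then show "smooth_on T (\<lambda>(t, x). twist (\<lambda>\<rho>. t * a \<rho>) x)"
    unfolding twist_def[abs_def] case_prod_beta
    by (intro smooth_on_add smooth_on_scaleR smooth_on_mult smooth_on_inner
        smooth_on_compose_real[OF smooth_on_cos_sin(1)] smooth_on_compose_real[OF smooth_on_cos_sin(2)]
        smooth_on_compose_real[OF assms] \<open>smooth_on T (\<lambda>z. J (snd z))\<close>
        smooth_on_linear[OF bounded_linear_fst] smooth_on_linear[OF bounded_linear_snd])
qed

lemma twist_has_vector_derivative:
  "((\<lambda>t. twist (\<lambda>\<rho>. t * a \<rho>) x) has_vector_derivative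
     a (x \<bullet> x) *\<^sub>R J (twist (\<lambda>\<rho>. t * a \<rho>) x)) (at t within T)"
  unfolding twist_def
  by (auto intro!: derivative_eq_intros simp: plane_eq_iff has_real_derivative_iff_has_vector_derivative[symmetric]
      algebra_simps)

lemma twist_has_derivative:
  fixes a :: "real \<Rightarrow> real"
  assumes "\<And>\<rho>. (a has_real_derivative a' \<rho>) (at \<rho>)"
  shows "(twist a has_derivative (\<lambda>v. cos (a (x \<bullet> x)) *\<^sub>R v + sin (a (x \<bullet> x)) *\<^sub>R J v +
      (2 * a' (x \<bullet> x) * (x \<bullet> v)) *\<^sub>R (cos (a (x \<bullet> x)) *\<^sub>R J x - sin (a (x \<bullet> x)) *\<^sub>R x))) (at x within S)"
proof -
  have a: "((\<lambda>x. a (x \<bullet> x)) has_derivative (\<lambda>v. 2 * a' (x \<bullet> x) * (x \<bullet> v))) (at x within S)" for x :: plane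
  proof -
    have "((\<lambda>x. x \<bullet> x) has_derivative (\<lambda>v. 2 * (x \<bullet> v))) (at x within S)"
      by (auto intro!: derivative_eq_intros simp: inner_commute)
    from has_derivative_compose[OF this, of a "(*) (a' (x \<bullet> x))"] show ?thesis
      using assms by (simp add: has_field_derivative_def mult_ac)
  qed
  show ?thesis
    unfolding twist_def[abs_def]
    by (rule derivative_eq_intros a bounded_linear_imp_has_derivative[OF bounded_linear_J] refl)+
      (auto simp: plane_eq_iff algebra_simps)
qed

text \<open>The differential is a rotation composed with the map v + 2 a' (x \<bullet> v) J x. As x
  is orthogonal to J x, this map is a shear of determinant 1.\<close>

lemma area_preserving_twist:
  assumes "smooth_on UNIV a"
  shows "area_preserving (twist a)"
  unfolding area_preserving_def
proof (intro ballI impI)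
  fix A :: "plane set"
  assume A: "A \<in> sets lebesgue" "A \<subseteq> disc"
  then have Am: "A \<in> lmeasurable"
    using bounded_set_imp_lmeasurable bounded_subset bounded_cball by blast
  let ?D = "\<lambda>x v. cos (a (x \<bullet> x)) *\<^sub>R v + sin (a (x \<bullet> x)) *\<^sub>R J v +
      (2 * deriv a (x \<bullet> x) * (x \<bullet> v)) *\<^sub>R (cos (a (x \<bullet> x)) *\<^sub>R J x - sin (a (x \<bullet> x)) *\<^sub>R x)"
  have D: "(twist a has_derivative ?D x) (at x within A)" for x
    by (intro twist_has_derivative smooth_on_deriv assms)
  have inj: "inj_on (twist a) A"
    by (rule inj_on_inverseI[of _ "twist (\<lambda>\<rho>. - a \<rho>)"]) (simp add: twist_inverse)
  have det: "det (matrix (?D x)) = 1" for x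
  proof -
    define c s A where "c = cos (a (x \<bullet> x))" and "s = sin (a (x \<bullet> x))" and "A = 2 * deriv a (x \<bullet> x)"
    have "c * c + s * s = 1"
      using sin_cos_squared_add3 unfolding c_def s_def by metis
    then show ?thesis
      unfolding det_2 matrix_def
      by (simp flip: c_def s_def A_def) (simp add: inner_plane axis_def, algebra)
  qed
  have one: "((\<lambda>x. 1) has_integral measure lebesgue A) A"
    using Am by (simp add: has_integral_iff lmeasurable_iff_integrable_on lmeasure_integral)
  have "twist a ` A \<in> lmeasurable \<and> measure lebesgue (twist a ` A) = measure lebesgue A"
    using has_measure_differentiable_image[OF A(1) D inj, of "measure lebesgue A"] one by (simp add: det)
  then show "emeasure lebesgue (twist a ` A) = emeasure lebesgue A"
    using Am by (simp add: emeasure_eq_measure2)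
qed

lemma twist_in_disc_diffeos:
  assumes a: "smooth_on UNIV a" and "b < 1" and zero: "\<And>\<rho>. b \<le> \<rho> \<Longrightarrow> a \<rho> = 0"
  shows "twist a \<in> disc_diffeos"
proof -
  have bij: "bij_betw (twist a) disc disc"
    by (rule bij_betw_byWitness[where f' = "twist (\<lambda>\<rho>. - a \<rho>)"]) (auto simp: twist_inverse)
  have "smooth_on UNIV (\<lambda>\<rho>. - a \<rho>)"
    using smooth_on_mult[OF smooth_on_const[of _ "-1"] a] by simp
  then have "smooth_on disc (twist (\<lambda>\<rho>. - a \<rho>))"
    by (rule smooth_on_twist)
  moreover have "inv_into disc (twist a) x = twist (\<lambda>\<rho>. - a \<rho>) x" if "x \<in> disc" for x
    using that by (intro inv_into_f_eq) (use bij in \<open>auto simp: bij_betw_def twist_inverse\<close>)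
  ultimately have inv: "smooth_on disc (inv_into disc (twist a))"
    using smooth_on_cong by blast
  \<comment> \<open>The profile vanishes for squared radii from \<open>b\<close> on, hence the
    square root; the maximum covers negative \<open>b\<close>.\<close>
  define r where "r = sqrt (max 0 b)"
  have "r < 1"
    using \<open>b < 1\<close> by (simp add: r_def)
  have r: "twist a x = x" if "r \<le> norm x" for x
  proof (rule twist_eq_self, rule zero)
    have "max 0 b \<le> (norm x)\<^sup>2"
      using that unfolding r_def by (rule sqrt_le_D)
    then show "b \<le> x \<bullet> x"
      by (simp add: power2_norm_eq_inner)
  qed
  then have "twist a x = x" if "x \<notin> disc" for x
    using that \<open>r < 1\<close> by (intro r) (simp add: not_le)
  then show ?thesis
    unfolding disc_diffeos_def disc_diffeo_def identity_near_boundary_def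
    using bij inv smooth_on_twist[OF a] area_preserving_twist[OF a] r \<open>r < 1\<close> by auto
qed

lemma isotopy_twist:
  assumes a: "smooth_on UNIV a" and "b < 1" and zero: "\<And>\<rho>. b \<le> \<rho> \<Longrightarrow> a \<rho> = 0"
  shows "isotopy (\<lambda>t. twist (\<lambda>\<rho>. t * a \<rho>))"
proof -
  have "twist (\<lambda>\<rho>. t * a \<rho>) \<in> disc_diffeos" for t
    by (rule twist_in_disc_diffeos[of _ b]) (auto intro: smooth_on_mult smooth_on_const assms)
  then show ?thesis
    unfolding isotopy_def smooth_family_def using smooth_on_twist[OF a] by auto
qed

text \<open>The difference of two derivatives is a derivative of 0 within \<open>S\<close>. Along
  the segment from x to a point y of \<open>S\<close> it must kill y - x, and a ball inside
  \<open>S\<close> supplies differences of such vectors in every direction.\<close>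

lemma has_derivative_within_unique_convex:
  fixes f :: "'a::euclidean_space \<Rightarrow> 'b::real_normed_vector"
  assumes S: "convex S" "interior S \<noteq> {}" "x \<in> S"
    and f': "(f has_derivative f') (at x within S)" and f'': "(f has_derivative f'') (at x within S)"
  shows "f' = f''"
proof -
  define l where "l v = f' v - f'' v" for v
  have D: "((\<lambda>x. 0) has_derivative l) (at x within S)"
    using has_derivative_diff[OF f' f''] by (simp add: l_def[abs_def])
  have lin: "linear l"
    using D has_derivative_linear by blast
  have 0: "l (y - x) = 0" if "y \<in> S" for y
  proof -
    let ?g = "\<lambda>s. x + s *\<^sub>R (y - x)"
    have sub: "?g ` {0..1} \<subseteq> S"
    proof
      fix z assume "z \<in> ?g ` {0..1}"
      then obtain s where "0 \<le> s" "s \<le> 1" "z = (1 - s) *\<^sub>R x + s *\<^sub>R y"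
        by (auto simp: algebra_simps)
      then show "z \<in> S"
        using S that by (simp add: convexD_alt)
    qed
    have "(?g has_derivative (\<lambda>s. s *\<^sub>R (y - x))) (at 0 within {0..1})"
      by (auto intro!: derivative_eq_intros)
    moreover have "((\<lambda>x. 0) has_derivative l) (at (?g 0) within ?g ` {0..1})"
      using has_derivative_subset[OF D sub] by simp
    ultimately have "((\<lambda>s::real. 0) has_derivative (\<lambda>s. l (s *\<^sub>R (y - x)))) (at 0 within {0..1})"
      by (rule has_derivative_in_compose)
    then have D1: "((\<lambda>s::real. 0) has_vector_derivative l (y - x)) (at 0 within cbox 0 1)"
      by (simp add: has_vector_derivative_def linear_scale[OF lin])
    have D2: "((\<lambda>s::real. 0) has_vector_derivative 0) (at 0 within cbox 0 1)"
      by simp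
    show ?thesis
      by (rule vector_derivative_unique_within_closed_interval[OF _ _ D1 D2]) auto
  qed
  obtain a e where "0 < e" and e: "ball a e \<subseteq> S"
    using S(2) by (metis ex_in_conv mem_interior)
  have "l w = 0" for w
  proof (cases "w = 0")
    case True
    then show ?thesis
      using linear_0[OF lin] by simp
  next
    case False
    define d where "d = e / (2 * norm w)"
    have "d > 0"
      using False \<open>0 < e\<close> by (simp add: d_def)
    have "a + d *\<^sub>R w \<in> ball a e" "a \<in> ball a e"
      using \<open>0 < e\<close> False by (simp_all add: dist_norm d_def)
    then have "l (a + d *\<^sub>R w - x) = 0" "l (a - x) = 0"
      by (simp_all only: 0[OF subsetD[OF e]])
    then have "l ((a + d *\<^sub>R w - x) - (a - x)) = 0"
      unfolding linear_diff[OF lin] by simp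
    then have "d *\<^sub>R l w = 0"
      by (simp add: linear_scale[OF lin])
    then show ?thesis
      using \<open>d > 0\<close> by simp
  qed
  then show ?thesis
    by (auto simp: l_def fun_eq_iff)
qed

text \<open>\<open>hamiltonian_field\<close> picks a derivative by choice; uniqueness lets any
  derivative at hand be used, also at boundary points.\<close>

lemma hamiltonian_field_eq:
  assumes "(h has_derivative h') (at x within disc)" "x \<in> disc"
  shows "hamiltonian_field h x = vector [h' (axis 2 1), - h' (axis 1 1)]"
proof -
  have D: "(h has_derivative frechet_derivative h (at x within disc)) (at x within disc)"
    using assms(1) by (meson differentiableI frechet_derivative_works)
  have "interior disc \<noteq> {}"
    by simp
  then have "frechet_derivative h (at x within disc) = h'"
    using has_derivative_within_unique_convex[OF convex_cball _ assms(2) D assms(1)] by blast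
  then show ?thesis
    by (simp add: hamiltonian_field_def)
qed

text \<open>The gradient of F(|x|^2) is 2 F' x, and the Hamiltonian field is minus its quarter turn.
  It is tangent to the circles about the centre, so each orbit is a rotation with constant angular
  speed -2 F'.\<close>

lemma generates_twist:
  assumes F: "smooth_on UNIV F" and "b < 1" and zero: "\<And>\<rho>. b \<le> \<rho> \<Longrightarrow> F \<rho> = 0"
  shows "generates (\<lambda>t x. F (x \<bullet> x)) (twist (\<lambda>\<rho>. - 2 * deriv F \<rho>))"
proof -
  have "smooth_family (\<lambda>t x. F (x \<bullet> x))"
    unfolding smooth_family_def case_prod_beta
    by (intro smooth_on_inner smooth_on_compose_real[OF F] smooth_on_linear bounded_linear_snd)
  moreover have "sqrt (max 0 b) < 1" "F (x \<bullet> x) = 0" if "sqrt (max 0 b) \<le> norm x" for x :: plane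
  proof -
    have "max 0 b \<le> (norm x)\<^sup>2"
      using that by (rule sqrt_le_D)
    then show "F (x \<bullet> x) = 0"
      using zero by (simp add: power2_norm_eq_inner)
    show "sqrt (max 0 b) < 1"
      using \<open>b < 1\<close> by simp
  qed
  moreover have "sqrt (max 0 b) < 1"
    using \<open>b < 1\<close> by simp
  ultimately have H: "hamiltonian_on_disc (\<lambda>t x. F (x \<bullet> x))"
    unfolding hamiltonian_on_disc_def by blast
  have field: "hamiltonian_field (\<lambda>x. F (x \<bullet> x)) x = (- 2 * deriv F (x \<bullet> x)) *\<^sub>R J x" if "x \<in> disc" for x
  proof -
    have "((\<lambda>x. x \<bullet> x) has_derivative (\<lambda>v. 2 * (x \<bullet> v))) (at x within disc)"
      by (auto intro!: derivative_eq_intros simp: inner_commute)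
    from has_derivative_compose[OF this, of F "(*) (deriv F (x \<bullet> x))"]
    have "((\<lambda>x. F (x \<bullet> x)) has_derivative (\<lambda>v. deriv F (x \<bullet> x) * (2 * (x \<bullet> v)))) (at x within disc)"
      using smooth_on_deriv(1)[OF F] by (simp add: has_field_derivative_def)
    from hamiltonian_field_eq[OF this that] show ?thesis
      by (simp add: plane_eq_iff inner_axis)
  qed
  have "hamiltonian_flow (\<lambda>t x. F (x \<bullet> x)) (\<lambda>t. twist (\<lambda>\<rho>. t * (- 2 * deriv F \<rho>)))"
    unfolding hamiltonian_flow_def
  proof (intro ballI conjI)
    show "twist (\<lambda>\<rho>. 0 * (- 2 * deriv F \<rho>)) x = x" for x
      by (simp add: twist_eq_self)
    fix x :: plane and t :: real
    assume x: "x \<in> disc"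
    then show "twist (\<lambda>\<rho>. t * (- 2 * deriv F \<rho>)) x \<in> disc"
      by simp
    then show "((\<lambda>s. twist (\<lambda>\<rho>. s * (- 2 * deriv F \<rho>)) x) has_vector_derivative
        hamiltonian_field (\<lambda>x. F (x \<bullet> x)) (twist (\<lambda>\<rho>. t * (- 2 * deriv F \<rho>)) x)) (at t within {0..1})"
      using twist_has_vector_derivative[of "\<lambda>\<rho>. - 2 * deriv F \<rho>" x] by (simp add: field)
  qed
  then show ?thesis
    unfolding generates_def using H
    by (intro conjI exI[of _ "\<lambda>t. twist (\<lambda>\<rho>. t * (- 2 * deriv F \<rho>))"]) auto
qed

section \<open>Winding of pairs of points\<close>

text \<open>The derivative of the argument of z when z moves with velocity w. At z = 0 division by
  zero yields 0, so a pair of equal points has winding 0.\<close>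

definition angular_speed :: "plane \<Rightarrow> plane \<Rightarrow> real" where
  "angular_speed z w = (J z \<bullet> w) / (z \<bullet> z)"

definition to_complex :: "plane \<Rightarrow> complex" where
  "to_complex z = Complex (z $ 1) (z $ 2)"

lemma to_complex_eq_0_iff [simp]: "to_complex z = 0 \<longleftrightarrow> z = 0"
  by (simp add: to_complex_def plane_eq_iff complex_eq_iff)

lemma bounded_linear_to_complex: "bounded_linear to_complex"
proof -
  have "linear to_complex"
    by (rule linearI) (auto simp: to_complex_def complex_eq_iff)
  then show ?thesis
    by (simp add: linear_conv_bounded_linear)
qed

lemma Im_divide_to_complex: "Im (to_complex w / to_complex z) = angular_speed z w"
  by (simp add: angular_speed_def to_complex_def Im_divide inner_plane power2_eq_square)

lemma Re_to_complex_cnj: "Re (to_complex z * cnj (to_complex e)) = z \<bullet> e"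
  by (simp add: to_complex_def inner_plane)

lemma continuous_on_angular_speed:
  assumes "continuous_on S f" "continuous_on S g" "\<And>x. x \<in> S \<Longrightarrow> f x \<noteq> 0"
  shows "continuous_on S (\<lambda>x. angular_speed (f x) (g x))"
  unfolding angular_speed_def using assms
  by (intro continuous_intros bounded_linear.continuous_on[OF bounded_linear_J]) auto

section \<open>The turning angle of a curve that avoids the origin\<close>

context
  fixes z z' :: "real \<Rightarrow> plane"
  assumes z: "\<And>t. t \<in> {0..1} \<Longrightarrow> (z has_vector_derivative z' t) (at t within {0..1})"
    and z': "continuous_on {0..1} z'"
    and nz: "\<And>t. t \<in> {0..1} \<Longrightarrow> z t \<noteq> 0"
begin

private lemma cont_z: "continuous_on {0..1} z"
  using z has_vector_derivative_continuous continuous_on_eq_continuous_within by blast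

private lemma to_complex_deriv:
  "t \<in> {0..1} \<Longrightarrow> ((\<lambda>t. to_complex (z t)) has_vector_derivative to_complex (z' t)) (at t within {0..1})"
  using z bounded_linear.has_vector_derivative[OF bounded_linear_to_complex] by blast

private lemma log_deriv_cont: "continuous_on {0..1} (\<lambda>t. to_complex (z' t) / to_complex (z t))"
  using nz by (intro continuous_on_divide bounded_linear.continuous_on[OF bounded_linear_to_complex] cont_z z') auto

private lemma Im_integral:
  "Im (integral {0..1} (\<lambda>t. to_complex (z' t) / to_complex (z t))) =
     integral {0..1} (\<lambda>t. angular_speed (z t) (z' t))"
proof -
  have "integral {0..1} (Im \<circ> (\<lambda>t. to_complex (z' t) / to_complex (z t))) =
    Im (integral {0..1} (\<lambda>t. to_complex (z' t) / to_complex (z t)))"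
    by (rule integral_linear[OF integrable_continuous_real[OF log_deriv_cont] bounded_linear_Im])
  then show ?thesis
    by (simp add: o_def Im_divide_to_complex)
qed

text \<open>The primitive E of z'/z is a continuous logarithm of z, up to the initial value: z
  exp(-E) has derivative 0. Its imaginary part is the turning angle, which the end points therefore
  determine modulo 2 pi.\<close>

lemma exp_angle_integral:
  "\<exists>E. to_complex (z 1) = to_complex (z 0) * exp E \<and> Im E = integral {0..1} (\<lambda>t. angular_speed (z t) (z' t))"
proof -
  let ?f = "\<lambda>t. to_complex (z' t) / to_complex (z t)"
  define E where "E t = integral {0..t} ?f" for t
  have E: "(E has_vector_derivative ?f t) (at t within {0..1})" if "t \<in> {0..1}" for t
    unfolding E_def using log_deriv_cont that by (rule integral_has_vector_derivative)
  have "((\<lambda>t. to_complex (z t) * exp (- E t)) has_derivative (\<lambda>h. 0)) (at t within {0..1})" if t: "t \<in> {0..1}" for t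
  proof -
    have "((\<lambda>t. - E t) has_vector_derivative - ?f t) (at t within {0..1})"
      by (rule has_vector_derivative_minus[OF E[OF t]])
    from field_vector_diff_chain_within[OF this, of exp "exp (- E t)"]
    have "((\<lambda>t. exp (- E t)) has_vector_derivative - ?f t * exp (- E t)) (at t within {0..1})"
      by (simp add: o_def DERIV_exp has_field_derivative_at_within)
    from has_vector_derivative_mult[OF to_complex_deriv[OF t] this]
    show ?thesis
      using nz[OF t] by (simp add: has_vector_derivative_def field_simps)
  qed
  then have "to_complex (z 1) * exp (- E 1) = to_complex (z 0) * exp (- E 0)"
    by (intro has_derivative_zero_unique[of "{0..1}" "\<lambda>t. to_complex (z t) * exp (- E t)"]) auto
  then have "to_complex (z 1) = to_complex (z 0) * exp (E 1)"
    by (simp add: E_def exp_minus field_simps)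
  then show ?thesis
    using Im_integral unfolding E_def by blast
qed

text \<open>Multiplication by the conjugate of e moves the curve into the right half plane, where
  the principal logarithm is a primitive of z'/z and has imaginary part strictly between -pi/2 and
  pi/2.\<close>

lemma angle_integral_half_plane:
  assumes pos: "\<And>t. t \<in> {0..1} \<Longrightarrow> 0 < z t \<bullet> e"
  shows "\<bar>integral {0..1} (\<lambda>t. angular_speed (z t) (z' t))\<bar> < pi"
proof -
  let ?r = "\<lambda>t. to_complex (z t) * cnj (to_complex e)"
  have "e \<noteq> 0"
    using pos[of 0] by auto
  have r: "0 < Re (?r t)" if "t \<in> {0..1}" for t
    using pos[OF that] by (simp only: Re_to_complex_cnj)
  have "((\<lambda>t. Ln (?r t)) has_vector_derivative to_complex (z' t) / to_complex (z t)) (at t within {0..1})"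
    if t: "t \<in> {0..1}" for t
  proof -
    have "(?r has_vector_derivative to_complex (z' t) * cnj (to_complex e)) (at t within {0..1})"
      using to_complex_deriv[OF t] by (rule has_vector_derivative_mult_left)
    moreover have "(Ln has_field_derivative inverse (?r t)) (at (?r t) within ?r ` {0..1})"
    proof (rule has_field_derivative_at_within, rule has_field_derivative_Ln)
      show "?r t \<notin> \<real>\<^sub>\<le>\<^sub>0"
        using r[OF t] by (metis complex_nonpos_Reals_iff not_le)
    qed
    ultimately have "(Ln \<circ> ?r has_vector_derivative (to_complex (z' t) * cnj (to_complex e)) * inverse (?r t)) (at t within {0..1})"
      by (rule field_vector_diff_chain_within)
    moreover have "(to_complex (z' t) * cnj (to_complex e)) * inverse (?r t) = to_complex (z' t) / to_complex (z t)"
      using \<open>e \<noteq> 0\<close> nz[OF t] by (simp add: field_simps)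
    ultimately show ?thesis
      by (simp add: o_def)
  qed
  then have "((\<lambda>t. to_complex (z' t) / to_complex (z t)) has_integral Ln (?r 1) - Ln (?r 0)) {0..1}"
    by (intro fundamental_theorem_of_calculus) auto
  then have "integral {0..1} (\<lambda>t. angular_speed (z t) (z' t)) = Im (Ln (?r 1)) - Im (Ln (?r 0))"
    using Im_integral by (simp add: integral_unique)
  moreover have "\<bar>Im (Ln (?r 1))\<bar> < pi / 2" "\<bar>Im (Ln (?r 0))\<bar> < pi / 2"
    by (intro Re_Ln_pos_lt_imp r; simp)+
  ultimately show ?thesis
    by linarith
qed

end

text \<open>\<open>g'\<close> is the velocity; no differentiability in the space variable is assumed.\<close>

locale motion =
  fixes g g' :: "real \<Rightarrow> plane \<Rightarrow> plane"
  assumes cont: "continuous_on ({0..1} \<times> disc) (\<lambda>(t, x). g t x)"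
    and cont': "continuous_on ({0..1} \<times> disc) (\<lambda>(t, x). g' t x)"
    and deriv: "\<And>t x. t \<in> {0..1} \<Longrightarrow> x \<in> disc \<Longrightarrow> ((\<lambda>s. g s x) has_vector_derivative g' t x) (at t within {0..1})"
    and inj: "\<And>t. t \<in> {0..1} \<Longrightarrow> inj_on (g t) disc"
    and in_disc: "\<And>t x. t \<in> {0..1} \<Longrightarrow> x \<in> disc \<Longrightarrow> g t x \<in> disc"
    and init: "\<And>x. x \<in> disc \<Longrightarrow> g 0 x = x"
    and boundary: "\<And>t x. t \<in> {0..1} \<Longrightarrow> norm x = 1 \<Longrightarrow> g t x = x"
begin

lemma continuous_on_g [continuous_intros]:
  assumes "continuous_on S p" "continuous_on S q" "p ` S \<subseteq> {0..1}" "q ` S \<subseteq> disc"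
  shows "continuous_on S (\<lambda>x. g (p x) (q x))"
proof -
  have "continuous_on S (\<lambda>x. case (p x, q x) of (t, x) \<Rightarrow> g t x)"
    by (rule continuous_on_compose2[OF cont continuous_on_Pair[OF assms(1,2)]]) (use assms(3,4) in auto)
  then show ?thesis
    by simp
qed

lemma continuous_on_g' [continuous_intros]:
  assumes "continuous_on S p" "continuous_on S q" "p ` S \<subseteq> {0..1}" "q ` S \<subseteq> disc"
  shows "continuous_on S (\<lambda>x. g' (p x) (q x))"
proof -
  have "continuous_on S (\<lambda>x. case (p x, q x) of (t, x) \<Rightarrow> g' t x)"
    by (rule continuous_on_compose2[OF cont' continuous_on_Pair[OF assms(1,2)]]) (use assms(3,4) in auto)
  then show ?thesis
    by simp
qed

lemma separated: "t \<in> {0..1} \<Longrightarrow> x \<in> disc \<Longrightarrow> y \<in> disc \<Longrightarrow> x \<noteq> y \<Longrightarrow> g t x - g t y \<noteq> 0"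
  using inj_onD[OF inj, of t x y] by auto

definition winding :: "plane \<Rightarrow> plane \<Rightarrow> real" where
  "winding x y = integral {0..1} (\<lambda>t. angular_speed (g t x - g t y) (g' t x - g' t y))"

lemma difference_deriv:
  "t \<in> {0..1} \<Longrightarrow> x \<in> disc \<Longrightarrow> y \<in> disc \<Longrightarrow>
    ((\<lambda>t. g t x - g t y) has_vector_derivative g' t x - g' t y) (at t within {0..1})"
  by (intro has_vector_derivative_diff deriv)

lemma continuous_winding: "x \<in> disc \<Longrightarrow> continuous_on (disc - {x}) (winding x)"
  unfolding winding_def[abs_def] interval_cbox
proof (rule integral_continuous_on_param, unfold case_prod_beta, rule continuous_on_angular_speed)
  assume x: "x \<in> disc"
  show "continuous_on ((disc - {x}) \<times> cbox 0 1) (\<lambda>p. g (snd p) x - g (snd p) (fst p))"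
    "continuous_on ((disc - {x}) \<times> cbox 0 1) (\<lambda>p. g' (snd p) x - g' (snd p) (fst p))"
    using x by (auto intro!: continuous_intros)
  show "g (snd p) x - g (snd p) (fst p) \<noteq> 0" if "p \<in> (disc - {x}) \<times> cbox 0 1" for p
    using that x by (intro separated) auto
qed

text \<open>Apart from \<open>E\<close>, the equation mentions only the end map, so two motions with
  the same end have windings that differ by a multiple of 2 pi.\<close>

lemma exp_winding:
  assumes "x \<in> disc" "y \<in> disc" "x \<noteq> y"
  shows "\<exists>E. to_complex (g 1 x - g 1 y) = to_complex (x - y) * exp E \<and> Im E = winding x y"
proof -
  have "continuous_on {0..1} (\<lambda>t. g' t x - g' t y)"
    using assms by (auto intro!: continuous_intros)
  from exp_angle_integral[OF difference_deriv this] show ?thesis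
    unfolding winding_def using assms separated by (simp add: init)
qed

text \<open>Seen from the fixed boundary point y, the moving point always lies in the open half
  plane of direction -y.\<close>

lemma winding_boundary:
  assumes "norm x < 1" "norm y = 1"
  shows "\<bar>winding x y\<bar> < pi"
  unfolding winding_def
proof (rule angle_integral_half_plane[where e = "- y"])
  have x: "x \<in> disc" and y: "y \<in> disc" and "x \<noteq> y"
    using assms by auto
  show "continuous_on {0..1} (\<lambda>t. g' t x - g' t y)"
    using x y by (auto intro!: continuous_intros)
  fix t :: real assume t: "t \<in> {0..1}"
  show "((\<lambda>t. g t x - g t y) has_vector_derivative g' t x - g' t y) (at t within {0..1})"
    using t x y by (rule difference_deriv)
  show "g t x - g t y \<noteq> 0"
    using t x y \<open>x \<noteq> y\<close> by (rule separated)
  \<comment> \<open>An interior point cannot reach the circle: it would land on a fixed point of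
    \<open>g t\<close>, against injectivity.\<close>
  have "norm (g t x) \<noteq> 1"
  proof
    assume 1: "norm (g t x) = 1"
    then have "g t (g t x) = g t x"
      using boundary t by blast
    then have "g t x = x"
      using inj_onD[OF inj[OF t]] in_disc[OF t x] x by blast
    with 1 assms show False
      by simp
  qed
  then have "norm (g t x) < 1"
    using in_disc[OF t x] by simp
  moreover have "g t x \<bullet> y \<le> norm (g t x) * norm y"
    by (rule norm_cauchy_schwarz)
  moreover have "g t y = y" "y \<bullet> y = 1"
    using boundary t assms by (auto simp: dot_square_norm)
  ultimately show "0 < (g t x - g t y) \<bullet> - y"
    using assms by (simp add: inner_diff_left)
qed

end

lemma aff_dim_disc: "aff_dim disc = 2"
  by (simp add: aff_dim_cball)

lemma winding_unique:
  assumes "motion g g'" "motion h h'"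
    and end_eq: "\<And>x. x \<in> disc \<Longrightarrow> g 1 x = h 1 x"
    and x: "norm x < 1" and y: "y \<in> disc" "x \<noteq> y"
  shows "motion.winding g g' x y = motion.winding h h' x y"
proof -
  interpret g: motion g g' by fact
  interpret h: motion h h' by fact
  define d where "d y = (g.winding x y - h.winding x y) / (2 * pi)" for y
  have xd: "x \<in> disc"
    using x by simp
  have d_int: "\<exists>n::int. d y = n" if y: "y \<in> disc - {x}" for y
  proof -
    obtain E where E: "to_complex (g 1 x - g 1 y) = to_complex (x - y) * exp E" "Im E = g.winding x y"
      using g.exp_winding[OF xd, of y] y by auto
    obtain F where F: "to_complex (h 1 x - h 1 y) = to_complex (x - y) * exp F" "Im F = h.winding x y"
      using h.exp_winding[OF xd, of y] y by auto
    have "exp E = exp F"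
      using E(1) F(1) end_eq xd y by auto
    then obtain n :: int where "E = F + of_int (2 * n) * pi * \<i>"
      using exp_eq by auto
    then have "Im E = Im F + 2 * n * pi"
      by simp
    then show ?thesis
      using E F by (intro exI[of _ n]) (simp add: d_def field_simps)
  qed
  have "d constant_on (disc - {x})"
  proof (rule continuous_discrete_range_constant)
    \<comment> \<open>Dimension 2 enters here: the punctured disc is connected, so the continuous
      integer-valued \<open>d\<close> is constant on it.\<close>
    show "connected (disc - {x})"
      by (rule connected_punctured_convex) (auto simp: aff_dim_disc)
    show "continuous_on (disc - {x}) d"
      unfolding d_def[abs_def]
      by (intro continuous_intros g.continuous_winding h.continuous_winding xd) auto
    fix a assume a: "a \<in> disc - {x}"
    have "1 \<le> norm (d b - d a)" if b: "b \<in> disc - {x}" and ne: "d b \<noteq> d a" for b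
    proof -
      obtain m n :: int where mn: "d b = m" "d a = n"
        using d_int[OF a] d_int[OF b] by blast
      with ne have "m \<noteq> n" by auto
      then have "1 \<le> \<bar>m - n\<bar>" by linarith
      then show ?thesis
        unfolding mn real_norm_def by linarith
    qed
    then show "\<exists>e>0. \<forall>b. b \<in> disc - {x} \<and> d b \<noteq> d a \<longrightarrow> e \<le> norm (d b - d a)"
      by (intro exI[of _ 1]) auto
  qed
  moreover define u :: plane where "u = axis 1 1"
  have "norm u = 1"
    by (simp add: u_def)
  then have u: "u \<in> disc - {x}"
    using x by auto
  ultimately have "d y = d u"
    using y by (auto simp: constant_on_def)
  moreover have "\<bar>d u\<bar> < 1"
    using g.winding_boundary[OF x \<open>norm u = 1\<close>] h.winding_boundary[OF x \<open>norm u = 1\<close>]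
    by (simp add: d_def abs_if field_simps split: if_splits)
  then have "d u = 0"
    using d_int[OF u] by auto
  ultimately show ?thesis
    by (simp add: d_def)
qed

section \<open>Integrals over the disc\<close>

text \<open>The definitions use the gauge integral over a set, whereas Fubini, image measures and
  dominated convergence are applied to the restricted Borel measure. For continuous functions on
  compact sets \<open>integrable_continuous_compact\<close> passes from one to the other.\<close>

abbreviation lborel_on :: "'a::euclidean_space set \<Rightarrow> 'a measure" where
  "lborel_on S \<equiv> restrict_space lborel S"

lemma space_lborel_on [simp]: "space (lborel_on S) = S"
  by (simp add: space_restrict_space)

lemma finite_measure_lborel_on:
  assumes "compact S"
  shows "finite_measure (lborel_on S)"
proof (rule finite_measureI)
  have "emeasure (lborel_on S) S = emeasure lborel S"
    using assms by (subst emeasure_restrict_space) (auto simp: borel_compact)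
  then show "emeasure (lborel_on S) (space (lborel_on S)) \<noteq> \<infinity>"
    using emeasure_bounded_finite[OF compact_imp_bounded[OF assms]] by auto
qed

lemma sigma_finite_lborel_on: "compact S \<Longrightarrow> sigma_finite_measure (lborel_on S)"
  by (rule finite_measure.axioms(1)[OF finite_measure_lborel_on])

lemma id_measurable_lborel_on: "(\<lambda>x. x) \<in> borel_measurable (lborel_on S)"
  by (rule measurable_restrict_space1) simp

lemma id_measurable_pair:
  fixes A :: "'a::second_countable_topology measure" and B :: "'b::second_countable_topology measure"
  assumes "(\<lambda>x. x) \<in> borel_measurable A" "(\<lambda>x. x) \<in> borel_measurable B"
  shows "(\<lambda>x. x) \<in> borel_measurable (A \<Otimes>\<^sub>M B)"
proof -
  have "(\<lambda>x. (fst x, snd x)) \<in> measurable (A \<Otimes>\<^sub>M B) (borel \<Otimes>\<^sub>M borel)"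
    using measurable_compose[OF measurable_fst assms(1)] measurable_compose[OF measurable_snd assms(2)]
    by (intro measurable_Pair) auto
  then show ?thesis
    by (simp add: borel_prod)
qed

text \<open>Measurability of the identity map is easily checked on products of restricted measures,
  so their sigma-algebra need not be described before continuous functions are known to be
  measurable.\<close>

lemma borel_measurable_continuous_on_space:
  fixes f :: "'a::topological_space \<Rightarrow> 'b::topological_space"
  assumes "(\<lambda>x. x) \<in> borel_measurable N" "continuous_on (space N) f"
  shows "f \<in> borel_measurable N"
proof -
  have "(\<lambda>x. x) \<in> measurable N (restrict_space borel (space N))"
    using assms(1) by (intro measurable_restrict_space2) auto
  from measurable_compose[OF this borel_measurable_continuous_on_restrict[OF assms(2)]]
  show ?thesis .
qed

lemma integrable_continuous_compact:
  fixes f :: "'a::euclidean_space \<Rightarrow> 'b::euclidean_space"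
  assumes "compact S" "continuous_on S f"
  shows "f integrable_on S" and "integrable (lborel_on S) f" and "integral\<^sup>L (lborel_on S) f = integral S f"
proof -
  have "set_integrable lborel S f"
    unfolding set_integrable_def using borel_integrable_compact[OF assms] by simp
  from set_borel_integral_eq_integral[OF this] this
  show "f integrable_on S" "integrable (lborel_on S) f" "integral\<^sup>L (lborel_on S) f = integral S f"
    using assms(1)
    by (auto simp: set_integrable_def set_lebesgue_integral_def integrable_restrict_space integral_restrict_space borel_compact)
qed

lemma nn_integral_continuous_compact:
  fixes f :: "'a::euclidean_space \<Rightarrow> real"
  assumes "compact S" "continuous_on S f" "\<And>x. x \<in> S \<Longrightarrow> 0 \<le> f x"
  shows "(\<integral>\<^sup>+x. ennreal (f x) \<partial>lborel_on S) = ennreal (integral S f)"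
  using assms integrable_continuous_compact[OF assms(1,2)]
  by (subst nn_integral_eq_integral) (auto intro!: AE_I2)

text \<open>By uniform continuity on the compact product the integrand changes by at most
  \<open>e'\<close> everywhere. The 1 added to the measure in \<open>e'\<close> covers sets of
  measure 0.\<close>

lemma continuous_on_integral_compact:
  fixes F :: "'a::metric_space \<Rightarrow> 'b::euclidean_space \<Rightarrow> real"
  assumes "compact A" "compact S" and F: "continuous_on (A \<times> S) (\<lambda>(t, x). F t x)"
  shows "continuous_on A (\<lambda>t. integral S (F t))"
proof -
  have cont: "continuous_on S (F t)" if "t \<in> A" for t
  proof -
    have "continuous_on S (\<lambda>x. case (t, x) of (t, x) \<Rightarrow> F t x)"
      by (rule continuous_on_compose2[OF F]) (use that in \<open>auto intro!: continuous_intros\<close>)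
    then show ?thesis
      by simp
  qed
  have lm: "S \<in> lmeasurable"
    using \<open>compact S\<close> by (rule lmeasurable_compact)
  show ?thesis
    unfolding continuous_on_iff
  proof (intro ballI allI impI)
    fix t :: 'a and e :: real
    assume t: "t \<in> A" and "0 < e"
    define e' where "e' = e / (measure lebesgue S + 1)"
    have "0 < measure lebesgue S + 1"
      by (simp add: add_nonneg_pos)
    then have "0 < e'" and e': "e' * measure lebesgue S < e"
      using \<open>0 < e\<close> by (auto simp: e'_def field_simps)
    have "uniformly_continuous_on (A \<times> S) (\<lambda>(t, x). F t x)"
      using F assms by (intro compact_uniformly_continuous compact_Times)
    then obtain d where "0 < d"
      and d: "\<And>z z'. z \<in> A \<times> S \<Longrightarrow> z' \<in> A \<times> S \<Longrightarrow> dist z' z < d \<Longrightarrow>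
          dist ((\<lambda>(t, x). F t x) z') ((\<lambda>(t, x). F t x) z) < e'"
      unfolding uniformly_continuous_on_def using \<open>0 < e'\<close> by metis
    have "dist (integral S (F s)) (integral S (F t)) < e" if s: "s \<in> A" "dist s t < d" for s
    proof -
      have le: "norm (F s x - F t x) \<le> e'" if "x \<in> S" for x
        using d[of "(t, x)" "(s, x)"] s t that by (simp add: dist_Pair_Pair dist_real_def)
      have int: "F s integrable_on S" "F t integrable_on S"
        using cont s t integrable_continuous_compact(1)[OF \<open>compact S\<close>] by auto
      have "integral S (F s) - integral S (F t) = integral S (\<lambda>x. F s x - F t x)"
        using int by (simp add: Henstock_Kurzweil_Integration.integral_diff)
      also have "norm \<dots> \<le> integral S (\<lambda>x. e')"
        using int le lm by (intro integral_norm_bound_integral integrable_diff integrable_on_const) auto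
      also have "\<dots> = e' * measure lebesgue S"
        using lm integral_mult_right[of S e' "\<lambda>x. 1"] by (simp add: lmeasure_integral)
      finally show ?thesis
        using e' by (simp add: dist_norm)
    qed
    then show "\<exists>d>0. \<forall>s\<in>A. dist s t < d \<longrightarrow> dist (integral S (F s)) (integral S (F t)) < e"
      using \<open>0 < d\<close> by blast
  qed
qed

section \<open>The kernel 1 / |z| and the comparison of L1 with Lp on the disc\<close>

lemma measure_disc: "measure lebesgue disc = pi"
  by (simp add: content_cball unit_ball_vol_2)

text \<open>The kernel is dominated by the sum over k of 2^k times the indicator of the ball of
  radius 2 / 2^k about \<open>a\<close>. The k-th term has integral 4 pi / 2^k, and the geometric
  series gives 8 pi.\<close>

lemma nn_integral_inverse_distance:
  fixes a :: plane
  assumes a: "a \<in> disc"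
  shows "(\<integral>\<^sup>+y. ennreal (1 / norm (a - y)) \<partial>lborel_on disc) \<le> ennreal (8 * pi)"
proof -
  let ?F = "\<lambda>k::nat. \<lambda>y. ennreal (2 ^ k) * indicator (cball a (2 / 2 ^ k)) y"
  have le: "ennreal (1 / norm (a - y)) * indicator disc y \<le> (\<Sum>k. ?F k y)" for y
  proof (cases "y \<in> disc \<and> y \<noteq> a")
    case True
    then have r: "0 < norm (a - y)" "norm (a - y) \<le> 2"
      using a norm_triangle_ineq4[of a y] by auto
    have ex: "\<exists>k. 1 / 2 ^ k < norm (a - y)"
      using real_arch_pow_inv[OF r(1), of "1 / 2"] by (simp add: power_one_over)
    \<comment> \<open>Minimality traps the distance between 1 / 2^k and 2 / 2^k; for k = 0 the upper
      bound is the diameter of the disc.\<close>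
    define k where "k = (LEAST k. 1 / 2 ^ k < norm (a - y))"
    have k: "1 / 2 ^ k < norm (a - y)"
      unfolding k_def by (rule LeastI_ex[OF ex])
    have "norm (a - y) \<le> 2 / 2 ^ k"
    proof (cases k)
      case (Suc j)
      then have "\<not> 1 / 2 ^ j < norm (a - y)"
        using not_less_Least[of j] unfolding k_def by (metis lessI)
      then show ?thesis
        by (simp add: Suc)
    qed (use r in simp)
    then have y: "y \<in> cball a (2 / 2 ^ k)"
      by (simp add: dist_norm)
    have "1 / norm (a - y) \<le> 2 ^ k"
      using k r by (simp add: field_simps)
    then have "ennreal (1 / norm (a - y)) \<le> ?F k y"
      using y by (simp add: ennreal_leI)
    also have "\<dots> = (\<Sum>j\<in>{k}. ?F j y)"
      by (simp only: sum.insert sum.empty finite.emptyI empty_iff not_False_eq_True add_0_right)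
    also have "\<dots> \<le> (\<Sum>k. ?F k y)"
      by (rule sum_le_suminf[OF summableI]) auto
    finally show ?thesis
      using True by simp
  qed auto
  have "(\<integral>\<^sup>+y. ennreal (1 / norm (a - y)) \<partial>lborel_on disc) =
      (\<integral>\<^sup>+y. ennreal (1 / norm (a - y)) * indicator disc y \<partial>lborel)"
    by (subst nn_integral_restrict_space) auto
  also have "\<dots> \<le> (\<integral>\<^sup>+y. (\<Sum>k. ?F k y) \<partial>lborel)"
    by (intro nn_integral_mono le)
  also have "\<dots> = (\<Sum>k. \<integral>\<^sup>+y. ?F k y \<partial>lborel)"
    by (rule nn_integral_suminf)
      (auto intro!: borel_measurable_times_ennreal borel_measurable_indicator borel_closed)
  also have "\<dots> = (\<Sum>k. ennreal (4 * pi * (1 / 2) ^ k))"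
  proof (rule suminf_cong)
    fix k
    have "(\<integral>\<^sup>+y. ?F k y \<partial>lborel) = ennreal (2 ^ k) * emeasure lborel (cball a (2 / 2 ^ k))"
      by (rule nn_integral_cmult_indicator) simp
    also have "emeasure lborel (cball a (2 / 2 ^ k)) = ennreal (pi * (2 / 2 ^ k)\<^sup>2)"
      by (subst emeasure_cball) (auto simp: unit_ball_vol_2)
    finally show "(\<integral>\<^sup>+y. ?F k y \<partial>lborel) = ennreal (4 * pi * (1 / 2) ^ k)"
      by (simp flip: ennreal_mult add: power2_eq_square power_one_over field_simps)
  qed
  also have "\<dots> = ennreal (8 * pi)"
  proof (rule suminf_ennreal_eq)
    have "(\<lambda>k. (1 / 2) ^ k :: real) sums 2"
      using geometric_sums[of "1 / 2 :: real"] by simp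
    from sums_mult[OF this, of "4 * pi"]
    show "(\<lambda>k. 4 * pi * (1 / 2) ^ k) sums (8 * pi)"
      by simp
  qed simp
  finally show ?thesis .
qed

text \<open>Windings are controlled by the L1 norm of the velocity; this passes to every p, with pi
  + 1 in place of the sharp constant pi^(1 - 1/p).\<close>

lemma integral_le_Lp:
  fixes f :: "plane \<Rightarrow> real"
  assumes f: "continuous_on disc f" "\<And>x. x \<in> disc \<Longrightarrow> 0 \<le> f x" and p: "1 \<le> p"
  shows "integral disc f \<le> (pi + 1) * (integral disc (\<lambda>x. f x powr p)) powr (1 / p)"
proof -
  define I where "I = integral disc (\<lambda>x. f x powr p)"
  have fp: "continuous_on disc (\<lambda>x. f x powr p)"
    using f p by (intro continuous_on_powr' continuous_on_const) auto
  note int = integrable_continuous_compact(1)[OF compact_cball f(1)] integrable_continuous_compact(1)[OF compact_cball fp]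
  have "0 \<le> I"
    unfolding I_def by (rule integral_nonneg[OF int(2)]) simp
  have le: "integral disc f \<le> pi * l + l powr (1 - p) * I" if "0 < l" for l
  proof -
    \<comment> \<open>This bound, optimised in \<open>l\<close>, replaces the inequality of Hoelder.\<close>
    have pw: "f x \<le> l + l powr (1 - p) * f x powr p" if x: "x \<in> disc" for x
    proof (cases "f x \<le> l")
      case True
      then show ?thesis
        by (simp add: add_increasing2)
    next
      case False
      then have "0 < f x" "l \<le> f x"
        using \<open>0 < l\<close> by auto
      then have "f x powr (1 - p) \<le> l powr (1 - p)"
        using \<open>0 < l\<close> p by (intro powr_mono2') auto
      then have "f x powr (1 - p) * f x powr p \<le> l powr (1 - p) * f x powr p"
        by (rule mult_right_mono) simp
      moreover have "f x powr (1 - p) * f x powr p = f x"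
        using \<open>0 < f x\<close> by (simp flip: powr_add)
      ultimately show ?thesis
        using \<open>0 < l\<close> by linarith
    qed
    have ci: "(\<lambda>x::plane. l) integrable_on disc"
      by (intro integrable_on_const) (simp add: lmeasurable_cball)
    have "integral disc f \<le> integral disc (\<lambda>x. l + l powr (1 - p) * f x powr p)"
      using int pw ci by (intro integral_le) (auto intro!: integrable_add integrable_on_mult_right)
    also have "\<dots> = integral disc (\<lambda>x::plane. l) + l powr (1 - p) * I"
      unfolding I_def using int ci
      by (subst Henstock_Kurzweil_Integration.integral_add) (auto intro!: integrable_on_mult_right)
    also have "integral disc (\<lambda>x::plane. l) = pi * l"
      using lmeasure_integral[OF lmeasurable_cball, of "0::plane" 1] measure_disc
        integral_mult_right[of disc l "\<lambda>x. 1"] by simp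
    finally show ?thesis .
  qed
  show ?thesis
  proof (cases "I = 0")
    case True
    \<comment> \<open>If the p-integral is 0, only the term pi * l remains, and l may be arbitrarily
      small.\<close>
    have "integral disc f \<le> 0 + e" if "0 < e" for e
      using le[of "e / pi"] that True by simp
    then have "integral disc f \<le> 0"
      by (rule field_le_epsilon)
    then show ?thesis
      using p by (simp flip: I_def add: True)
  next
    case False
    with \<open>0 \<le> I\<close> have "0 < I" by simp
    \<comment> \<open>For this value l^(1-p) * I = l, so the two terms add up to (pi + 1) *
      l.\<close>
    define l where "l = I powr (1 / p)"
    have "l powr (1 - p) * I = I powr ((1 / p) * (1 - p)) * I powr 1"
      using \<open>0 < I\<close> by (simp add: l_def powr_powr)
    also have "\<dots> = I powr ((1 / p) * (1 - p) + 1)"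
      by (simp only: powr_add)
    also have "(1 / p) * (1 - p) + 1 = 1 / p"
      using p by (simp add: field_simps)
    finally have "l powr (1 - p) * I = l"
      by (simp add: l_def)
    moreover have "0 < l"
      using \<open>0 < I\<close> by (simp add: l_def)
    ultimately show ?thesis
      using le[of l] by (simp add: l_def I_def[symmetric] algebra_simps)
  qed
qed

text \<open>\<open>area_preserving\<close> speaks of images and the image measure of preimages.
  Since \<open>g\<close> is a bijection, each set \<open>A\<close> is the image of its preimage
  \<open>B\<close>.\<close>

lemma distr_disc_diffeo:
  assumes "g \<in> disc_diffeos"
  shows "g \<in> measurable (lborel_on disc) (lborel_on disc)" and "distr (lborel_on disc) (lborel_on disc) g = lborel_on disc"
proof -
  have bij: "bij_betw g disc disc" and ap: "area_preserving g" and cont: "continuous_on disc g"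
    using assms by (auto simp: disc_diffeos_def disc_diffeo_def smooth_on_imp_continuous_on)
  have gb: "g \<in> borel_measurable (lborel_on disc)"
    using cont by (simp add: borel_measurable_continuous_on_space[OF id_measurable_lborel_on])
  have gr: "g \<in> measurable (lborel_on disc) (restrict_space borel disc)"
    using gb bij by (intro measurable_restrict_space2) (auto simp: bij_betw_def)
  have S: "sets (restrict_space borel disc :: plane measure) = sets (lborel_on disc)"
    by (simp add: sets_restrict_space)
  show g: "g \<in> measurable (lborel_on disc) (lborel_on disc)"
    using gr unfolding measurable_cong_sets[OF refl S] .
  show "distr (lborel_on disc) (lborel_on disc) g = lborel_on disc"
  proof (rule measure_eqI)
    fix A
    assume "A \<in> sets (distr (lborel_on disc) (lborel_on disc) g)"
    then have A: "A \<in> sets (lborel_on disc)"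
      by simp
    define B where "B = g -` A \<inter> disc"
    have B: "B \<in> sets (lborel_on disc)"
      using measurable_sets[OF g A] by (simp add: B_def)
    have sub: "A \<subseteq> disc" "A \<in> sets borel" "B \<subseteq> disc" "B \<in> sets borel"
      using A B by (auto simp: sets_restrict_space)
    have em: "emeasure (lborel_on disc) C = emeasure lebesgue C" if "C \<subseteq> disc" "C \<in> sets borel" for C :: "plane set"
      using that by (subst emeasure_restrict_space) auto
    have "g ` disc = disc"
      using bij by (simp add: bij_betw_def)
    then have "g ` B = A \<inter> disc"
      unfolding B_def by (force simp: image_iff)
    then have "g ` B = A"
      using sub(1) by blast
    moreover have "B \<in> sets lebesgue"
      using sub by (intro sets_completionI_sets) simp
    ultimately have "emeasure lebesgue A = emeasure lebesgue B"
      using ap sub unfolding area_preserving_def by blast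
    then show "emeasure (distr (lborel_on disc) (lborel_on disc) g) A = emeasure (lborel_on disc) A"
      using sub em by (simp add: emeasure_distr[OF g A] flip: B_def)
  qed simp
qed

section \<open>Winding and length\<close>

lemma id_measurable_time_disc_disc:
  "(\<lambda>z. z) \<in> borel_measurable (lborel_on {0..1::real} \<Otimes>\<^sub>M (lborel_on disc \<Otimes>\<^sub>M lborel_on disc))"
  by (intro id_measurable_pair id_measurable_lborel_on)

lemma borel_measurable_time_disc_disc:
  fixes f :: "real \<times> plane \<times> plane \<Rightarrow> 'b::topological_space"
  assumes "continuous_on ({0..1} \<times> disc \<times> disc) f"
  shows "f \<in> borel_measurable (lborel_on {0..1} \<Otimes>\<^sub>M (lborel_on disc \<Otimes>\<^sub>M lborel_on disc))"
  using assms by (intro borel_measurable_continuous_on_space[OF id_measurable_time_disc_disc])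
    (simp add: space_pair_measure)

lemma angular_speed_le: "\<bar>angular_speed z w\<bar> \<le> norm w / norm z"
proof (cases "z = 0")
  case False
  have "\<bar>J z \<bullet> w\<bar> \<le> norm z * norm w"
    using Cauchy_Schwarz_ineq2[of "J z" w] by simp
  then have "\<bar>J z \<bullet> w\<bar> / (norm z)\<^sup>2 \<le> (norm z * norm w) / (norm z)\<^sup>2"
    by (rule divide_right_mono) simp
  then show ?thesis
    using False by (simp add: angular_speed_def power2_eq_square flip: power2_norm_eq_inner)
qed (simp add: angular_speed_def)

context motion
begin

lemma winding_same [simp]: "winding x x = 0"
  by (simp add: winding_def angular_speed_def)

text \<open>The triangle inequality separates the speeds of the two points, so that in each summand
  the singular factor can be integrated over the other point.\<close>

lemma abs_winding_le:
  assumes x: "x \<in> disc" and y: "y \<in> disc"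
  shows "ennreal \<bar>winding x y\<bar> \<le> (\<integral>\<^sup>+t. ennreal (norm (g' t x) * (1 / norm (g t x - g t y))) +
     ennreal (norm (g' t y) * (1 / norm (g t x - g t y))) \<partial>lborel_on {0..1})"
proof (cases "x = y")
  case False
  let ?a = "\<lambda>t. angular_speed (g t x - g t y) (g' t x - g' t y)"
  have cont: "continuous_on {0..1} ?a"
    using x y separated[OF _ x y False] by (intro continuous_on_angular_speed continuous_intros) auto
  then have cont_abs: "continuous_on {0..1} (\<lambda>t. \<bar>?a t\<bar>)"
    by (intro continuous_intros)
  have "\<bar>winding x y\<bar> \<le> integral {0..1} (\<lambda>t. \<bar>?a t\<bar>)"
    unfolding winding_def real_norm_def[symmetric]
    by (rule integral_norm_bound_integral)
      (use integrable_continuous_real[OF cont] integrable_continuous_real[OF cont_abs] in auto)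
  then have "ennreal \<bar>winding x y\<bar> \<le> ennreal (integral {0..1} (\<lambda>t. \<bar>?a t\<bar>))"
    by (rule ennreal_leI)
  also have "\<dots> = (\<integral>\<^sup>+t. ennreal \<bar>?a t\<bar> \<partial>lborel_on {0..1})"
    using cont_abs by (subst nn_integral_continuous_compact) auto
  also have "\<dots> \<le> (\<integral>\<^sup>+t. ennreal (norm (g' t x) * (1 / norm (g t x - g t y))) +
     ennreal (norm (g' t y) * (1 / norm (g t x - g t y))) \<partial>lborel_on {0..1})"
  proof (rule nn_integral_mono)
    fix t
    have "\<bar>?a t\<bar> \<le> norm (g' t x - g' t y) / norm (g t x - g t y)"
      by (rule angular_speed_le)
    also have "\<dots> \<le> (norm (g' t x) + norm (g' t y)) / norm (g t x - g t y)"
      by (intro divide_right_mono norm_triangle_ineq4) simp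
    finally have "ennreal \<bar>?a t\<bar> \<le> ennreal (norm (g' t x) * (1 / norm (g t x - g t y)) + norm (g' t y) * (1 / norm (g t x - g t y)))"
      by (intro ennreal_leI) (simp add: add_divide_distrib)
    then show "ennreal \<bar>?a t\<bar> \<le> ennreal (norm (g' t x) * (1 / norm (g t x - g t y))) + ennreal (norm (g' t y) * (1 / norm (g t x - g t y)))"
      by (subst (asm) ennreal_plus) auto
  qed
  finally show ?thesis .
qed simp

text \<open>For fixed t and x the substitution u = g t y turns the singular factor into the
  reciprocal distance from g t x to u, with integral at most 8 pi. The summand with the speed of y
  becomes the other one when the variables are exchanged, which doubles the constant. Everything is
  nonnegative, so Tonelli's theorem suffices.\<close>

lemma nn_integral_winding_le:
  assumes pres: "\<And>t. t \<in> {0..1} \<Longrightarrow> g t \<in> measurable (lborel_on disc) (lborel_on disc) \<and>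
      distr (lborel_on disc) (lborel_on disc) (g t) = lborel_on disc"
  shows "(\<integral>\<^sup>+x. \<integral>\<^sup>+y. ennreal \<bar>winding x y\<bar> \<partial>lborel_on disc \<partial>lborel_on disc) \<le>
    ennreal (16 * pi) * (\<integral>\<^sup>+t. \<integral>\<^sup>+x. ennreal (norm (g' t x)) \<partial>lborel_on disc \<partial>lborel_on {0..1})"
proof -
  define M :: "plane measure" where "M = lborel_on disc"
  define T :: "real measure" where "T = lborel_on {0..1}"
  have spM: "space M = disc" and spT: "space T = {0..1}"
    by (simp_all add: M_def T_def)
  interpret M: sigma_finite_measure M
    unfolding M_def by (intro sigma_finite_lborel_on compact_cball)
  interpret T: sigma_finite_measure T
    unfolding T_def by (intro sigma_finite_lborel_on compact_Icc)
  interpret MM: pair_sigma_finite M M ..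
  interpret TMM: pair_sigma_finite T "M \<Otimes>\<^sub>M M" ..
  define K where "K t x y = ennreal (norm (g' t x) * (1 / norm (g t x - g t y)))" for t x y
  define L where "L t x y = K t x y + K t y x" for t x y
  have K: "(\<lambda>(t, x, y). K t x y) \<in> borel_measurable (T \<Otimes>\<^sub>M (M \<Otimes>\<^sub>M M))"
    and K': "(\<lambda>(t, x, y). K t y x) \<in> borel_measurable (T \<Otimes>\<^sub>M (M \<Otimes>\<^sub>M M))"
    unfolding K_def case_prod_beta T_def M_def
    by (intro measurable_compose[OF _ measurable_ennreal] borel_measurable_times borel_measurable_divide
        borel_measurable_const borel_measurable_time_disc_disc; auto intro!: continuous_intros)+
  have L: "(\<lambda>(t, x, y). L t x y) \<in> borel_measurable (T \<Otimes>\<^sub>M (M \<Otimes>\<^sub>M M))"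
    using borel_measurable_add[OF K K'] unfolding L_def case_prod_beta .
  have Kt: "(\<lambda>(x, y). K t x y) \<in> borel_measurable (M \<Otimes>\<^sub>M M)" if "t \<in> {0..1}" for t
    using measurable_compose[OF measurable_Pair1' K, of t] that by (simp add: spT)
  have K't: "(\<lambda>(x, y). K t y x) \<in> borel_measurable (M \<Otimes>\<^sub>M M)" if "t \<in> {0..1}" for t
    using measurable_compose[OF measurable_Pair1' K', of t] that by (simp add: spT)
  have bound: "(\<integral>\<^sup>+x. \<integral>\<^sup>+y. K t x y \<partial>M \<partial>M) \<le> ennreal (8 * pi) * (\<integral>\<^sup>+x. ennreal (norm (g' t x)) \<partial>M)"
    if t: "t \<in> {0..1}" for t
  proof -
    have gm: "g t \<in> measurable M M" and gd: "distr M M (g t) = M"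
      using pres[OF t] by (auto simp: M_def)
    have meas: "(\<lambda>u. ennreal (1 / norm (a - u))) \<in> borel_measurable M" for a :: plane
      unfolding M_def by (intro measurable_restrict_space1) measurable
    have "continuous_on disc (\<lambda>x. norm (g' t x))"
      using t by (auto intro!: continuous_intros)
    then have meas': "(\<lambda>x. ennreal (norm (g' t x))) \<in> borel_measurable M"
      unfolding M_def
      by (intro measurable_compose[OF borel_measurable_continuous_on_space[OF id_measurable_lborel_on] measurable_ennreal]) simp
    have "(\<integral>\<^sup>+y. K t x y \<partial>M) \<le> ennreal (norm (g' t x)) * ennreal (8 * pi)" if x: "x \<in> disc" for x
    proof -
      have "(\<integral>\<^sup>+y. ennreal (1 / norm (g t x - g t y)) \<partial>M) = (\<integral>\<^sup>+u. ennreal (1 / norm (g t x - u)) \<partial>distr M M (g t))"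
        by (subst nn_integral_distr[OF gm]) (use meas in simp_all)
      also have "\<dots> \<le> ennreal (8 * pi)"
        unfolding gd unfolding M_def using in_disc[OF t x] by (rule nn_integral_inverse_distance)
      finally have le: "(\<integral>\<^sup>+y. ennreal (1 / norm (g t x - g t y)) \<partial>M) \<le> ennreal (8 * pi)" .
      have "(\<integral>\<^sup>+y. K t x y \<partial>M) = (\<integral>\<^sup>+y. ennreal (norm (g' t x)) * ennreal (1 / norm (g t x - g t y)) \<partial>M)"
        unfolding K_def by (simp only: ennreal_mult' norm_ge_zero)
      also have "\<dots> = ennreal (norm (g' t x)) * (\<integral>\<^sup>+y. ennreal (1 / norm (g t x - g t y)) \<partial>M)"
        by (rule nn_integral_cmult) (rule measurable_compose[OF gm meas])
      also have "\<dots> \<le> ennreal (norm (g' t x)) * ennreal (8 * pi)"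
        by (intro mult_left_mono le) simp
      finally show ?thesis .
    qed
    then have "(\<integral>\<^sup>+x. \<integral>\<^sup>+y. K t x y \<partial>M \<partial>M) \<le> (\<integral>\<^sup>+x. ennreal (norm (g' t x)) * ennreal (8 * pi) \<partial>M)"
      by (intro nn_integral_mono) (simp add: spM)
    also have "\<dots> = (\<integral>\<^sup>+x. ennreal (norm (g' t x)) \<partial>M) * ennreal (8 * pi)"
      by (rule nn_integral_multc[OF meas'])
    finally show ?thesis
      by (simp only: mult.commute)
  qed
  have "(\<integral>\<^sup>+x. \<integral>\<^sup>+y. ennreal \<bar>winding x y\<bar> \<partial>M \<partial>M) \<le> (\<integral>\<^sup>+x. \<integral>\<^sup>+y. \<integral>\<^sup>+t. L t x y \<partial>T \<partial>M \<partial>M)"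
  proof (intro nn_integral_mono)
    fix x y assume "x \<in> space M" "y \<in> space M"
    then have "ennreal \<bar>winding x y\<bar> \<le> (\<integral>\<^sup>+t. ennreal (norm (g' t x) * (1 / norm (g t x - g t y))) +
     ennreal (norm (g' t y) * (1 / norm (g t x - g t y))) \<partial>T)"
      unfolding T_def by (intro abs_winding_le) (simp_all add: spM)
    also have "\<dots> = (\<integral>\<^sup>+t. L t x y \<partial>T)"
      unfolding L_def K_def by (simp only: norm_minus_commute[of "g _ y" "g _ x"])
    finally show "ennreal \<bar>winding x y\<bar> \<le> (\<integral>\<^sup>+t. L t x y \<partial>T)" .
  qed
  also have "\<dots> = (\<integral>\<^sup>+z. (\<integral>\<^sup>+t. (case z of (x, y) \<Rightarrow> L t x y) \<partial>T) \<partial>(M \<Otimes>\<^sub>M M))"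
  proof (subst M.nn_integral_fst[symmetric])
    have "(\<lambda>z. (case fst z of (x, y) \<Rightarrow> L (snd z) x y)) \<in> borel_measurable ((M \<Otimes>\<^sub>M M) \<Otimes>\<^sub>M T)"
      using measurable_compose[OF measurable_pair_swap' L] by (simp add: case_prod_beta)
    then have "(\<lambda>(z, t). (case z of (x, y) \<Rightarrow> L t x y)) \<in> borel_measurable ((M \<Otimes>\<^sub>M M) \<Otimes>\<^sub>M T)"
      by (simp add: case_prod_beta)
    then show "(\<lambda>z. \<integral>\<^sup>+t. (case z of (x, y) \<Rightarrow> L t x y) \<partial>T) \<in> borel_measurable (M \<Otimes>\<^sub>M M)"
      by (rule T.borel_measurable_nn_integral)
  qed simp
  also have "\<dots> = (\<integral>\<^sup>+t. (\<integral>\<^sup>+z. (case z of (x, y) \<Rightarrow> L t x y) \<partial>(M \<Otimes>\<^sub>M M)) \<partial>T)"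
    by (rule TMM.Fubini'[OF L])
  also have "\<dots> \<le> (\<integral>\<^sup>+t. ennreal (16 * pi) * (\<integral>\<^sup>+x. ennreal (norm (g' t x)) \<partial>M) \<partial>T)"
  proof (rule nn_integral_mono)
    fix t assume "t \<in> space T"
    then have t: "t \<in> {0..1}"
      by (simp add: spT)
    have "(\<integral>\<^sup>+z. (case z of (x, y) \<Rightarrow> L t x y) \<partial>(M \<Otimes>\<^sub>M M)) =
        (\<integral>\<^sup>+z. (case z of (x, y) \<Rightarrow> K t x y) \<partial>(M \<Otimes>\<^sub>M M)) + (\<integral>\<^sup>+z. (case z of (x, y) \<Rightarrow> K t y x) \<partial>(M \<Otimes>\<^sub>M M))"
      unfolding nn_integral_add[OF Kt[OF t] K't[OF t], symmetric] L_def by (simp add: case_prod_beta)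
    also have "\<dots> = (\<integral>\<^sup>+x. \<integral>\<^sup>+y. K t x y \<partial>M \<partial>M) + (\<integral>\<^sup>+x. \<integral>\<^sup>+y. K t y x \<partial>M \<partial>M)"
      unfolding M.nn_integral_fst[OF Kt[OF t], symmetric] M.nn_integral_fst[OF K't[OF t], symmetric] by simp
    also have "(\<integral>\<^sup>+x. \<integral>\<^sup>+y. K t y x \<partial>M \<partial>M) = (\<integral>\<^sup>+x. \<integral>\<^sup>+y. K t x y \<partial>M \<partial>M)"
      by (rule MM.Fubini'[OF Kt[OF t]])
    also have "(\<integral>\<^sup>+x. \<integral>\<^sup>+y. K t x y \<partial>M \<partial>M) + (\<integral>\<^sup>+x. \<integral>\<^sup>+y. K t x y \<partial>M \<partial>M) \<le>
        ennreal (8 * pi) * (\<integral>\<^sup>+x. ennreal (norm (g' t x)) \<partial>M) + ennreal (8 * pi) * (\<integral>\<^sup>+x. ennreal (norm (g' t x)) \<partial>M)"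
      by (intro add_mono bound t)
    also have "\<dots> = (ennreal (8 * pi) + ennreal (8 * pi)) * (\<integral>\<^sup>+x. ennreal (norm (g' t x)) \<partial>M)"
      by (rule distrib_right[symmetric])
    also have "ennreal (8 * pi) + ennreal (8 * pi) = ennreal (16 * pi)"
      by (subst ennreal_plus[symmetric]) auto
    finally show "(\<integral>\<^sup>+z. (case z of (x, y) \<Rightarrow> L t x y) \<partial>(M \<Otimes>\<^sub>M M)) \<le> ennreal (16 * pi) * (\<integral>\<^sup>+x. ennreal (norm (g' t x)) \<partial>M)" .
  qed
  also have "\<dots> = ennreal (16 * pi) * (\<integral>\<^sup>+t. (\<integral>\<^sup>+x. ennreal (norm (g' t x)) \<partial>M) \<partial>T)"
  proof (rule nn_integral_cmult)
    have "continuous_on (space (T \<Otimes>\<^sub>M M)) (\<lambda>z. norm (g' (fst z) (snd z)))"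
      by (auto intro!: continuous_intros simp: space_pair_measure spT spM)
    moreover have "(\<lambda>z. z) \<in> borel_measurable (T \<Otimes>\<^sub>M M)"
      unfolding T_def M_def by (intro id_measurable_pair id_measurable_lborel_on)
    ultimately have "(\<lambda>z. norm (g' (fst z) (snd z))) \<in> borel_measurable (T \<Otimes>\<^sub>M M)"
      by (rule borel_measurable_continuous_on_space[rotated])
    then have "(\<lambda>(t, x). ennreal (norm (g' t x))) \<in> borel_measurable (T \<Otimes>\<^sub>M M)"
      unfolding case_prod_beta by (rule measurable_compose[OF _ measurable_ennreal])
    then show "(\<lambda>t. \<integral>\<^sup>+x. ennreal (norm (g' t x)) \<partial>M) \<in> borel_measurable T"
      by (rule M.borel_measurable_nn_integral)
  qed
  finally show ?thesis
    unfolding M_def T_def .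
qed

end

text \<open>Joint smoothness gives a derivative in (t, x); its value on (1, 0) is the velocity,
  jointly continuous. Uniqueness of derivatives within the time interval identifies it with
  \<open>vector_derivative\<close>.\<close>

lemma isotopy_motion:
  assumes "isotopy g" and id: "g 0 = id"
  shows "motion g (\<lambda>t x. vector_derivative (\<lambda>s. g s x) (at t within {0..1}))"
proof -
  have diff: "g t \<in> disc_diffeos" if "t \<in> {0..1}" for t
    using assms that by (simp add: isotopy_def)
  have "C_k_on (Suc 0) ({0..1} \<times> disc) (\<lambda>(t, x). g t x)"
    using assms by (simp add: isotopy_def smooth_family_def smooth_on_def del: C_k_on.simps)
  then obtain G where G: "\<And>z. z \<in> {0..1} \<times> disc \<Longrightarrow> ((\<lambda>(t, x). g t x) has_derivative G z) (at z within {0..1} \<times> disc)"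
    and Gc: "\<And>v. continuous_on ({0..1} \<times> disc) (\<lambda>z. G z v)"
    unfolding C_k_on.simps by blast
  have D: "((\<lambda>s. g s x) has_vector_derivative G (t, x) (1, 0)) (at t within {0..1})"
    if t: "t \<in> {0..1}" and x: "x \<in> disc" for t x
  proof -
    have "((\<lambda>s. (s, x)) has_derivative (\<lambda>s. (s, 0))) (at t within {0..1})"
      by (auto intro!: derivative_eq_intros)
    moreover have "((\<lambda>(t, x). g t x) has_derivative G (t, x)) (at (t, x) within (\<lambda>s. (s, x)) ` {0..1})"
      by (rule has_derivative_subset[OF G]) (use t x in auto)
    ultimately have D: "((\<lambda>s. (\<lambda>(t, x). g t x) (s, x)) has_derivative (\<lambda>s. G (t, x) (s, 0))) (at t within {0..1})"
      by (rule has_derivative_in_compose)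
    have "(\<lambda>s. G (t, x) (s, 0)) = (\<lambda>s. s *\<^sub>R G (t, x) (1, 0))"
    proof
      show "G (t, x) (s, 0) = s *\<^sub>R G (t, x) (1, 0)" for s
        using linear_scale[OF has_derivative_linear[OF G], of "(t, x)" s "(1, 0)"] t x by simp
    qed
    with D show ?thesis
      unfolding has_vector_derivative_def by simp
  qed
  have eq: "vector_derivative (\<lambda>s. g s x) (at t within {0..1}) = G (t, x) (1, 0)" if "t \<in> {0..1}" "x \<in> disc" for t x
    using vector_derivative_within_cbox[OF _ _ D[OF that, folded box_real(2)]] that by simp
  show ?thesis
  proof
    show "continuous_on ({0..1} \<times> disc) (\<lambda>(t, x). g t x)"
      using assms by (simp add: isotopy_def smooth_family_def smooth_on_imp_continuous_on)
    have "continuous_on ({0..1} \<times> disc) (\<lambda>(t, x). vector_derivative (\<lambda>s. g s x) (at t within {0..1}))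
        \<longleftrightarrow> continuous_on ({0..1} \<times> disc) (\<lambda>z. G z (1, 0))"
      by (rule continuous_on_cong) (auto simp: eq)
    then show "continuous_on ({0..1} \<times> disc) (\<lambda>(t, x). vector_derivative (\<lambda>s. g s x) (at t within {0..1}))"
      using Gc by blast
    show "((\<lambda>s. g s x) has_vector_derivative vector_derivative (\<lambda>s. g s x) (at t within {0..1})) (at t within {0..1})"
      if "t \<in> {0..1}" "x \<in> disc" for t x
      using D[OF that] eq[OF that] by simp
    show "inj_on (g t) disc" if "t \<in> {0..1}" for t
      using diff[OF that] by (simp add: disc_diffeos_def disc_diffeo_def bij_betw_def)
    show "g t x \<in> disc" if "t \<in> {0..1}" "x \<in> disc" for t x
      using diff[OF that(1)] that(2) by (auto simp: disc_diffeos_def disc_diffeo_def bij_betw_def)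
    show "g 0 x = x" for x
      by (simp add: id)
    show "g t x = x" if "t \<in> {0..1}" "norm x = 1" for t x
      using diff[OF that(1)] that(2) by (auto simp: disc_diffeos_def identity_near_boundary_def)
  qed
qed

text \<open>The factor 16 pi comes from the winding estimate and pi + 1 from the passage from L1 to
  Lp. Continuity of the Lp speed in t identifies the gauge integral in \<open>Lp_length\<close> with
  a nonnegative Lebesgue integral.\<close>

lemma nn_integral_winding_le_Lp_length:
  assumes g: "isotopy g" "g 0 = id" and p: "1 \<le> p"
  shows "(\<integral>\<^sup>+x. \<integral>\<^sup>+y. ennreal \<bar>motion.winding g (\<lambda>t x. vector_derivative (\<lambda>s. g s x) (at t within {0..1})) x y\<bar>
     \<partial>lborel_on disc \<partial>lborel_on disc) \<le> ennreal (16 * pi * (pi + 1) * Lp_length p g)"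
proof -
  define g' where "g' = (\<lambda>t x. vector_derivative (\<lambda>s. g s x) (at t within {0..1}))"
  interpret motion g g'
    unfolding g'_def using g by (rule isotopy_motion)
  let ?l = "\<lambda>t. (integral disc (\<lambda>x. norm (g' t x) powr p)) powr (1 / p)"
  have powr_cont: "continuous_on ({0..1} \<times> disc) (\<lambda>(t, x). norm (g' t x) powr p)"
    unfolding case_prod_beta using p by (intro continuous_on_powr' continuous_intros) auto
  have "continuous_on {0..1} (\<lambda>t. integral disc (\<lambda>x. norm (g' t x) powr p))"
    by (rule continuous_on_integral_compact[OF _ _ powr_cont]) auto
  moreover have "0 \<le> integral disc (\<lambda>x. norm (g' t x) powr p)" if "t \<in> {0..1}" for t
    using that p by (intro integral_nonneg integrable_continuous_compact(1) compact_cball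
        continuous_on_powr' continuous_intros) auto
  ultimately have cont: "continuous_on {0..1} ?l"
    using p by (intro continuous_on_powr' continuous_on_const) auto
  have "(\<integral>\<^sup>+x. \<integral>\<^sup>+y. ennreal \<bar>winding x y\<bar> \<partial>lborel_on disc \<partial>lborel_on disc) \<le>
    ennreal (16 * pi) * (\<integral>\<^sup>+t. \<integral>\<^sup>+x. ennreal (norm (g' t x)) \<partial>lborel_on disc \<partial>lborel_on {0..1})"
    using g distr_disc_diffeo by (intro nn_integral_winding_le) (auto simp: isotopy_def)
  also have "(\<integral>\<^sup>+t. \<integral>\<^sup>+x. ennreal (norm (g' t x)) \<partial>lborel_on disc \<partial>lborel_on {0..1}) \<le>
      (\<integral>\<^sup>+t. ennreal ((pi + 1) * ?l t) \<partial>lborel_on {0..1})"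
  proof (rule nn_integral_mono)
    fix t :: real assume "t \<in> space (lborel_on {0..1})"
    then have t: "t \<in> {0..1}"
      by simp
    have c: "continuous_on disc (\<lambda>x. norm (g' t x))"
      using t by (auto intro!: continuous_intros)
    have "(\<integral>\<^sup>+x. ennreal (norm (g' t x)) \<partial>lborel_on disc) = ennreal (integral disc (\<lambda>x. norm (g' t x)))"
      using c by (intro nn_integral_continuous_compact) auto
    also have "\<dots> \<le> ennreal ((pi + 1) * ?l t)"
      using c p by (intro ennreal_leI integral_le_Lp) auto
    finally show "(\<integral>\<^sup>+x. ennreal (norm (g' t x)) \<partial>lborel_on disc) \<le> ennreal ((pi + 1) * ?l t)" .
  qed
  also have "(\<integral>\<^sup>+t. ennreal ((pi + 1) * ?l t) \<partial>lborel_on {0..1}) = ennreal (integral {0..1} (\<lambda>t. (pi + 1) * ?l t))"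
    using cont by (intro nn_integral_continuous_compact continuous_on_mult_left) auto
  also have "integral {0..1} (\<lambda>t. (pi + 1) * ?l t) = (pi + 1) * Lp_length p g"
    by (simp add: Lp_length_def g'_def)
  finally show ?thesis
    by (simp add: g'_def ennreal_mult' mult.assoc mult_left_mono)
qed

section \<open>Derivatives of compactly supported functions\<close>

lemma line_derivative:
  assumes "\<And>x. (u has_derivative u' x) (at x)"
  shows "((\<lambda>s. u (x + s *\<^sub>R e)) has_vector_derivative u' (x + s *\<^sub>R e) e) (at s within T)"
proof -
  have 1: "((\<lambda>s. x + s *\<^sub>R e) has_derivative (\<lambda>s. s *\<^sub>R e)) (at s within T)"
    by (auto intro!: derivative_eq_intros)
  have "((\<lambda>s. u (x + s *\<^sub>R e)) has_derivative (\<lambda>r. u' (x + s *\<^sub>R e) (r *\<^sub>R e))) (at s within T)"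
    by (rule has_derivative_compose[OF 1 assms])
  then show ?thesis
    by (simp add: has_vector_derivative_def linear_scale[OF has_derivative_linear[OF assms]])
qed

lemma line_mvt:
  fixes u :: "'a::real_normed_vector \<Rightarrow> real"
  assumes "\<And>x. (u has_derivative u' x) (at x)" "0 < d"
  shows "\<exists>s. 0 < s \<and> s < d \<and> u (x + d *\<^sub>R e) - u x = d * u' (x + s *\<^sub>R e) e"
proof -
  have "((\<lambda>s. u (x + s *\<^sub>R e)) has_real_derivative u' (x + s *\<^sub>R e) e) (at s)" for s
    using line_derivative[OF assms(1)] by (simp add: has_real_derivative_iff_has_vector_derivative)
  from MVT2[OF \<open>0 < d\<close> this] show ?thesis
    by auto
qed

lemma has_derivative_eq_0_of_vanishing:
  fixes u :: "'a::real_normed_vector \<Rightarrow> real"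
  assumes "(u has_derivative D) (at x)" and "\<And>y. R < norm y \<Longrightarrow> u y = 0" and "R < norm x"
  shows "D e = 0"
proof -
  have "open {y::'a. R < norm y}"
    by (intro open_Collect_less continuous_intros)
  then have "((\<lambda>y. 0) has_derivative D) (at x)"
    using assms by (intro has_derivative_transform_within_open[OF assms(1), of "{y. R < norm y}"]) auto
  then have "D = (\<lambda>v. 0)"
    using has_derivative_unique[OF _ has_derivative_const] by blast
  then show ?thesis
    by simp
qed

text \<open>By translation invariance every difference quotient of u has integral 0; dominated
  convergence passes to the derivative.\<close>

lemma integral_derivative_eq_0:
  fixes u :: "plane \<Rightarrow> real"
  assumes D: "\<And>x. (u has_derivative u' x) (at x)"
    and cont: "continuous_on UNIV (\<lambda>x. u' x e)"
    and zero: "\<And>x. r < norm x \<Longrightarrow> u x = 0" and "0 \<le> r" "r \<le> 1"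
  shows "integral disc (\<lambda>x. u' x e) = 0"
proof -
  have zero': "u' x e = 0" if "r < norm x" for x
    using has_derivative_eq_0_of_vanishing[OF D zero that] .
  have contu: "continuous_on UNIV u"
    using has_derivative_continuous[OF D] by (simp add: continuous_on_eq_continuous_at)
  obtain B where B: "\<And>x. \<bar>u' x e\<bar> \<le> B"
  proof -
    have "compact ((\<lambda>x. u' x e) ` cball 0 r)"
      by (intro compact_continuous_image continuous_on_subset[OF cont]) auto
    then obtain B where B: "\<And>x. x \<in> cball 0 r \<Longrightarrow> \<bar>u' x e\<bar> \<le> B"
      using compact_imp_bounded bounded_iff by (metis image_eqI real_norm_def)
    have "0 \<le> B"
      using B[of 0] \<open>0 \<le> r\<close> by auto
    then have "\<bar>u' x e\<bar> \<le> B" for x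
      using B[of x] zero'[of x] by (cases "norm x \<le> r") auto
    then show thesis
      by (rule that)
  qed
  \<comment> \<open>Steps of size at most 1 keep all difference quotients supported in the ball of
    radius r + |e|, and the mean value theorem bounds them by \<open>B\<close>.\<close>
  define d :: "nat \<Rightarrow> real" where "d n = inverse (Suc n)" for n
  have d: "0 < d n" "d n \<le> 1" for n
    by (auto simp: d_def inverse_le_1_iff)
  have d0: "d \<longlonglongrightarrow> 0"
    unfolding d_def by (rule LIMSEQ_inverse_real_of_nat)
  define q where "q n x = (u (x + d n *\<^sub>R e) - u x) / d n" for n x
  have intu: "integrable lborel u"
  proof -
    have "integrable lborel (\<lambda>x. indicator (cball 0 r) x *\<^sub>R u x)"
      by (rule borel_integrable_compact) (auto intro: continuous_on_subset[OF contu])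
    moreover have "(\<lambda>x. indicator (cball 0 r) x *\<^sub>R u x) = u"
      using zero by (fastforce simp: indicator_def)
    ultimately show ?thesis
      by simp
  qed
  have intu': "integrable lborel (\<lambda>x. u (x + a))" and eq: "(LINT x|lborel. u (x + a)) = (LINT x|lborel. u x)" for a
  proof -
    have L: "distr lborel borel (\<lambda>x. a + x) = (lborel :: plane measure)"
      by (simp add: lborel_distr_plus)
    have m: "(\<lambda>x. a + x) \<in> measurable lborel (borel :: plane measure)"
      by simp
    have um: "u \<in> borel_measurable borel"
      by (rule borel_measurable_continuous_onI[OF contu])
    show "integrable lborel (\<lambda>x. u (x + a))"
      using integrable_distr_eq[OF m um] intu unfolding L by (simp add: add.commute)
    show "(LINT x|lborel. u (x + a)) = (LINT x|lborel. u x)"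
      using integral_distr[OF m um] unfolding L by (simp add: add.commute)
  qed
  have "(\<lambda>n. LINT x|lborel. q n x) \<longlonglongrightarrow> (LINT x|lborel. u' x e)"
  proof (rule integral_dominated_convergence[where w = "\<lambda>x. B * indicator (cball 0 (r + norm e)) x"])
    show "(\<lambda>x. u' x e) \<in> borel_measurable lborel"
      using borel_measurable_continuous_onI[OF cont] by simp
    show "q n \<in> borel_measurable lborel" for n
      unfolding q_def[abs_def] using intu intu' by (intro borel_measurable_divide borel_measurable_diff) auto
    show "integrable lborel (\<lambda>x::plane. B * indicator (cball 0 (r + norm e)) x)"
      by (intro integrable_mult_right integrable_real_indicator) (use emeasure_lborel_cball_finite[of "0::plane" "r + norm e"] in auto)
    show "AE x in lborel. (\<lambda>n. q n x) \<longlonglongrightarrow> u' x e"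
    proof (rule AE_I2)
      fix x
      have "((\<lambda>s. u (x + s *\<^sub>R e)) has_real_derivative u' x e) (at 0)"
        using line_derivative[OF D, of x e 0 UNIV] by (simp add: has_real_derivative_iff_has_vector_derivative)
      then have "((\<lambda>h. (u (x + h *\<^sub>R e) - u x) / h) \<longlongrightarrow> u' x e) (at 0)"
        by (simp add: DERIV_def)
      moreover have "filterlim d (at 0) sequentially"
        using d0 d(1) by (auto simp: filterlim_at less_imp_neq intro!: always_eventually) (metis less_irrefl)
      ultimately show "(\<lambda>n. q n x) \<longlonglongrightarrow> u' x e"
        unfolding q_def by (rule filterlim_compose)
    qed
    show "AE x in lborel. norm (q n x) \<le> B * indicator (cball 0 (r + norm e)) x" for n
    proof (rule AE_I2)
      fix x
      obtain s where s: "u (x + d n *\<^sub>R e) - u x = d n * u' (x + s *\<^sub>R e) e"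
        using line_mvt[OF D d(1)] by blast
      show "norm (q n x) \<le> B * indicator (cball 0 (r + norm e)) x"
      proof (cases "x \<in> cball 0 (r + norm e)")
        case True
        then show ?thesis
          using B[of "x + s *\<^sub>R e"] d(1)[of n] by (simp add: q_def s)
      next
        case False
        then have x: "r + norm e < norm x"
          by simp
        have "norm x \<le> norm (x + d n *\<^sub>R e) + norm (d n *\<^sub>R e)"
          using norm_triangle_ineq4[of "x + d n *\<^sub>R e" "d n *\<^sub>R e"] by simp
        moreover have "norm (d n *\<^sub>R e) \<le> norm e"
          using d[of n] by (simp add: mult_left_le_one_le)
        ultimately have "u (x + d n *\<^sub>R e) = 0" "u x = 0"
          using x by (auto intro!: zero) (use norm_ge_zero[of e] in linarith)
        then show ?thesis
          using False by (simp add: q_def)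
      qed
    qed
  qed
  moreover have "(LINT x|lborel. q n x) = 0" for n
    unfolding q_def using intu intu' eq by (simp add: Bochner_Integration.integral_diff)
  ultimately have "(\<lambda>n::nat. 0) \<longlonglongrightarrow> (LINT x|lborel. u' x e)"
    by simp
  then have "(LINT x|lborel. u' x e) = 0"
    by (simp add: LIMSEQ_const_iff)
  moreover have "(\<lambda>x. indicator disc x *\<^sub>R u' x e) = (\<lambda>x. u' x e)"
  proof
    show "indicator disc x *\<^sub>R u' x e = u' x e" for x
      using zero'[of x] \<open>r \<le> 1\<close> by (cases "norm x \<le> 1") auto
  qed
  moreover have "integral\<^sup>L (lborel_on disc) (\<lambda>x. u' x e) = (LINT x|lborel. indicator disc x *\<^sub>R u' x e)"
    by (rule integral_restrict_space) simp
  ultimately have "integral\<^sup>L (lborel_on disc) (\<lambda>x. u' x e) = 0"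
    by (simp only:)
  then show ?thesis
    using integrable_continuous_compact(3)[OF compact_cball continuous_on_subset[OF cont subset_UNIV], of 0 1]
    by simp
qed

text \<open>Schwarz's theorem: the second difference over the parallelogram spanned by h a and h b
  is h^2 times a value of either mixed derivative near x, by two mean value theorems in either
  order, and both mixed derivatives are continuous at x.\<close>

lemma symmetric_second_derivative:
  fixes f :: "'a::real_normed_vector \<Rightarrow> real"
  assumes f: "\<And>x. (f has_derivative f' x) (at x)"
    and A: "\<And>x. ((\<lambda>x. f' x a) has_derivative A x) (at x)"
    and B: "\<And>x. ((\<lambda>x. f' x b) has_derivative B x) (at x)"
    and contA: "continuous (at x) (\<lambda>x. A x b)" and contB: "continuous (at x) (\<lambda>x. B x a)"
  shows "A x b = B x a"
proof (rule ccontr)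
  assume ne: "A x b \<noteq> B x a"
  define e where "e = \<bar>A x b - B x a\<bar> / 2"
  have "0 < e"
    using ne by (simp add: e_def)
  obtain dA where "0 < dA" and dA: "\<And>y. dist y x < dA \<Longrightarrow> dist (A y b) (A x b) < e"
    using contA[unfolded continuous_within_eps_delta, rule_format, OF \<open>0 < e\<close>] by auto
  obtain dB where "0 < dB" and dB: "\<And>y. dist y x < dB \<Longrightarrow> dist (B y a) (B x a) < e"
    using contB[unfolded continuous_within_eps_delta, rule_format, OF \<open>0 < e\<close>] by auto
  \<comment> \<open>Small enough for the parallelogram to lie in both neighbourhoods; the 1 in the
    denominator covers a = b = 0.\<close>
  define h where "h = min dA dB / (norm a + norm b + 1)"
  have "0 < norm a + norm b + 1"
    by (simp add: add_nonneg_pos)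
  then have "0 < h"
    using \<open>0 < dA\<close> \<open>0 < dB\<close> by (simp add: h_def)
  have near: "dist (x + s *\<^sub>R a + t *\<^sub>R b) x < min dA dB" if "0 < s" "s < h" "0 < t" "t < h" for s t
  proof -
    have "dist (x + s *\<^sub>R a + t *\<^sub>R b) x = norm (s *\<^sub>R a + t *\<^sub>R b)"
      by (simp add: dist_norm algebra_simps)
    also have "\<dots> \<le> s * norm a + t * norm b"
      using norm_triangle_ineq[of "s *\<^sub>R a" "t *\<^sub>R b"] that by simp
    also have "\<dots> \<le> h * norm a + h * norm b"
      using that by (intro add_mono mult_right_mono) auto
    also have "\<dots> < h * (norm a + norm b + 1)"
      using \<open>0 < h\<close> by (simp add: algebra_simps)
    also have "\<dots> = min dA dB"
      using \<open>0 < norm a + norm b + 1\<close> by (simp add: h_def)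
    finally show ?thesis .
  qed
  have shift: "((\<lambda>y. f (y + c)) has_derivative f' (y + c)) (at y)" for y c
  proof -
    have "((\<lambda>y. y + c) has_derivative (\<lambda>v. v)) (at y)"
      by (auto intro!: derivative_eq_intros)
    then show ?thesis
      by (rule has_derivative_compose[OF _ f])
  qed
  define \<Delta> where "\<Delta> = f (x + h *\<^sub>R a + h *\<^sub>R b) - f (x + h *\<^sub>R a) - f (x + h *\<^sub>R b) + f x"
  have "\<exists>s t. 0 < s \<and> s < h \<and> 0 < t \<and> t < h \<and> \<Delta> = h * (h * A (x + s *\<^sub>R a + t *\<^sub>R b) b)"
  proof -
    obtain s where s: "0 < s" "s < h"
      and 1: "(f (x + h *\<^sub>R a + h *\<^sub>R b) - f (x + h *\<^sub>R a)) - (f (x + h *\<^sub>R b) - f x) =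
        h * (f' (x + s *\<^sub>R a + h *\<^sub>R b) a - f' (x + s *\<^sub>R a) a)"
      using line_mvt[OF has_derivative_diff[OF shift f] \<open>0 < h\<close>, of x a "h *\<^sub>R b"] by blast
    obtain t where "0 < t" "t < h"
      and "f' (x + s *\<^sub>R a + h *\<^sub>R b) a - f' (x + s *\<^sub>R a) a = h * A (x + s *\<^sub>R a + t *\<^sub>R b) b"
      using line_mvt[OF A \<open>0 < h\<close>, of "x + s *\<^sub>R a" b] by blast
    then show ?thesis
      using s 1 unfolding \<Delta>_def by (intro exI[of _ s] exI[of _ t]) simp
  qed
  then obtain s t where st: "0 < s" "s < h" "0 < t" "t < h" "\<Delta> = h * (h * A (x + s *\<^sub>R a + t *\<^sub>R b) b)"
    by blast
  have "\<exists>s t. 0 < s \<and> s < h \<and> 0 < t \<and> t < h \<and> \<Delta> = h * (h * B (x + s *\<^sub>R a + t *\<^sub>R b) a)"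
  proof -
    obtain s where s: "0 < s" "s < h"
      and 1: "(f (x + h *\<^sub>R b + h *\<^sub>R a) - f (x + h *\<^sub>R b)) - (f (x + h *\<^sub>R a) - f x) =
        h * (f' (x + s *\<^sub>R b + h *\<^sub>R a) b - f' (x + s *\<^sub>R b) b)"
      using line_mvt[OF has_derivative_diff[OF shift f] \<open>0 < h\<close>, of x b "h *\<^sub>R a"] by blast
    obtain t where "0 < t" "t < h"
      and "f' (x + s *\<^sub>R b + h *\<^sub>R a) b - f' (x + s *\<^sub>R b) b = h * B (x + s *\<^sub>R b + t *\<^sub>R a) a"
      using line_mvt[OF B \<open>0 < h\<close>, of "x + s *\<^sub>R b" a] by blast
    then show ?thesis
      using s 1 unfolding \<Delta>_def by (intro exI[of _ t] exI[of _ s]) (simp add: algebra_simps)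
  qed
  then obtain s' t' where st': "0 < s'" "s' < h" "0 < t'" "t' < h" "\<Delta> = h * (h * B (x + s' *\<^sub>R a + t' *\<^sub>R b) a)"
    by blast
  have "A (x + s *\<^sub>R a + t *\<^sub>R b) b = B (x + s' *\<^sub>R a + t' *\<^sub>R b) a"
    using st(5) st'(5) \<open>0 < h\<close> by simp
  moreover have "dist (A (x + s *\<^sub>R a + t *\<^sub>R b) b) (A x b) < e"
    using near st by (intro dA) simp
  moreover have "dist (B (x + s' *\<^sub>R a + t' *\<^sub>R b) a) (B x a) < e"
    using near st' by (intro dB) simp
  ultimately show False
    unfolding e_def dist_real_def by argo
qed

text \<open>\<open>C_k_on\<close> gives continuity of the derivative in each fixed direction only.
  Bounds for the finitely many basis vectors add up to a bound of the operator norm, and convexity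
  gives the mean value inequality.\<close>

lemma C1_lipschitz:
  fixes F :: "'a::euclidean_space \<Rightarrow> real"
  assumes "C_k_on 1 S F" "compact S" "convex S"
  shows "\<exists>L\<ge>0. \<forall>x\<in>S. \<forall>y\<in>S. \<bar>F x - F y\<bar> \<le> L * norm (x - y)"
proof -
  obtain F' where D: "\<And>x. x \<in> S \<Longrightarrow> (F has_derivative F' x) (at x within S)"
    and c: "\<And>v. continuous_on S (\<lambda>x. F' x v)"
    using assms(1) unfolding One_nat_def C_k_on.simps by blast
  have "\<exists>C. \<forall>x\<in>S. \<bar>F' x b\<bar> \<le> C" for b
    using compact_imp_bounded[OF compact_continuous_image[OF c assms(2)], of b]
    unfolding bounded_iff by auto
  then obtain C where C: "\<And>x b. x \<in> S \<Longrightarrow> \<bar>F' x b\<bar> \<le> C b"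
    by metis
  define L where "L = (\<Sum>b\<in>Basis. \<bar>C b\<bar>)"
  have "onorm (F' x) \<le> L" if x: "x \<in> S" for x
  proof (rule onorm_le)
    fix v
    have lin: "linear (F' x)"
      using D[OF x] by (rule has_derivative_linear)
    have "F' x v = F' x (\<Sum>b\<in>Basis. (v \<bullet> b) *\<^sub>R b)"
      by (simp add: euclidean_representation)
    also have "\<dots> = (\<Sum>b\<in>Basis. (v \<bullet> b) * F' x b)"
      by (simp add: linear_sum[OF lin] linear_scale[OF lin])
    finally have "norm (F' x v) \<le> (\<Sum>b\<in>Basis. norm ((v \<bullet> b) * F' x b))"
      by (simp add: sum_abs)
    also have "\<dots> \<le> (\<Sum>b\<in>Basis. \<bar>C b\<bar> * norm v)"
    proof (rule sum_mono)
      fix b :: 'a assume b: "b \<in> Basis"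
      have "\<bar>v \<bullet> b\<bar> * \<bar>F' x b\<bar> \<le> norm v * \<bar>C b\<bar>"
        using Basis_le_norm[OF b] C[OF x, of b] by (intro mult_mono) auto
      then show "norm ((v \<bullet> b) * F' x b) \<le> \<bar>C b\<bar> * norm v"
        by (simp add: abs_mult mult.commute)
    qed
    finally show "norm (F' x v) \<le> L * norm v"
      by (simp add: L_def sum_distrib_right)
  qed
  then have "\<forall>x\<in>S. \<forall>y\<in>S. \<bar>F x - F y\<bar> \<le> L * norm (x - y)"
    using differentiable_bound[OF assms(3) D] by auto
  moreover have "0 \<le> L"
    by (simp add: L_def sum_nonneg)
  ultimately show ?thesis
    by blast
qed

text \<open>As u vanishes near and beyond the boundary circle, its spatial derivative within the
  disc, continued by 0, is a derivative at every point of the plane. That it vanishes is seen where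
  u is 0 on a neighbourhood, hence the larger radius \<open>r'\<close>. One order of smoothness is
  spent.\<close>

lemma vanishing_family_derivative:
  fixes u :: "real \<Rightarrow> plane \<Rightarrow> real"
  assumes u: "C_k_on (Suc k) ({0..1} \<times> disc) (\<lambda>(t, x). u t x)"
    and zero: "\<And>t x. t \<in> {0..1} \<Longrightarrow> r \<le> norm x \<Longrightarrow> u t x = 0"
    and r: "r < r'" "r' < 1"
  shows "\<exists>D. (\<forall>t\<in>{0..1}. \<forall>x. (u t has_derivative (\<lambda>v. D v t x)) (at x)) \<and>
     (\<forall>v. C_k_on k ({0..1} \<times> disc) (\<lambda>(t, x). D v t x)) \<and>
     (\<forall>v. \<forall>t\<in>{0..1}. \<forall>x. r' \<le> norm x \<longrightarrow> D v t x = 0)"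
proof -
  let ?S = "{0..1::real} \<times> disc"
  obtain G where G: "\<And>z. z \<in> ?S \<Longrightarrow> ((\<lambda>(t, x). u t x) has_derivative G z) (at z within ?S)"
    and Gk: "\<And>v. C_k_on k ?S (\<lambda>z. G z v)"
    using u unfolding C_k_on.simps by blast
  define D where "D v t x = (if x \<in> disc then G (t, x) (0, v) else 0)" for v t x
  have space_deriv: "(u t has_derivative (\<lambda>v. G (t, x) (0, v))) (at x within disc)"
    if t: "t \<in> {0..1}" and x: "x \<in> disc" for t x
  proof -
    have "((\<lambda>y. (t, y)) has_derivative (\<lambda>v. (0, v))) (at x within disc)"
      by (auto intro!: derivative_eq_intros)
    moreover have "((\<lambda>(t, x). u t x) has_derivative G (t, x)) (at (t, x) within (\<lambda>y. (t, y)) ` disc)"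
      by (rule has_derivative_subset[OF G]) (use t x in auto)
    ultimately have "((\<lambda>y. (\<lambda>(t, x). u t x) (t, y)) has_derivative (\<lambda>v. G (t, x) (0, v))) (at x within disc)"
      by (rule has_derivative_in_compose)
    then show ?thesis
      by simp
  qed
  \<comment> \<open>Where u is locally 0 the zero map is a derivative too, and derivatives within
    the cylinder are unique.\<close>
  have Gzero: "G (t, x) = (\<lambda>v. 0)" if t: "t \<in> {0..1}" and x: "x \<in> disc" and "r < norm x" for t x
  proof (rule has_derivative_within_unique_convex)
    show "convex ?S" "interior ?S \<noteq> {}" "(t, x) \<in> ?S"
      using t x by (auto simp: interior_Times intro!: convex_Times)
    show "((\<lambda>(t, x). u t x) has_derivative G (t, x)) (at (t, x) within ?S)"
      using t x by (intro G) auto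
    show "((\<lambda>(t, x). u t x) has_derivative (\<lambda>v. 0)) (at (t, x) within ?S)"
    proof (rule has_derivative_transform_within[OF has_derivative_const])
      show "0 < norm x - r" "(t, x) \<in> ?S"
        using that by auto
      fix z assume z: "z \<in> ?S" "dist z (t, x) < norm x - r"
      have "norm x - norm (snd z) \<le> dist (snd z) x"
        unfolding dist_norm by (metis norm_minus_commute norm_triangle_ineq2)
      also have "\<dots> \<le> dist z (t, x)"
        using dist_snd_le[of z "(t, x)"] by simp
      finally show "0 = (case z of (t, x) \<Rightarrow> u t x)"
        using z zero[of "fst z" "snd z"] by (auto simp: case_prod_beta)
    qed
  qed
  have "(u t has_derivative (\<lambda>v. D v t x)) (at x)" if t: "t \<in> {0..1}" for t x
  proof (cases "norm x < 1")
    case True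
    then have "at x within disc = at x"
      by (intro at_within_interior) simp
    moreover have "(\<lambda>v. D v t x) = (\<lambda>v. G (t, x) (0, v))"
      using True by (simp add: D_def)
    ultimately show ?thesis
      using space_deriv[OF t, of x] True by simp
  next
    case False
    have "D v t x = 0" for v
      using Gzero[OF t, of x] False r by (auto simp: D_def)
    moreover have "(u t has_derivative (\<lambda>v. 0)) (at x)"
    proof (rule has_derivative_transform_within_open[OF has_derivative_const])
      show "open {y::plane. r < norm y}"
        by (intro open_Collect_less continuous_intros)
      show "x \<in> {y. r < norm y}"
        using False r by simp
      show "0 = u t y" if "y \<in> {y. r < norm y}" for y
        using that zero[OF t, of y] by simp
    qed
    ultimately show ?thesis
      by simp
  qed
  moreover have "C_k_on k ?S (\<lambda>(t, x). D v t x)" for v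
  proof -
    have "C_k_on k ?S (\<lambda>(t, x). D v t x) \<longleftrightarrow> C_k_on k ?S (\<lambda>z. G z (0, v))"
      by (rule C_k_on_cong) (auto simp: D_def)
    then show ?thesis
      using Gk by blast
  qed
  moreover have "D v t x = 0" if "t \<in> {0..1}" "r' \<le> norm x" for v t x
    using Gzero[OF that(1), of x] that(2) r by (auto simp: D_def)
  ultimately show ?thesis
    by blast
qed

section \<open>Hamiltonian flows\<close>

text \<open>
  \<open>G1\<close>, \<open>G2\<close> are the partial derivatives of \<open>h\<close>, and \<open>A\<close>, \<open>B\<close> their differentials; \<open>h\<close> is extended by zero to
  the whole plane.
\<close>

locale hamiltonian =
  fixes h G1 G2 :: "real \<Rightarrow> plane \<Rightarrow> real" and A B :: "real \<Rightarrow> plane \<Rightarrow> plane \<Rightarrow> real" and r L :: real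
  assumes r: "0 \<le> r" "r < 1" and L: "0 \<le> L"
    and h_deriv: "\<And>t x. t \<in> {0..1} \<Longrightarrow> (h t has_derivative (\<lambda>v. v $ 1 * G1 t x + v $ 2 * G2 t x)) (at x)"
    and G1_deriv: "\<And>t x. t \<in> {0..1} \<Longrightarrow> (G1 t has_derivative A t x) (at x)"
    and G2_deriv: "\<And>t x. t \<in> {0..1} \<Longrightarrow> (G2 t has_derivative B t x) (at x)"
    and cont_h: "continuous_on ({0..1} \<times> disc) (\<lambda>(t, x). h t x)"
    and cont_A: "\<And>v. continuous_on ({0..1} \<times> disc) (\<lambda>(t, x). A t x v)"
    and cont_B: "\<And>v. continuous_on ({0..1} \<times> disc) (\<lambda>(t, x). B t x v)"
    and zero: "\<And>t x. t \<in> {0..1} \<Longrightarrow> r \<le> norm x \<Longrightarrow> h t x = 0 \<and> G1 t x = 0 \<and> G2 t x = 0"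
    and lip: "\<And>s t x y. s \<in> {0..1} \<Longrightarrow> t \<in> {0..1} \<Longrightarrow> x \<in> disc \<Longrightarrow> y \<in> disc \<Longrightarrow>
       \<bar>G1 t x - G1 s y\<bar> \<le> L * (\<bar>t - s\<bar> + norm (x - y)) \<and> \<bar>G2 t x - G2 s y\<bar> \<le> L * (\<bar>t - s\<bar> + norm (x - y))"
begin

definition X :: "real \<Rightarrow> plane \<Rightarrow> plane" where
  "X t x = vector [G2 t x, - G1 t x]"

lemma X_nth [simp]: "X t x $ 1 = G2 t x" "X t x $ 2 = - G1 t x"
  by (simp_all add: X_def)

lemma X_lipschitz:
  assumes "s \<in> {0..1}" "t \<in> {0..1}" "x \<in> disc" "y \<in> disc"
  shows "norm (X t x - X s y) \<le> 2 * L * (\<bar>t - s\<bar> + norm (x - y))"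
proof -
  have "norm (X t x - X s y) \<le> \<bar>G2 t x - G2 s y\<bar> + \<bar>G1 s y - G1 t x\<bar>"
    using norm_le_l1_cart[of "X t x - X s y"] by (simp add: sum_2)
  then show ?thesis
    using lip[OF assms] by (simp add: abs_minus_commute algebra_simps)
qed

lemma X_zero: "t \<in> {0..1} \<Longrightarrow> r \<le> norm x \<Longrightarrow> X t x = 0"
  using zero[of t x] by (simp add: plane_eq_iff)

text \<open>The field vanishes at a boundary point, which has distance at most 2 from x, and 2 * L
  is a Lipschitz constant.\<close>

lemma X_bound:
  assumes "t \<in> {0..1}" "x \<in> disc"
  shows "norm (X t x) \<le> 4 * L"
proof -
  have "norm (axis 1 1 :: plane) = 1"
    by simp
  then have e: "axis 1 1 \<in> disc" "X t (axis 1 1) = 0"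
    using r assms by (auto intro!: X_zero)
  have "norm (X t x) = norm (X t x - X t (axis 1 1))"
    using e by simp
  also have "\<dots> \<le> 2 * L * (\<bar>t - t\<bar> + norm (x - axis 1 1))"
    by (rule X_lipschitz) (use assms e in auto)
  also have "\<dots> \<le> 2 * L * 2"
    using L assms norm_triangle_ineq4[of x "axis 1 1"] by (intro mult_left_mono) auto
  finally show ?thesis
    by simp
qed

lemma continuous_on_of_lipschitz:
  fixes F :: "real \<Rightarrow> plane \<Rightarrow> 'b::real_normed_vector"
  assumes "0 \<le> C" and "\<And>s t x y. s \<in> {0..1} \<Longrightarrow> t \<in> {0..1} \<Longrightarrow> x \<in> disc \<Longrightarrow> y \<in> disc \<Longrightarrow>
       norm (F t x - F s y) \<le> C * (\<bar>t - s\<bar> + norm (x - y))"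
  shows "continuous_on ({0..1} \<times> disc) (\<lambda>(t, x). F t x)"
proof (rule lipschitz_on_continuous_on)
  show "(2 * C)-lipschitz_on ({0..1} \<times> disc) (\<lambda>(t, x). F t x)"
  proof (rule lipschitz_onI)
    fix z w assume z: "z \<in> {0..1::real} \<times> disc" "w \<in> {0..1::real} \<times> disc"
    have "dist (case z of (t, x) \<Rightarrow> F t x) (case w of (t, x) \<Rightarrow> F t x) \<le> C * (dist (fst z) (fst w) + dist (snd z) (snd w))"
      using assms(2)[of "fst w" "fst z" "snd z" "snd w"] z by (auto simp: dist_norm)
    also have "\<dots> \<le> C * (dist z w + dist z w)"
      using assms(1) by (intro mult_left_mono add_mono dist_fst_le dist_snd_le)
    finally show "dist (case z of (t, x) \<Rightarrow> F t x) (case w of (t, x) \<Rightarrow> F t x) \<le> 2 * C * dist z w"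
      by simp
  qed (use assms in simp)
qed

lemma cont_X: "continuous_on ({0..1} \<times> disc) (\<lambda>(t, x). X t x)"
  using X_lipschitz L by (intro continuous_on_of_lipschitz[of "2 * L"]) auto

lemma continuous_on_X:
  assumes "continuous_on S p" "continuous_on S q" "p ` S \<subseteq> {0..1}" "q ` S \<subseteq> disc"
  shows "continuous_on S (\<lambda>x. X (p x) (q x))"
proof -
  have "continuous_on S (\<lambda>x. case (p x, q x) of (t, x) \<Rightarrow> X t x)"
    by (rule continuous_on_compose2[OF cont_X continuous_on_Pair[OF assms(1,2)]]) (use assms(3,4) in auto)
  then show ?thesis
    by simp
qed

text \<open>Inside the disc this is the symmetry of the second derivatives of h; on the circle both
  sides are 0.\<close>

lemma divergence_free:
  assumes t: "t \<in> {0..1}" and x: "x \<in> disc"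
  shows "A t x (axis 2 1) = B t x (axis 1 1)"
proof (cases "norm x < 1")
  case False
  then have rx: "r < norm x"
    using r by simp
  have "A t x v = 0" for v
    by (rule has_derivative_eq_0_of_vanishing[OF G1_deriv[OF t] _ rx]) (use zero[OF t] in auto)
  moreover have "B t x v = 0" for v
    by (rule has_derivative_eq_0_of_vanishing[OF G2_deriv[OF t] _ rx]) (use zero[OF t] in auto)
  ultimately show ?thesis
    by simp
next
  case True
  let ?f' = "\<lambda>x v. v $ 1 * G1 t x + v $ 2 * G2 t x"
  have c: "continuous (at x) (\<lambda>x. F t x v)"
    if "continuous_on ({0..1} \<times> disc) (\<lambda>(t, x). F t x v)" for F :: "real \<Rightarrow> plane \<Rightarrow> plane \<Rightarrow> real" and v
  proof -
    have "continuous_on (ball 0 1) (\<lambda>x. case (t, x) of (t, x) \<Rightarrow> F t x v)"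
      by (rule continuous_on_compose2[OF that]) (use t in \<open>auto intro!: continuous_intros\<close>)
    then show ?thesis
      using True by (simp add: continuous_on_eq_continuous_at)
  qed
  show ?thesis
  proof (rule symmetric_second_derivative[OF h_deriv[OF t], of "axis 1 1" "A t" "axis 2 1" "B t"])
    show "((\<lambda>x. (axis 1 1 :: plane) $ 1 * G1 t x + (axis 1 1 :: plane) $ 2 * G2 t x) has_derivative A t x) (at x)" for x
      using G1_deriv[OF t, of x] by (simp add: axis_def)
    show "((\<lambda>x. (axis 2 1 :: plane) $ 1 * G1 t x + (axis 2 1 :: plane) $ 2 * G2 t x) has_derivative B t x) (at x)" for x
      using G2_deriv[OF t, of x] by (simp add: axis_def)
    show "continuous (at x) (\<lambda>x. A t x (axis 2 1))" "continuous (at x) (\<lambda>x. B t x (axis 1 1))"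
      using c[OF cont_A] c[OF cont_B] by auto
  qed
qed

text \<open>The expression is the determinant of the differential of \<open>X t\<close>. The trace
  of that differential is 0, so the Jacobian of the Euler step with step size \<tau> is 1 plus
  \<tau>^2 times this determinant.\<close>

lemma jacobian_bound:
  "\<exists>C\<ge>0. \<forall>t\<in>{0..1}. \<forall>x\<in>disc.
     \<bar>B t x (axis 2 1) * A t x (axis 1 1) - B t x (axis 1 1) * A t x (axis 2 1)\<bar> \<le> C"
proof -
  have *: "\<exists>C. \<forall>t\<in>{0..1}. \<forall>x\<in>disc. \<bar>F t x v\<bar> \<le> C"
    if "continuous_on ({0..1} \<times> disc) (\<lambda>(t, x). F t x v)" for F :: "real \<Rightarrow> plane \<Rightarrow> plane \<Rightarrow> real" and v
  proof -
    have "compact ({0..1::real} \<times> disc)"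
      by (intro compact_Times) auto
    from compact_imp_bounded[OF compact_continuous_image[OF that this]]
    obtain C where C: "\<And>z. z \<in> {0..1} \<times> disc \<Longrightarrow> norm (case z of (t, x) \<Rightarrow> F t x v) \<le> C"
      unfolding bounded_iff by blast
    show ?thesis
    proof (intro exI[of _ C] ballI)
      show "\<bar>F t x v\<bar> \<le> C" if "t \<in> {0..1}" "x \<in> disc" for t x
        using C[of "(t, x)"] that by simp
    qed
  qed
  obtain CA CB where CA: "\<And>v t x. t \<in> {0..1} \<Longrightarrow> x \<in> disc \<Longrightarrow> \<bar>A t x v\<bar> \<le> CA v"
    and CB: "\<And>v t x. t \<in> {0..1} \<Longrightarrow> x \<in> disc \<Longrightarrow> \<bar>B t x v\<bar> \<le> CB v"
    using *[of A, OF cont_A] *[of B, OF cont_B] by metis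
  define C where "C = CB (axis 2 1) * CA (axis 1 1) + CB (axis 1 1) * CA (axis 2 1)"
  have bound: "\<bar>B t x (axis 2 1) * A t x (axis 1 1) - B t x (axis 1 1) * A t x (axis 2 1)\<bar> \<le> C"
    if "t \<in> {0..1}" "x \<in> disc" for t x
  proof -
    have "\<bar>B t x (axis 2 1)\<bar> * \<bar>A t x (axis 1 1)\<bar> \<le> CB (axis 2 1) * CA (axis 1 1)"
      "\<bar>B t x (axis 1 1)\<bar> * \<bar>A t x (axis 2 1)\<bar> \<le> CB (axis 1 1) * CA (axis 2 1)"
      using that CA CB abs_ge_zero order_trans by (meson mult_mono)+
    then show ?thesis
      unfolding C_def by (simp add: abs_mult[symmetric])
  qed
  moreover have "0 \<le> C"
    using bound[of 0 0] by (auto intro: order_trans[OF abs_ge_zero])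
  ultimately show ?thesis
    by blast
qed

text \<open>The upper bounds on \<tau> keep the step inside the disc, make it injective and keep the
  factor 1 - \<tau>^2 C nonnegative. The change of variables leads to an integral over the image of
  the disc, which is shown to be contained in the disc; for nonnegative f this gives an
  inequality.\<close>

lemma euler_step:
  assumes t: "t \<in> {0..1}" and \<tau>: "0 \<le> \<tau>" "\<tau> * (4 * L) \<le> 1 - r" "\<tau> * (2 * L) < 1" "\<tau>\<^sup>2 * C \<le> 1"
    and C: "\<And>x. x \<in> disc \<Longrightarrow>
     \<bar>B t x (axis 2 1) * A t x (axis 1 1) - B t x (axis 1 1) * A t x (axis 2 1)\<bar> \<le> C"
  shows "x \<in> disc \<Longrightarrow> x + \<tau> *\<^sub>R X t x \<in> disc"
    and "continuous_on disc f \<Longrightarrow> (\<And>x. x \<in> disc \<Longrightarrow> 0 \<le> f x) \<Longrightarrow>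
       (1 - \<tau>\<^sup>2 * C) * integral disc (\<lambda>x. f (x + \<tau> *\<^sub>R X t x)) \<le> integral disc f"
proof -
  define S where "S x = x + \<tau> *\<^sub>R X t x" for x
  have S_disc: "S x \<in> disc" if x: "x \<in> disc" for x
  proof (cases "r \<le> norm x")
    case True
    then show ?thesis
      using X_zero[OF t] x by (simp add: S_def)
  next
    case False
    have "norm (S x) \<le> norm x + \<tau> * norm (X t x)"
      unfolding S_def using norm_triangle_ineq[of x "\<tau> *\<^sub>R X t x"] \<tau>(1) by simp
    also have "\<tau> * norm (X t x) \<le> \<tau> * (4 * L)"
      by (intro mult_left_mono X_bound t x \<tau>)
    finally show ?thesis
      using False \<tau>(2) by simp
  qed
  then show "x \<in> disc \<Longrightarrow> x + \<tau> *\<^sub>R X t x \<in> disc"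
    by (simp add: S_def)
  have contS: "continuous_on disc S"
    unfolding S_def[abs_def] using t by (intro continuous_intros continuous_on_X) auto
  have inj: "inj_on S disc"
  proof (rule inj_onI, rule ccontr)
    fix x y assume xy: "x \<in> disc" "y \<in> disc" "S x = S y" "x \<noteq> y"
    then have "x - y = \<tau> *\<^sub>R (X t y - X t x)"
      by (simp add: S_def algebra_simps)
    then have "norm (x - y) = \<tau> * norm (X t y - X t x)"
      using \<tau>(1) by simp
    also have "\<dots> \<le> \<tau> * (2 * L * (\<bar>t - t\<bar> + norm (y - x)))"
      by (intro mult_left_mono X_lipschitz t xy \<tau>)
    also have "\<dots> = (\<tau> * (2 * L)) * norm (x - y)"
      by (simp add: norm_minus_commute)
    also have "\<dots> < 1 * norm (x - y)"
      using \<tau>(3) xy by (intro mult_strict_right_mono) auto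
    finally show False
      by simp
  qed
  define D where "D x v = v + \<tau> *\<^sub>R (vector [B t x v, - A t x v] :: plane)" for x v
  have D: "(S has_derivative D x) (at x within disc)" for x
  proof -
    have X': "X t = (\<lambda>x. G2 t x *\<^sub>R axis 1 1 - G1 t x *\<^sub>R axis 2 1)"
      by (auto simp: plane_eq_iff axis_def)
    have "(X t has_derivative (\<lambda>v. B t x v *\<^sub>R axis 1 1 - A t x v *\<^sub>R axis 2 1)) (at x within disc)"
      unfolding X' by (intro has_derivative_diff has_derivative_scaleR_left
          has_derivative_at_withinI[OF G1_deriv[OF t]] has_derivative_at_withinI[OF G2_deriv[OF t]])
    moreover have "B t x v *\<^sub>R axis 1 1 - A t x v *\<^sub>R axis 2 1 = (vector [B t x v, - A t x v] :: plane)" for v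
      by (auto simp: plane_eq_iff axis_def)
    ultimately have "(X t has_derivative (\<lambda>v. vector [B t x v, - A t x v])) (at x within disc)"
      by simp
    then show ?thesis
      unfolding S_def[abs_def] D_def by (intro has_derivative_add has_derivative_ident has_derivative_scaleR_right)
  qed
  define J where "J x = \<bar>det (matrix (D x))\<bar>" for x
  have J: "1 - \<tau>\<^sup>2 * C \<le> J x" if x: "x \<in> disc" for x
  proof -
    define q where "q = B t x (axis 2 1) * A t x (axis 1 1) - B t x (axis 1 1) * A t x (axis 2 1)"
    have "det (matrix (D x)) = 1 + \<tau>\<^sup>2 * q"
      unfolding det_2 matrix_def q_def
      by (simp add: D_def axis_def[of _ "1::real"] divergence_free[OF t x, unfolded axis_def] power2_eq_square algebra_simps)
    moreover have "\<tau>\<^sup>2 * \<bar>q\<bar> \<le> \<tau>\<^sup>2 * C"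
      unfolding q_def by (intro mult_left_mono C x) simp
    then have "\<bar>\<tau>\<^sup>2 * q\<bar> \<le> \<tau>\<^sup>2 * C"
      by (simp add: abs_mult)
    ultimately show ?thesis
      unfolding J_def by linarith
  qed
  fix f :: "plane \<Rightarrow> real" assume f: "continuous_on disc f" and nonneg: "\<And>x. x \<in> disc \<Longrightarrow> 0 \<le> f x"
  have sub: "S ` disc \<subseteq> disc" and cpt: "compact (S ` disc)"
    using S_disc contS by (auto intro!: compact_continuous_image)
  have f_int: "f integrable_on S ` disc" "f integrable_on disc"
    using integrable_continuous_compact(1)[OF cpt continuous_on_subset[OF f sub]]
      integrable_continuous_compact(1)[OF compact_cball f] by auto
  have fS_int: "(\<lambda>x. f (S x)) integrable_on disc"
    using continuous_on_compose2[OF f contS sub] by (intro integrable_continuous_compact(1)) auto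
  \<comment> \<open>The change of variables theorem is stated for vector-valued functions, so f is
    read as a map to \<open>real ^ 1\<close>.\<close>
  let ?f1 = "\<lambda>x. vec (f x) :: real ^ 1"
  have "f absolutely_integrable_on S ` disc"
    using f_int(1) nonneg sub by (subst absolutely_integrable_on_iff_nonneg) auto
  then have "?f1 absolutely_integrable_on S ` disc \<and> integral (S ` disc) ?f1 = integral (S ` disc) ?f1"
    by (simp add: absolutely_integrable_on_1_iff)
  then have "(\<lambda>x. J x *\<^sub>R ?f1 (S x)) absolutely_integrable_on disc \<and>
      integral disc (\<lambda>x. J x *\<^sub>R ?f1 (S x)) = integral (S ` disc) ?f1"
    unfolding J_def
    by (subst has_absolute_integral_change_of_variables[OF _ D inj]) auto
  then have int: "(\<lambda>x. J x * f (S x)) integrable_on disc"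
    and eq: "integral disc (\<lambda>x. J x * f (S x)) = integral (S ` disc) f"
    by (auto simp: absolutely_integrable_on_1_iff absolutely_integrable_on_def integral_on_1_eq vec_eq_iff)
  have "(1 - \<tau>\<^sup>2 * C) * integral disc (\<lambda>x. f (S x)) = integral disc (\<lambda>x. (1 - \<tau>\<^sup>2 * C) * f (S x))"
    by simp
  also have "\<dots> \<le> integral disc (\<lambda>x. J x * f (S x))"
    using fS_int int J nonneg S_disc
    by (intro integral_le integrable_on_mult_right mult_right_mono) auto
  also have "\<dots> \<le> integral disc f"
    unfolding eq using sub f_int nonneg by (intro integral_subset_le) auto
  finally show "(1 - \<tau>\<^sup>2 * C) * integral disc (\<lambda>x. f (x + \<tau> *\<^sub>R X t x)) \<le> integral disc f"
    by (simp add: S_def)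
qed

section \<open>The explicit Euler scheme and its effect on integrals\<close>

primrec euler :: "real \<Rightarrow> nat \<Rightarrow> plane \<Rightarrow> plane" where
  "euler \<tau> 0 x = x"
| "euler \<tau> (Suc k) x = euler \<tau> k x + \<tau> *\<^sub>R X (k * \<tau>) (euler \<tau> k x)"

text \<open>The last step is absorbed into the test function: the induction hypothesis is applied to
  f composed with that step, so f has to be quantified inside the induction.\<close>

lemma euler_integral_le:
  assumes \<tau>: "0 \<le> \<tau>" "\<tau> * (4 * L) \<le> 1 - r" "\<tau> * (2 * L) < 1" "\<tau>\<^sup>2 * C \<le> 1"
    and C: "\<And>t x. t \<in> {0..1} \<Longrightarrow> x \<in> disc \<Longrightarrow>
     \<bar>B t x (axis 2 1) * A t x (axis 1 1) - B t x (axis 1 1) * A t x (axis 2 1)\<bar> \<le> C"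
  shows "k * \<tau> \<le> 1 \<Longrightarrow> (\<forall>x\<in>disc. euler \<tau> k x \<in> disc) \<and> continuous_on disc (euler \<tau> k) \<and>
     (\<forall>f. continuous_on disc f \<longrightarrow> (\<forall>x\<in>disc. 0 \<le> f x) \<longrightarrow>
       (1 - \<tau>\<^sup>2 * C) ^ k * integral disc (\<lambda>x. f (euler \<tau> k x)) \<le> integral disc f)"
proof (induction k)
  case (Suc k)
  have t: "k * \<tau> \<in> {0..1}"
    using Suc.prems \<tau>(1) by (simp add: algebra_simps)
  then have IH: "\<forall>x\<in>disc. euler \<tau> k x \<in> disc" "continuous_on disc (euler \<tau> k)"
    "\<And>f. continuous_on disc f \<Longrightarrow> \<forall>x\<in>disc. 0 \<le> f x \<Longrightarrow>
       (1 - \<tau>\<^sup>2 * C) ^ k * integral disc (\<lambda>x. f (euler \<tau> k x)) \<le> integral disc f"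
    using Suc.IH by auto
  note step = euler_step[OF t \<tau> C[OF t]]
  let ?S = "\<lambda>x. x + \<tau> *\<^sub>R X (k * \<tau>) x"
  have contS: "continuous_on disc ?S"
    using t by (intro continuous_intros continuous_on_X) auto
  have "(1 - \<tau>\<^sup>2 * C) ^ Suc k * integral disc (\<lambda>x. f (euler \<tau> (Suc k) x)) \<le> integral disc f"
    if f: "continuous_on disc f" "\<forall>x\<in>disc. 0 \<le> f x" for f
  proof -
    have "continuous_on disc (\<lambda>x. f (?S x))"
      by (rule continuous_on_compose2[OF f(1) contS]) (use step(1) in auto)
    then have "(1 - \<tau>\<^sup>2 * C) ^ k * integral disc (\<lambda>x. f (?S (euler \<tau> k x))) \<le> integral disc (\<lambda>x. f (?S x))"
      using IH(3)[of "\<lambda>x. f (?S x)"] f(2) step(1) by blast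
    then have "(1 - \<tau>\<^sup>2 * C) * ((1 - \<tau>\<^sup>2 * C) ^ k * integral disc (\<lambda>x. f (?S (euler \<tau> k x)))) \<le>
        (1 - \<tau>\<^sup>2 * C) * integral disc (\<lambda>x. f (?S x))"
      using \<tau>(4) by (intro mult_left_mono) auto
    also have "\<dots> \<le> integral disc f"
      using step(2)[OF _ f(1)] f(2) by blast
    finally show ?thesis
      by (simp add: mult.assoc)
  qed
  moreover have "\<forall>x\<in>disc. euler \<tau> (Suc k) x \<in> disc"
    using IH(1) step(1) by simp
  moreover have "continuous_on disc (euler \<tau> (Suc k))"
    unfolding euler.simps by (rule continuous_on_compose2[OF contS IH(2)]) (use IH(1) in blast)
  ultimately show ?case
    by blast
qed simp

end

text \<open>The product of |z|^2 with exp(-2 C t) does not increase and the product with exp(2 C t)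
  does not decrease. The backward estimate is the source of injectivity of flows.\<close>

lemma gronwall_norm:
  fixes z z' :: "real \<Rightarrow> 'a::real_inner"
  assumes z: "\<And>t. t \<in> {0..1} \<Longrightarrow> (z has_vector_derivative z' t) (at t within {0..1})"
    and bound: "\<And>t. t \<in> {0..1} \<Longrightarrow> norm (z' t) \<le> C * norm (z t)"
    and t: "t \<in> {0..1}"
  shows "norm (z t) \<le> exp (C * t) * norm (z 0)" and "norm (z 0) \<le> exp (C * t) * norm (z t)"
proof -
  have abs_le: "\<bar>z s \<bullet> z' s\<bar> \<le> C * (z s \<bullet> z s)" if s: "s \<in> {0..1}" for s
  proof -
    have "\<bar>z s \<bullet> z' s\<bar> \<le> norm (z s) * norm (z' s)"
      by (rule Cauchy_Schwarz_ineq2)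
    also have "\<dots> \<le> norm (z s) * (C * norm (z s))"
      by (intro mult_left_mono bound s) simp
    finally show ?thesis
      by (simp add: power2_eq_square mult_ac flip: power2_norm_eq_inner)
  qed
  \<comment> \<open>One mean value statement serves both signs, k = C and k = -C.\<close>
  have mono: "\<exists>s\<in>{0..t}. (z t \<bullet> z t) * exp (2 * k * t) - z 0 \<bullet> z 0 =
      t * (2 * exp (2 * k * s) * (z s \<bullet> z' s + k * (z s \<bullet> z s)))" for k
  proof -
    let ?f = "\<lambda>s. (z s \<bullet> z s) * exp (2 * k * s)"
    let ?f' = "\<lambda>s h. h * (2 * exp (2 * k * s) * (z s \<bullet> z' s + k * (z s \<bullet> z s)))"
    have "(?f has_derivative ?f' s) (at s within {0..t})" if "0 \<le> s" "s \<le> t" for s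
    proof -
      have "(z has_derivative (\<lambda>h. h *\<^sub>R z' s)) (at s within {0..t})"
        using z[of s] that t unfolding has_vector_derivative_def by (auto elim: has_derivative_subset)
      then show ?thesis
        by (auto intro!: derivative_eq_intros simp: fun_eq_iff algebra_simps inner_commute)
    qed
    from mvt_very_simple[of 0 t ?f ?f', OF _ this] t show ?thesis
      by auto
  qed
  have sq: "a \<le> exp (C * t) * b" if "a\<^sup>2 \<le> b\<^sup>2 * exp (2 * C * t)" "0 \<le> b" for a b :: real
  proof (rule power2_le_imp_le)
    have "exp (2 * C * t) = (exp (C * t))\<^sup>2"
      by (simp add: power2_eq_square flip: exp_add)
    then show "a\<^sup>2 \<le> (exp (C * t) * b)\<^sup>2"
      using that by (simp add: power_mult_distrib mult.commute)
  qed (use that in simp)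
  obtain s where s: "s \<in> {0..t}" and 1: "(z t \<bullet> z t) * exp (2 * C * t) - z 0 \<bullet> z 0 =
      t * (2 * exp (2 * C * s) * (z s \<bullet> z' s + C * (z s \<bullet> z s)))"
    using mono by blast
  have "0 \<le> z s \<bullet> z' s + C * (z s \<bullet> z s)"
    using abs_le[of s] s t by (simp add: abs_le_iff)
  then have "0 \<le> (z t \<bullet> z t) * exp (2 * C * t) - z 0 \<bullet> z 0"
    unfolding 1 using t by simp
  then show "norm (z 0) \<le> exp (C * t) * norm (z t)"
    by (intro sq) (simp_all add: power2_norm_eq_inner)
  obtain s where s: "s \<in> {0..t}" and 2: "(z t \<bullet> z t) * exp (2 * (- C) * t) - z 0 \<bullet> z 0 =
      t * (2 * exp (2 * (- C) * s) * (z s \<bullet> z' s + (- C) * (z s \<bullet> z s)))"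
    using mono by blast
  have "z s \<bullet> z' s + (- C) * (z s \<bullet> z s) \<le> 0"
    using abs_le[of s] s t by (simp add: abs_le_iff)
  then have "(z t \<bullet> z t) * exp (2 * (- C) * t) - z 0 \<bullet> z 0 \<le> 0"
    unfolding 2 using t by (intro mult_nonneg_nonpos) auto
  then have "z t \<bullet> z t \<le> (z 0 \<bullet> z 0) * exp (2 * C * t)"
    by (simp add: exp_minus field_simps)
  then show "norm (z t) \<le> exp (C * t) * norm (z 0)"
    by (intro sq) (simp_all add: power2_norm_eq_inner)
qed

section \<open>Convergence of the Euler scheme to the flow and preservation of integrals\<close>

lemma continuous_on_disc_bounded:
  fixes f :: "plane \<Rightarrow> real"
  assumes "continuous_on disc f"
  shows "\<exists>M. \<forall>x\<in>disc. \<bar>f x\<bar> \<le> M"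
  using compact_imp_bounded[OF compact_continuous_image[OF assms compact_cball]]
  by (simp add: bounded_iff)

text \<open>This mirrors \<open>hamiltonian_flow\<close>: for each initial point a solution that
  stays in the disc, with no regularity in the initial point. Continuity, injectivity and
  preservation of integrals are derived.\<close>

locale hamiltonian_motion = hamiltonian +
  fixes \<phi> :: "real \<Rightarrow> plane \<Rightarrow> plane"
  assumes start: "\<And>x. x \<in> disc \<Longrightarrow> \<phi> 0 x = x"
    and stays: "\<And>t x. t \<in> {0..1} \<Longrightarrow> x \<in> disc \<Longrightarrow> \<phi> t x \<in> disc"
    and flow: "\<And>t x. t \<in> {0..1} \<Longrightarrow> x \<in> disc \<Longrightarrow>
       ((\<lambda>s. \<phi> s x) has_vector_derivative X t (\<phi> t x)) (at t within {0..1})"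
begin

lemma flow_lipschitz_time:
  assumes "s \<in> {0..1}" "t \<in> {0..1}" "x \<in> disc"
  shows "norm (\<phi> t x - \<phi> s x) \<le> 4 * L * \<bar>t - s\<bar>"
proof -
  have "norm (\<phi> t x - \<phi> s x) \<le> 4 * L * norm (t - s)"
  proof (rule differentiable_bound[of "{0..1}"])
    show "((\<lambda>s. \<phi> s x) has_derivative (\<lambda>h. h *\<^sub>R X u (\<phi> u x))) (at u within {0..1})" if "u \<in> {0..1}" for u
      using flow[OF that assms(3)] by (simp add: has_vector_derivative_def)
    show "onorm (\<lambda>h. h *\<^sub>R X u (\<phi> u x)) \<le> 4 * L" if "u \<in> {0..1}" for u
    proof (rule onorm_le)
      show "norm (h *\<^sub>R X u (\<phi> u x)) \<le> 4 * L * norm h" for h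
        using mult_left_mono[OF X_bound[OF that stays[OF that assms(3)]], of "\<bar>h\<bar>"] by (simp add: mult.commute)
    qed
  qed (use assms in auto)
  then show ?thesis
    by simp
qed

text \<open>Gronwall's inequality for the difference of two orbits, with the Lipschitz constant 2 *
  L of the field.\<close>

lemma flow_bilipschitz:
  assumes "t \<in> {0..1}" "x \<in> disc" "y \<in> disc"
  shows "norm (\<phi> t x - \<phi> t y) \<le> exp (2 * L * t) * norm (x - y)"
    and "norm (x - y) \<le> exp (2 * L * t) * norm (\<phi> t x - \<phi> t y)"
proof -
  have "((\<lambda>t. \<phi> t x - \<phi> t y) has_vector_derivative X t (\<phi> t x) - X t (\<phi> t y)) (at t within {0..1})" if "t \<in> {0..1}" for t
    using that assms by (intro has_vector_derivative_diff flow)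
  moreover have "norm (X t (\<phi> t x) - X t (\<phi> t y)) \<le> 2 * L * norm (\<phi> t x - \<phi> t y)" if "t \<in> {0..1}" for t
    using X_lipschitz[OF that that stays[OF that assms(2)] stays[OF that assms(3)]] by simp
  ultimately show "norm (\<phi> t x - \<phi> t y) \<le> exp (2 * L * t) * norm (x - y)"
    and "norm (x - y) \<le> exp (2 * L * t) * norm (\<phi> t x - \<phi> t y)"
    using gronwall_norm[of "\<lambda>t. \<phi> t x - \<phi> t y" "\<lambda>t. X t (\<phi> t x) - X t (\<phi> t y)" "2 * L" t] assms start by auto
qed

text \<open>A boundary point is a zero of the field, so the deviation of its orbit from it obeys a
  Gronwall estimate with initial value 0.\<close>

lemma flow_boundary:
  assumes t: "t \<in> {0..1}" and y: "norm y = 1"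
  shows "\<phi> t y = y"
proof -
  have yd: "y \<in> disc"
    using y by simp
  have "((\<lambda>t. \<phi> t y - y) has_vector_derivative X t (\<phi> t y)) (at t within {0..1})" if "t \<in> {0..1}" for t
    using has_vector_derivative_diff[OF flow[OF that yd] has_vector_derivative_const] by simp
  moreover have "norm (X t (\<phi> t y)) \<le> 2 * L * norm (\<phi> t y - y)" if "t \<in> {0..1}" for t
    using X_lipschitz[OF that that stays[OF that yd] yd] X_zero[OF that, of y] r y by simp
  ultimately have "norm (\<phi> t y - y) \<le> exp (2 * L * t) * norm (\<phi> 0 y - y)"
    using gronwall_norm(1)[of "\<lambda>t. \<phi> t y - y" "\<lambda>t. X t (\<phi> t y)" "2 * L" t] t by auto
  then show ?thesis
    using start[OF yd] by simp
qed

lemma continuous_on_flow_pair: "continuous_on ({0..1} \<times> disc) (\<lambda>(t, x). \<phi> t x)"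
proof (rule continuous_on_of_lipschitz[of "4 * L + exp (2 * L)"])
  fix s t :: real and x y assume *: "s \<in> {0..1}" "t \<in> {0..1}" "x \<in> disc" "y \<in> disc"
  have "norm (\<phi> t x - \<phi> s y) \<le> norm (\<phi> t x - \<phi> s x) + norm (\<phi> s x - \<phi> s y)"
    using norm_triangle_ineq[of "\<phi> t x - \<phi> s x" "\<phi> s x - \<phi> s y"] by simp
  also have "\<dots> \<le> 4 * L * \<bar>t - s\<bar> + exp (2 * L * s) * norm (x - y)"
    using * by (intro add_mono flow_lipschitz_time flow_bilipschitz)
  also have "exp (2 * L * s) * norm (x - y) \<le> exp (2 * L) * norm (x - y)"
    using * L by (intro mult_right_mono) (auto simp: mult_left_le)
  finally have "norm (\<phi> t x - \<phi> s y) \<le> 4 * L * \<bar>t - s\<bar> + exp (2 * L) * norm (x - y)"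
    by simp
  also have "\<dots> \<le> (4 * L + exp (2 * L)) * \<bar>t - s\<bar> + (4 * L + exp (2 * L)) * norm (x - y)"
    using L by (intro add_mono mult_right_mono) auto
  finally show "norm (\<phi> t x - \<phi> s y) \<le> (4 * L + exp (2 * L)) * (\<bar>t - s\<bar> + norm (x - y))"
    by (simp add: distrib_left)
qed (use L in \<open>simp add: add_nonneg_nonneg\<close>)

text \<open>Windings become available for Hamiltonian flows, which are known here as solutions of a
  differential equation and not as smooth isotopies.\<close>

sublocale motion \<phi> "\<lambda>t x. X t (\<phi> t x)"
proof
  show "continuous_on ({0..1} \<times> disc) (\<lambda>(t, x). \<phi> t x)"
    by (rule continuous_on_flow_pair)
  show "continuous_on ({0..1} \<times> disc) (\<lambda>(t, x). X t (\<phi> t x))"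
    using continuous_on_flow_pair stays unfolding case_prod_beta
    by (intro continuous_on_X continuous_intros) auto
  show "inj_on (\<phi> t) disc" if t: "t \<in> {0..1}" for t
  proof (rule inj_onI)
    fix x y assume "x \<in> disc" "y \<in> disc" "\<phi> t x = \<phi> t y"
    then show "x = y"
      using flow_bilipschitz(2)[OF t, of x y] by simp
  qed
qed (use start stays flow flow_boundary in auto)

text \<open>One step commits an error of at most \<tau>^2 * c with c = 2 L (1 + 4 L): along an orbit
  of speed at most 4 L the field changes at rate at most c. An error already present is magnified by
  at most 1 + 2 L \<tau> in each step.\<close>

lemma euler_error:
  assumes \<tau>: "0 \<le> \<tau>" and x: "x \<in> disc"
    and eu: "\<And>k. k * \<tau> \<le> 1 \<Longrightarrow> euler \<tau> k x \<in> disc"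
  shows "k * \<tau> \<le> 1 \<Longrightarrow>
    norm (euler \<tau> k x - \<phi> (k * \<tau>) x) \<le> k * (\<tau>\<^sup>2 * (2 * L * (1 + 4 * L))) * (1 + 2 * L * \<tau>) ^ k"
proof (induction k)
  case 0
  then show ?case
    using start[OF x] by simp
next
  case (Suc k)
  define c where "c = 2 * L * (1 + 4 * L)"
  define s where "s = k * \<tau>"
  have s: "s \<in> {0..1}" "s + \<tau> \<in> {0..1}" "k * \<tau> \<le> 1"
    using Suc.prems \<tau> by (auto simp: s_def algebra_simps)
  have c: "0 \<le> c"
    using L by (simp add: c_def)
  let ?E = "euler \<tau> k x"
  have E: "?E \<in> disc"
    using eu s(3) by simp
  have one_step: "norm (\<phi> (s + \<tau>) x - \<phi> s x - \<tau> *\<^sub>R X s (\<phi> s x)) \<le> \<tau>\<^sup>2 * c"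
  proof -
    have sub: "{s..s + \<tau>} \<subseteq> {0..1}"
      using s by auto
    have "norm (\<phi> (s + \<tau>) x - \<phi> s x - ((s + \<tau>) - s) *\<^sub>R X s (\<phi> s x)) \<le> norm ((s + \<tau>) - s) * (\<tau> * c)"
    proof (rule vector_differentiable_bound_linearization[of "{s..s + \<tau>}" _ "\<lambda>u. X u (\<phi> u x)"])
      show "((\<lambda>s. \<phi> s x) has_vector_derivative X u (\<phi> u x)) (at u within {s..s + \<tau>})" if "u \<in> {s..s + \<tau>}" for u
        using that sub by (intro has_vector_derivative_within_subset[OF flow[OF _ x] sub]) auto
      show "closed_segment s (s + \<tau>) \<subseteq> {s..s + \<tau>}" "s \<in> {s..s + \<tau>}"
        using \<tau> by (auto simp: closed_segment_eq_real_ivl)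
      fix u assume u: "u \<in> {s..s + \<tau>}"
      then have u1: "u \<in> {0..1}" "\<bar>u - s\<bar> \<le> \<tau>"
        using sub by auto
      have "norm (X u (\<phi> u x) - X s (\<phi> s x)) \<le> 2 * L * (\<bar>u - s\<bar> + norm (\<phi> u x - \<phi> s x))"
        using u1 s x by (intro X_lipschitz stays)
      also have "\<dots> \<le> 2 * L * (\<bar>u - s\<bar> + 4 * L * \<bar>u - s\<bar>)"
        using u1 s x L by (intro mult_left_mono add_left_mono flow_lipschitz_time) auto
      also have "\<dots> = c * \<bar>u - s\<bar>"
        by (simp add: c_def algebra_simps)
      also have "\<dots> \<le> c * \<tau>"
        using u1 c by (intro mult_left_mono)
      finally show "norm (X u (\<phi> u x) - X s (\<phi> s x)) \<le> \<tau> * c"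
        by (simp add: mult.commute)
    qed
    then show ?thesis
      using \<tau> by (simp add: power2_eq_square)
  qed
  let ?q = "1 + 2 * L * \<tau>"
  have q: "1 \<le> ?q"
    using L \<tau> by simp
  have IH: "norm (?E - \<phi> s x) \<le> k * (\<tau>\<^sup>2 * c) * ?q ^ k"
    using Suc.IH s(3) by (simp add: c_def s_def)
  \<comment> \<open>The old error, its propagation by the field, and the error committed by the new
    step.\<close>
  have eq: "euler \<tau> (Suc k) x - \<phi> (Suc k * \<tau>) x =
      (?E - \<phi> s x) + \<tau> *\<^sub>R (X s ?E - X s (\<phi> s x)) - (\<phi> (s + \<tau>) x - \<phi> s x - \<tau> *\<^sub>R X s (\<phi> s x))"
    by (simp add: s_def algebra_simps)
  have 1: "norm (euler \<tau> (Suc k) x - \<phi> (Suc k * \<tau>) x) \<le>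
      norm (?E - \<phi> s x) + norm (\<tau> *\<^sub>R (X s ?E - X s (\<phi> s x))) + \<tau>\<^sup>2 * c"
    unfolding eq by (rule order_trans[OF norm_triangle_ineq4 add_mono[OF norm_triangle_ineq one_step]])
  have "norm (X s ?E - X s (\<phi> s x)) \<le> 2 * L * norm (?E - \<phi> s x)"
    using X_lipschitz[OF s(1) s(1) E stays[OF s(1) x]] by simp
  from mult_left_mono[OF this \<tau>]
  have 2: "norm (\<tau> *\<^sub>R (X s ?E - X s (\<phi> s x))) \<le> \<tau> * (2 * L * norm (?E - \<phi> s x))"
    using \<tau> by simp
  have "norm (?E - \<phi> s x) * ?q = norm (?E - \<phi> s x) + \<tau> * (2 * L * norm (?E - \<phi> s x))"
    by (simp add: algebra_simps)
  with 1 2 have "norm (euler \<tau> (Suc k) x - \<phi> (Suc k * \<tau>) x) \<le> norm (?E - \<phi> s x) * ?q + \<tau>\<^sup>2 * c"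
    by linarith
  also have "\<dots> \<le> k * (\<tau>\<^sup>2 * c) * ?q ^ k * ?q + \<tau>\<^sup>2 * c * ?q ^ Suc k"
  proof (rule add_mono)
    show "norm (?E - \<phi> s x) * ?q \<le> k * (\<tau>\<^sup>2 * c) * ?q ^ k * ?q"
      using q by (intro mult_right_mono IH) simp
    have "\<tau>\<^sup>2 * c * 1 \<le> \<tau>\<^sup>2 * c * ?q ^ Suc k"
      using c q by (intro mult_left_mono one_le_power) simp_all
    then show "\<tau>\<^sup>2 * c \<le> \<tau>\<^sup>2 * c * ?q ^ Suc k"
      by simp
  qed
  also have "\<dots> = Suc k * (\<tau>\<^sup>2 * c) * ?q ^ Suc k"
    by (simp add: algebra_simps)
  finally show ?case
    by (simp add: c_def)
qed

text \<open>With N steps of size \<tau> = t / N the factor of the Euler scheme is (1 - \<tau>^2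
  C)^N, which tends to 1 because N \<tau>^2 = t \<tau>. The Euler maps converge pointwise to \<phi>
  t and f is bounded, so dominated convergence gives the limit of the integrals.\<close>

lemma flow_integral_le:
  fixes f :: "plane \<Rightarrow> real"
  assumes t: "t \<in> {0..1}" and f: "continuous_on disc f" "\<And>x. x \<in> disc \<Longrightarrow> 0 \<le> f x"
  shows "integral disc (\<lambda>x. f (\<phi> t x)) \<le> integral disc f"
proof -
  obtain C where "0 \<le> C" and C: "\<And>t x. t \<in> {0..1} \<Longrightarrow> x \<in> disc \<Longrightarrow>
     \<bar>B t x (axis 2 1) * A t x (axis 1 1) - B t x (axis 1 1) * A t x (axis 2 1)\<bar> \<le> C"
    using jacobian_bound by blast
  define \<tau> where "\<tau> N = t / real N" for N
  have \<tau>0: "\<tau> \<longlonglongrightarrow> 0"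
    unfolding \<tau>_def by (rule lim_const_over_n)
  have "(\<lambda>N. \<tau> N * (4 * L)) \<longlonglongrightarrow> 0 * (4 * L)" "(\<lambda>N. \<tau> N * (2 * L)) \<longlonglongrightarrow> 0 * (2 * L)"
    "(\<lambda>N. (\<tau> N)\<^sup>2 * C) \<longlonglongrightarrow> 0\<^sup>2 * C"
    by (intro tendsto_mult_right tendsto_power \<tau>0)+
  then have "\<forall>\<^sub>F N in sequentially. \<tau> N * (4 * L) < 1 - r" "\<forall>\<^sub>F N in sequentially. \<tau> N * (2 * L) < 1"
    "\<forall>\<^sub>F N in sequentially. (\<tau> N)\<^sup>2 * C < 1"
    using r by (auto dest!: order_tendstoD(2))
  then have "\<forall>\<^sub>F N in sequentially. N > 0 \<and> \<tau> N * (4 * L) \<le> 1 - r \<and> \<tau> N * (2 * L) < 1 \<and> (\<tau> N)\<^sup>2 * C \<le> 1"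
    using eventually_gt_at_top[of 0] by eventually_elim auto
  then obtain N0 where N0: "\<And>N. N \<ge> N0 \<Longrightarrow> N > 0 \<and> \<tau> N * (4 * L) \<le> 1 - r \<and> \<tau> N * (2 * L) < 1 \<and> (\<tau> N)\<^sup>2 * C \<le> 1"
    unfolding eventually_sequentially by blast
  have N\<tau>: "real N * \<tau> N = t" "0 \<le> \<tau> N" if "N \<ge> N0" for N
    using N0[OF that] t by (auto simp: \<tau>_def)
  have eu: "(\<forall>x\<in>disc. euler (\<tau> N) k x \<in> disc) \<and> continuous_on disc (euler (\<tau> N) k) \<and>
     (1 - (\<tau> N)\<^sup>2 * C) ^ k * integral disc (\<lambda>x. f (euler (\<tau> N) k x)) \<le> integral disc f"
    if "N \<ge> N0" "real k * \<tau> N \<le> 1" for N k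
    using euler_integral_le[OF N\<tau>(2)[OF that(1)] _ _ _ C that(2)] N0[OF that(1)] f by auto
  have euN: "(\<forall>x\<in>disc. euler (\<tau> N) N x \<in> disc) \<and> continuous_on disc (euler (\<tau> N) N) \<and>
     (1 - (\<tau> N)\<^sup>2 * C) ^ N * integral disc (\<lambda>x. f (euler (\<tau> N) N x)) \<le> integral disc f" if "N \<ge> N0" for N
    using eu[OF that, of N] N\<tau>(1)[OF that] t by simp
  \<comment> \<open>Shifted by \<open>N0\<close>, so that the smallness conditions on the step size
    hold for all indices.\<close>
  define g where "g N x = f (euler (\<tau> (N + N0)) (N + N0) x)" for N x
  have conv: "(\<lambda>N. g N x) \<longlonglongrightarrow> f (\<phi> t x)" if x: "x \<in> disc" for x
  proof -
    let ?E = "\<lambda>N. euler (\<tau> N) N x"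
    define c where "c = 2 * L * (1 + 4 * L)"
    have c: "0 \<le> c"
      using L by (simp add: c_def)
    have le: "norm (?E N - \<phi> t x) \<le> c * exp (2 * L) * \<tau> N" if N: "N \<ge> N0" for N
    proof -
      have "norm (?E N - \<phi> (N * \<tau> N) x) \<le> N * ((\<tau> N)\<^sup>2 * c) * (1 + 2 * L * \<tau> N) ^ N"
        unfolding c_def using eu[OF N] x N\<tau>[OF N] t by (intro euler_error) auto
      also have "(1 + 2 * L * \<tau> N) ^ N \<le> exp (2 * L)"
      proof -
        have "(1 + 2 * L * \<tau> N) ^ N \<le> exp (2 * L * \<tau> N) ^ N"
          using L N\<tau>[OF N] by (intro power_mono exp_ge_add_one_self) auto
        also have "\<dots> = exp (2 * L * (N * \<tau> N))"
          by (simp add: mult_ac flip: exp_of_nat_mult)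
        also have "\<dots> \<le> exp (2 * L)"
          using L t N\<tau>[OF N] by (simp add: mult_left_le)
        finally show ?thesis .
      qed
      also have "N * ((\<tau> N)\<^sup>2 * c) * exp (2 * L) = t * (c * exp (2 * L) * \<tau> N)"
        using N\<tau>(1)[OF N] by (simp add: power2_eq_square mult_ac)
      also have "\<dots> \<le> 1 * (c * exp (2 * L) * \<tau> N)"
        using t c N\<tau>[OF N] by (intro mult_right_mono) auto
      finally show ?thesis
        using N\<tau>(1)[OF N] c N\<tau>(2)[OF N] by (simp add: mult_left_mono)
    qed
    have null: "(\<lambda>N. c * exp (2 * L) * \<tau> N) \<longlonglongrightarrow> 0"
      using tendsto_mult_left[OF \<tau>0, of "c * exp (2 * L)"] by simp
    have "\<forall>\<^sub>F N in sequentially. norm (?E N - \<phi> t x) \<le> c * exp (2 * L) * \<tau> N"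
      using le by (rule eventually_sequentiallyI)
    then have "(\<lambda>N. ?E N - \<phi> t x) \<longlonglongrightarrow> 0"
      using null by (rule Lim_null_comparison)
    then have "?E \<longlonglongrightarrow> \<phi> t x"
      by (rule LIM_zero_cancel)
    then have E: "(\<lambda>N. ?E (N + N0)) \<longlonglongrightarrow> \<phi> t x"
      by (rule LIMSEQ_ignore_initial_segment)
    have "\<forall>N. ?E (N + N0) \<in> disc"
      using euN x le_add2 by blast
    then show ?thesis
      unfolding g_def using f(1)[unfolded continuous_on_sequentially] E stays[OF t x] by (simp add: o_def)
  qed
  have cg: "continuous_on disc (g N)" for N
    unfolding g_def using euN[of "N + N0"]
    by (intro continuous_on_compose2[OF f(1)]) auto
  have cphi: "continuous_on disc (\<lambda>x. f (\<phi> t x))"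
    using t stays by (intro continuous_on_compose2[OF f(1)] continuous_intros) auto
  obtain M where M: "\<And>x. x \<in> disc \<Longrightarrow> \<bar>f x\<bar> \<le> M"
    using continuous_on_disc_bounded[OF f(1)] by blast
  have "(\<lambda>N. integral\<^sup>L (lborel_on disc) (g N)) \<longlonglongrightarrow> integral\<^sup>L (lborel_on disc) (\<lambda>x. f (\<phi> t x))"
  proof (rule integral_dominated_convergence[where w = "\<lambda>x. M"])
    interpret finite_measure "lborel_on disc :: plane measure"
      by (rule finite_measure_lborel_on) simp
    show "integrable (lborel_on disc) (\<lambda>x::plane. M)"
      by simp
    show "AE x in lborel_on disc. (\<lambda>N. g N x) \<longlonglongrightarrow> f (\<phi> t x)"
      using conv by (intro AE_I2) simp
    show "AE x in lborel_on disc. norm (g N x) \<le> M" for N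
      using euN[of "N + N0"] M by (intro AE_I2) (simp add: g_def)
    show "(\<lambda>x. f (\<phi> t x)) \<in> borel_measurable (lborel_on disc)" "g N \<in> borel_measurable (lborel_on disc)" for N
      using cg cphi by (simp_all add: borel_measurable_continuous_on_space[OF id_measurable_lborel_on])
  qed
  then have lim: "(\<lambda>N. integral disc (g N)) \<longlonglongrightarrow> integral disc (\<lambda>x. f (\<phi> t x))"
    by (simp add: integrable_continuous_compact(3)[OF compact_cball] cg cphi)
  have "(\<lambda>N. 1 - C * \<tau> (N + N0)) \<longlonglongrightarrow> 1 - C * 0"
    by (intro tendsto_intros LIMSEQ_ignore_initial_segment \<tau>0)
  then have "(\<lambda>N. (1 - C * \<tau> (N + N0)) * integral disc (g N)) \<longlonglongrightarrow> (1 - C * 0) * integral disc (\<lambda>x. f (\<phi> t x))"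
    by (rule tendsto_mult[OF _ lim])
  moreover have "(1 - C * \<tau> (N + N0)) * integral disc (g N) \<le> integral disc f" for N
  proof -
    define K where "K = N + N0"
    have K: "K \<ge> N0" "K * \<tau> K \<le> 1"
      using N\<tau>(1)[of K] t by (auto simp: K_def)
    have g0: "0 \<le> integral disc (g N)"
      using euN[OF K(1)] f(2) by (intro integral_nonneg integrable_continuous_compact(1) compact_cball cg)
        (auto simp: g_def K_def)
    \<comment> \<open>Bernoulli's inequality, with K \<tau> K = t \<le> 1, bounds the factor of the
      scheme below by 1 - C * \<tau> K.\<close>
    have "1 - C * \<tau> K \<le> 1 - C * \<tau> K * t"
      using t \<open>0 \<le> C\<close> N\<tau>[OF K(1)] by (simp add: mult_left_le)
    also have "\<dots> = 1 + K * (- ((\<tau> K)\<^sup>2 * C))"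
      using N\<tau>(1)[OF K(1)] by (simp add: power2_eq_square mult_ac)
    also have "\<dots> \<le> (1 + (- ((\<tau> K)\<^sup>2 * C))) ^ K"
      using N0[OF K(1)] by (intro Bernoulli_inequality) auto
    finally have "(1 - C * \<tau> K) * integral disc (g N) \<le> (1 - (\<tau> K)\<^sup>2 * C) ^ K * integral disc (g N)"
      using g0 by (intro mult_right_mono) auto
    also have "\<dots> \<le> integral disc f"
    proof -
      have "g N = (\<lambda>x. f (euler (\<tau> K) K x))"
        by (simp add: g_def K_def fun_eq_iff)
      then show ?thesis
        using euN[OF K(1)] by simp
    qed
    finally show ?thesis
      by (simp add: K_def)
  qed
  ultimately have "(1 - C * 0) * integral disc (\<lambda>x. f (\<phi> t x)) \<le> integral disc f"
    by (intro LIMSEQ_le_const2) auto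
  then show ?thesis
    by simp
qed

text \<open>For a bound M of |f| both M - f and M + f are nonnegative, and the inequality for them
  gives the two directions; the constant M contributes the same on both sides.\<close>

lemma flow_preserves_integral:
  fixes f :: "plane \<Rightarrow> real"
  assumes t: "t \<in> {0..1}" and f: "continuous_on disc f"
  shows "integral disc (\<lambda>x. f (\<phi> t x)) = integral disc f"
proof -
  obtain M where M: "\<And>x. x \<in> disc \<Longrightarrow> \<bar>f x\<bar> \<le> M"
    using continuous_on_disc_bounded[OF f] by blast
  have cphi: "continuous_on disc (\<lambda>x. f (\<phi> t x))"
    using t stays by (intro continuous_on_compose2[OF f] continuous_intros) auto
  note int = integrable_continuous_compact(1)[OF compact_cball]
  have ci: "(\<lambda>x::plane. M) integrable_on disc"
    by (intro int continuous_on_const)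
  have "integral disc (\<lambda>x. M - f (\<phi> t x)) \<le> integral disc (\<lambda>x. M - f x)"
    using f M by (intro flow_integral_le t continuous_intros) (auto simp: abs_le_iff)
  then have 1: "integral disc f \<le> integral disc (\<lambda>x. f (\<phi> t x))"
    using int[OF f] int[OF cphi] ci by (simp add: Henstock_Kurzweil_Integration.integral_diff)
  have "integral disc (\<lambda>x. M + f (\<phi> t x)) \<le> integral disc (\<lambda>x. M + f x)"
    using f M by (intro flow_integral_le t continuous_intros) (auto simp: abs_le_iff, smt (verit) M abs_le_iff)
  then have "integral disc (\<lambda>x. f (\<phi> t x)) \<le> integral disc f"
    using int[OF f] int[OF cphi] ci by (simp add: Henstock_Kurzweil_Integration.integral_add)
  with 1 show ?thesis
    by simp
qed

end

section \<open>Winding and the Calabi invariant\<close>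

lemma iterated_integral:
  fixes F :: "'a::euclidean_space \<Rightarrow> 'b::euclidean_space \<Rightarrow> real"
  assumes A: "compact A" and B: "compact B" and F: "continuous_on (A \<times> B) (\<lambda>(x, y). F x y)"
  shows "integral\<^sup>L (lborel_on A \<Otimes>\<^sub>M lborel_on B) (\<lambda>(x, y). F x y) = integral A (\<lambda>x. integral B (F x))"
    and "integral A (\<lambda>x. integral B (F x)) = integral B (\<lambda>y. integral A (\<lambda>x. F x y))"
proof -
  interpret A: finite_measure "lborel_on A"
    using A by (rule finite_measure_lborel_on)
  interpret B: finite_measure "lborel_on B"
    using B by (rule finite_measure_lborel_on)
  interpret pair_sigma_finite "lborel_on A" "lborel_on B" ..
  interpret AB: finite_measure "lborel_on A \<Otimes>\<^sub>M lborel_on B"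
    by (rule finite_measure_pair_measure) unfold_locales
  have sp: "space (lborel_on A \<Otimes>\<^sub>M lborel_on B) = A \<times> B"
    by (simp add: space_pair_measure)
  have meas: "(\<lambda>(x, y). F x y) \<in> borel_measurable (lborel_on A \<Otimes>\<^sub>M lborel_on B)"
    by (rule borel_measurable_continuous_on_space[OF id_measurable_pair[OF id_measurable_lborel_on id_measurable_lborel_on]])
      (simp only: sp F)
  obtain M where M: "\<And>z. z \<in> A \<times> B \<Longrightarrow> norm (case z of (x, y) \<Rightarrow> F x y) \<le> M"
    using compact_imp_bounded[OF compact_continuous_image[OF F compact_Times[OF A B]]]
    unfolding bounded_iff by blast
  have int: "integrable (lborel_on A \<Otimes>\<^sub>M lborel_on B) (\<lambda>(x, y). F x y)"
    using M meas by (intro AB.integrable_const_bound[of _ M] AE_I2) (simp_all only: sp)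
  have c1: "continuous_on B (F x)" if "x \<in> A" for x
  proof -
    have "continuous_on B (\<lambda>y. case (x, y) of (x, y) \<Rightarrow> F x y)"
      by (rule continuous_on_compose2[OF F]) (use that in \<open>auto intro!: continuous_intros\<close>)
    then show ?thesis by simp
  qed
  have c2: "continuous_on A (\<lambda>x. F x y)" if "y \<in> B" for y
  proof -
    have "continuous_on A (\<lambda>x. case (x, y) of (x, y) \<Rightarrow> F x y)"
      by (rule continuous_on_compose2[OF F]) (use that in \<open>auto intro!: continuous_intros\<close>)
    then show ?thesis by simp
  qed
  have F': "continuous_on (B \<times> A) (\<lambda>(y, x). F x y)"
  proof -
    have "continuous_on (B \<times> A) (\<lambda>z. case (snd z, fst z) of (x, y) \<Rightarrow> F x y)"
      by (rule continuous_on_compose2[OF F]) (auto intro!: continuous_intros)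
    then show ?thesis by (simp add: case_prod_beta)
  qed
  have 1: "integral\<^sup>L (lborel_on A) (\<lambda>x. integral\<^sup>L (lborel_on B) (F x)) = integral A (\<lambda>x. integral B (F x))"
    unfolding integrable_continuous_compact(3)[OF A continuous_on_integral_compact[OF A B F], symmetric]
    by (rule Bochner_Integration.integral_cong) (auto simp: integrable_continuous_compact(3)[OF B c1])
  have 2: "integral\<^sup>L (lborel_on B) (\<lambda>y. integral\<^sup>L (lborel_on A) (\<lambda>x. F x y)) = integral B (\<lambda>y. integral A (\<lambda>x. F x y))"
    unfolding integrable_continuous_compact(3)[OF B continuous_on_integral_compact[OF B A F'], symmetric]
    by (rule Bochner_Integration.integral_cong) (auto simp: integrable_continuous_compact(3)[OF A c2])
  show "integral\<^sup>L (lborel_on A \<Otimes>\<^sub>M lborel_on B) (\<lambda>(x, y). F x y) = integral A (\<lambda>x. integral B (F x))"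
    using integral_fst'[OF int] 1 by simp
  show "integral A (\<lambda>x. integral B (F x)) = integral B (\<lambda>y. integral A (\<lambda>x. F x y))"
    using Fubini_integral[OF int] 1 2 by simp
qed

text \<open>The divergence of the regularised kernel \<open>z / (\<bar>z\<bar>\<^sup>2 + \<epsilon>\<^sup>2)\<close>.\<close>

definition mollifier :: "real \<Rightarrow> plane \<Rightarrow> real" where
  "mollifier \<epsilon> z = 2 * \<epsilon>\<^sup>2 / (z \<bullet> z + \<epsilon>\<^sup>2)\<^sup>2"

lemma mollifier_nonneg: "0 \<le> mollifier \<epsilon> z"
  by (simp add: mollifier_def)

lemma mollifier_minus_commute: "mollifier \<epsilon> (x - y) = mollifier \<epsilon> (y - x)"
  unfolding mollifier_def by (metis inner_minus_left inner_minus_right minus_diff_eq minus_minus)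

lemma continuous_on_mollifier:
  assumes "0 < \<epsilon>" "continuous_on S f"
  shows "continuous_on S (\<lambda>x. mollifier \<epsilon> (f x))"
proof -
  have "z \<bullet> z + \<epsilon>\<^sup>2 \<noteq> 0" for z :: plane
    using assms(1) by (metis add_nonneg_pos inner_ge_zero less_irrefl zero_less_power)
  then show ?thesis
    unfolding mollifier_def using assms by (intro continuous_intros) auto
qed

text \<open>On the ball of radius \<epsilon> the mollifier is at least 1 / (2 \<epsilon>^2), and the
  area is pi \<epsilon>^2. The bound does not depend on \<epsilon>, so the mass can be cancelled in
  a limit.\<close>

lemma mollifier_mass_lower_bound:
  assumes "0 < \<epsilon>" "\<epsilon> \<le> \<rho>"
  shows "pi / 2 \<le> integral (cball 0 \<rho>) (mollifier \<epsilon>)"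
proof -
  have int: "mollifier \<epsilon> integrable_on cball 0 s" for s
    by (intro integrable_continuous_compact(1)) (auto intro!: continuous_on_mollifier assms continuous_on_id)
  have "measure lebesgue (cball (0::plane) \<epsilon>) = pi * \<epsilon>\<^sup>2"
    using assms by (simp add: content_cball unit_ball_vol_2)
  then have "pi / 2 = integral (cball (0::plane) \<epsilon>) (\<lambda>z. 1 / (2 * \<epsilon>\<^sup>2))"
    using assms lmeasure_integral[OF lmeasurable_cball, of "0::plane" \<epsilon>]
      integral_mult_right[of "cball (0::plane) \<epsilon>" "1 / (2 * \<epsilon>\<^sup>2)" "\<lambda>z. 1"] by (simp add: field_simps)
  also have "\<dots> \<le> integral (cball 0 \<epsilon>) (mollifier \<epsilon>)"
  proof (rule integral_le[OF _ int])
    show "(\<lambda>z::plane. 1 / (2 * \<epsilon>\<^sup>2)) integrable_on cball 0 \<epsilon>"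
      by (intro integrable_continuous_compact(1)) auto
    fix z :: plane assume "z \<in> cball 0 \<epsilon>"
    then have "z \<bullet> z \<le> \<epsilon>\<^sup>2"
      by (simp add: power_mono flip: power2_norm_eq_inner)
    then have "(z \<bullet> z + \<epsilon>\<^sup>2)\<^sup>2 \<le> (2 * \<epsilon>\<^sup>2)\<^sup>2"
      by (intro power_mono) auto
    moreover have "0 < (z \<bullet> z + \<epsilon>\<^sup>2)\<^sup>2"
      using assms by (intro zero_less_power add_nonneg_pos) auto
    moreover have "0 < (2 * \<epsilon>\<^sup>2)\<^sup>2"
      using assms by simp
    ultimately have "2 * \<epsilon>\<^sup>2 / (2 * \<epsilon>\<^sup>2)\<^sup>2 \<le> mollifier \<epsilon> z"
      unfolding mollifier_def by (intro divide_left_mono mult_pos_pos) simp_all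
    moreover have "2 * \<epsilon>\<^sup>2 / (2 * \<epsilon>\<^sup>2)\<^sup>2 = 1 / (2 * \<epsilon>\<^sup>2)"
      using assms by (simp add: field_simps power2_eq_square)
    ultimately show "1 / (2 * \<epsilon>\<^sup>2) \<le> mollifier \<epsilon> z"
      by linarith
  qed
  also have "\<dots> \<le> integral (cball 0 \<rho>) (mollifier \<epsilon>)"
    using assms int by (intro integral_subset_le) (auto simp: mollifier_nonneg)
  finally show ?thesis .
qed

text \<open>The ball of radius \<rho> about x lies in the disc and, by translation, contributes
  exactly the second integral. Outside it the mollifier is at most 2 \<epsilon>^2 / \<rho>^4, and
  the disc has area pi.\<close>

lemma mollified_disc:
  assumes \<epsilon>: "0 < \<epsilon>" and \<rho>: "0 < \<rho>" and x: "norm x + \<rho> \<le> 1"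
  shows "\<bar>integral disc (\<lambda>y. mollifier \<epsilon> (x - y)) - integral (cball 0 \<rho>) (mollifier \<epsilon>)\<bar> \<le> 2 * pi * \<epsilon>\<^sup>2 / \<rho> ^ 4"
proof -
  let ?m = "\<lambda>y. mollifier \<epsilon> (- x + y)"
  have cont: "continuous_on S (mollifier \<epsilon>)" "continuous_on S ?m" for S
    by (intro continuous_on_mollifier \<epsilon> continuous_intros)+
  have borel: "(\<lambda>z. indicator (cball 0 \<rho>) z *\<^sub>R mollifier \<epsilon> z) \<in> borel_measurable borel"
    by (intro borel_measurable_continuous_on_indicator cont) auto
  have sub: "cball x \<rho> \<subseteq> disc"
  proof
    fix y assume "y \<in> cball x \<rho>"
    then show "y \<in> disc"
      using norm_triangle_ineq[of x "y - x"] x by (simp add: dist_norm norm_minus_commute)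
  qed
  have "integral (cball 0 \<rho>) (mollifier \<epsilon>) = (LINT z|lborel. indicator (cball 0 \<rho>) z *\<^sub>R mollifier \<epsilon> z)"
    using integrable_continuous_compact(3)[OF compact_cball cont(1)] by (simp add: integral_restrict_space)
  also have "\<dots> = (LINT z|distr lborel borel ((+) (- x)). indicator (cball 0 \<rho>) z *\<^sub>R mollifier \<epsilon> z)"
    by (simp only: lborel_distr_plus)
  also have "\<dots> = (LINT y|lborel. indicator (cball 0 \<rho>) (- x + y) *\<^sub>R ?m y)"
    using borel by (intro integral_distr) auto
  also have "\<dots> = (LINT y|lborel. indicator (cball x \<rho>) y *\<^sub>R ?m y)"
    by (intro Bochner_Integration.integral_cong refl) (auto simp: indicator_def dist_norm norm_minus_commute)
  also have "\<dots> = integral (cball x \<rho>) ?m"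
    using integrable_continuous_compact(3)[OF compact_cball cont(2)] by (simp add: integral_restrict_space)
  finally have shift: "integral (cball 0 \<rho>) (mollifier \<epsilon>) = integral (cball x \<rho>) ?m" .
  have int: "?m integrable_on cball a s" for a s
    by (intro integrable_continuous_compact(1) compact_cball cont)
  have "((\<lambda>y. if y \<in> cball x \<rho> then ?m y else 0) has_integral integral (cball x \<rho>) ?m) disc"
    unfolding has_integral_restrict[OF sub] by (rule integrable_integral[OF int])
  from has_integral_diff[OF integrable_integral[OF int] this]
  have D: "((\<lambda>y. ?m y - (if y \<in> cball x \<rho> then ?m y else 0)) has_integral
      integral disc ?m - integral (cball x \<rho>) ?m) disc" .
  have C: "((\<lambda>y::plane. 2 * \<epsilon>\<^sup>2 / \<rho> ^ 4) has_integral 2 * \<epsilon>\<^sup>2 / \<rho> ^ 4 * pi) disc"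
  proof -
    have "((\<lambda>y::plane. 1) has_integral pi) disc"
      using integrable_continuous_compact(1)[OF compact_cball continuous_on_const]
        lmeasure_integral[OF lmeasurable_cball, of "0::plane" 1] measure_disc by (simp add: has_integral_iff)
    from has_integral_mult_right[OF this, of "2 * \<epsilon>\<^sup>2 / \<rho> ^ 4"] show ?thesis
      by simp
  qed
  have "0 \<le> integral disc ?m - integral (cball x \<rho>) ?m"
    by (rule has_integral_nonneg[OF D]) (auto simp: mollifier_nonneg)
  moreover have "integral disc ?m - integral (cball x \<rho>) ?m \<le> 2 * \<epsilon>\<^sup>2 / \<rho> ^ 4 * pi"
  proof (rule has_integral_le[OF D C])
    fix y :: plane
    show "?m y - (if y \<in> cball x \<rho> then ?m y else 0) \<le> 2 * \<epsilon>\<^sup>2 / \<rho> ^ 4"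
    proof (cases "y \<in> cball x \<rho>")
      case False
      then have "\<rho> \<le> norm (- x + y)"
        by (simp add: dist_norm norm_minus_commute)
      then have "\<rho>\<^sup>2 \<le> (norm (- x + y))\<^sup>2"
        using \<rho> by (intro power_mono) auto
      then have "\<rho>\<^sup>2 \<le> (- x + y) \<bullet> (- x + y) + \<epsilon>\<^sup>2"
        by (simp only: power2_norm_eq_inner) (simp add: add_increasing2)
      then have "(\<rho>\<^sup>2)\<^sup>2 \<le> ((- x + y) \<bullet> (- x + y) + \<epsilon>\<^sup>2)\<^sup>2"
        by (intro power_mono) auto
      moreover have "(\<rho>\<^sup>2)\<^sup>2 = \<rho> ^ 4"
        by simp
      ultimately have "?m y \<le> 2 * \<epsilon>\<^sup>2 / \<rho> ^ 4"
        unfolding mollifier_def using \<rho> by (intro divide_left_mono) (auto intro!: mult_pos_pos)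
      then show ?thesis
        using False by simp
    qed simp
  qed
  ultimately show ?thesis
    unfolding shift mollifier_minus_commute[of \<epsilon> x] by (simp add: mult_ac)
qed

section \<open>The double integral of the regularised angular speed of a Hamiltonian field\<close>

context hamiltonian
begin

text \<open>The angular speed of x - y under the field, with \<epsilon>^2 added to the denominator;
  for positive \<epsilon> it is continuous across the diagonal.\<close>

definition spin :: "real \<Rightarrow> real \<Rightarrow> plane \<Rightarrow> plane \<Rightarrow> real" where
  "spin \<epsilon> t x y = (J (x - y) \<bullet> (X t x - X t y)) / ((x - y) \<bullet> (x - y) + \<epsilon>\<^sup>2)"

lemma denominator_pos: "0 < \<epsilon> \<Longrightarrow> 0 < (z::plane) \<bullet> z + \<epsilon>\<^sup>2"
  by (simp add: add_nonneg_pos)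

text \<open>The Lipschitz property makes the numerator at most 2 L |x - y|^2. The bound is uniform
  in \<epsilon> and serves as the dominating constant.\<close>

lemma spin_bound:
  assumes t: "t \<in> {0..1}" "x \<in> disc" "y \<in> disc"
  shows "\<bar>spin \<epsilon> t x y\<bar> \<le> 2 * L"
proof -
  have "\<bar>J (x - y) \<bullet> (X t x - X t y)\<bar> \<le> norm (x - y) * norm (X t x - X t y)"
    using Cauchy_Schwarz_ineq2[of "J (x - y)" "X t x - X t y"] by simp
  also have "\<dots> \<le> norm (x - y) * (2 * L * norm (x - y))"
    using X_lipschitz[of t t x y] t by (intro mult_left_mono) auto
  also have "\<dots> = 2 * L * ((x - y) \<bullet> (x - y))"
    by (simp add: power2_eq_square mult_ac flip: power2_norm_eq_inner)
  also have "\<dots> \<le> 2 * L * ((x - y) \<bullet> (x - y) + \<epsilon>\<^sup>2)"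
    using L by (intro mult_left_mono) auto
  finally have le: "\<bar>J (x - y) \<bullet> (X t x - X t y)\<bar> \<le> 2 * L * ((x - y) \<bullet> (x - y) + \<epsilon>\<^sup>2)" .
  have nn: "0 \<le> (x - y) \<bullet> (x - y) + \<epsilon>\<^sup>2"
    by simp
  show ?thesis
  proof (cases "(x - y) \<bullet> (x - y) + \<epsilon>\<^sup>2 = 0")
    case True
    then show ?thesis
      using L by (simp add: spin_def)
  next
    case False
    then have "0 < (x - y) \<bullet> (x - y) + \<epsilon>\<^sup>2"
      using nn by linarith
    then show ?thesis
      using le by (simp add: spin_def divide_le_eq)
  qed
qed

lemma continuous_on_spin:
  assumes "0 < \<epsilon>" "continuous_on S p" "continuous_on S f" "continuous_on S g"
    and "p ` S \<subseteq> {0..1}" "f ` S \<subseteq> disc" "g ` S \<subseteq> disc"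
  shows "continuous_on S (\<lambda>z. spin \<epsilon> (p z) (f z) (g z))"
proof -
  have "(f z - g z) \<bullet> (f z - g z) + \<epsilon>\<^sup>2 \<noteq> 0" for z
    using denominator_pos[OF assms(1), of "f z - g z"] by simp
  then show ?thesis
    unfolding spin_def
    by (intro continuous_intros bounded_linear.continuous_on[OF bounded_linear_J] continuous_on_X assms) auto
qed

text \<open>J z \<bullet> X is minus the derivative of h in the direction z = x - y. It is therefore
  h times the divergence of the kernel, minus the divergence of h times the kernel, after division
  by |z|^2 + \<epsilon>^2; the last divergence integrates to 0 because h vanishes near the
  circle.\<close>

lemma half_spin_integral:
  assumes t: "t \<in> {0..1}" and \<epsilon>: "0 < \<epsilon>"
  shows "integral disc (\<lambda>x. (J (x - y) \<bullet> X t x) / ((x - y) \<bullet> (x - y) + \<epsilon>\<^sup>2)) =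
    integral disc (\<lambda>x. h t x * mollifier \<epsilon> (x - y))"
proof -
  let ?q = "\<lambda>x. (x - y) \<bullet> (x - y) + \<epsilon>\<^sup>2"
  have q: "0 < ?q x" for x
    by (rule denominator_pos[OF \<epsilon>])
  then have q0: "?q x \<noteq> 0" for x
    by (metis less_irrefl)
  \<comment> \<open>The component in direction e of h times the regularised kernel;
    \<open>u'\<close> is its differential.\<close>
  define u where "u e x = h t x * (((x - y) \<bullet> e) / ?q x)" for e x
  define u' where "u' e x v = (v $ 1 * G1 t x + v $ 2 * G2 t x) * (((x - y) \<bullet> e) / ?q x) +
      h t x * ((v \<bullet> e) / ?q x - ((x - y) \<bullet> e) * (2 * ((x - y) \<bullet> v)) / (?q x)\<^sup>2)" for e x v
  have D: "(u e has_derivative u' e x) (at x)" for e x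
  proof -
    have n: "((\<lambda>x. (x - y) \<bullet> e) has_derivative (\<lambda>v. v \<bullet> e)) (at x)"
      by (auto intro!: derivative_eq_intros)
    have d: "(?q has_derivative (\<lambda>v. 2 * ((x - y) \<bullet> v))) (at x)"
      by (auto intro!: derivative_eq_intros simp: inner_commute)
    have "((\<lambda>x. ((x - y) \<bullet> e) / ?q x) has_derivative
        (\<lambda>v. (v \<bullet> e) / ?q x - ((x - y) \<bullet> e) * (2 * ((x - y) \<bullet> v)) / (?q x)\<^sup>2)) (at x)"
    proof (rule has_derivative_eq_rhs[OF has_derivative_divide'[OF n d q0]], rule ext)
      have "(a * Q - b * c) / (Q * Q) = a / Q - b * c / Q\<^sup>2" if "Q \<noteq> 0" for a b c Q :: real
        using that by (simp add: diff_divide_distrib power2_eq_square)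
      from this[OF q0] show "((v \<bullet> e) * ?q x - ((x - y) \<bullet> e) * (2 * ((x - y) \<bullet> v))) / (?q x * ?q x) =
          (v \<bullet> e) / ?q x - ((x - y) \<bullet> e) * (2 * ((x - y) \<bullet> v)) / (?q x)\<^sup>2" for v .
    qed
    from has_derivative_mult[OF h_deriv[OF t, of x] this] show ?thesis
      unfolding u_def[abs_def] u'_def[abs_def] by (simp add: add.commute)
  qed
  have contG: "continuous_on UNIV (G1 t)" "continuous_on UNIV (G2 t)" "continuous_on UNIV (h t)"
    using has_derivative_continuous[OF G1_deriv[OF t]] has_derivative_continuous[OF G2_deriv[OF t]]
      has_derivative_continuous[OF h_deriv[OF t]] by (simp_all add: continuous_on_eq_continuous_at)
  have cont: "continuous_on UNIV (\<lambda>x. u' e x v)" for e v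
    unfolding u'_def by (intro continuous_intros contG) (use q0 in auto)
  have zero_u: "u e x = 0" if "r < norm x" for e x
    using zero[OF t, of x] that by (simp add: u_def)
  have I: "integral disc (\<lambda>x. u' e x v) = 0" for e v
    using r by (intro integral_derivative_eq_0[OF D cont zero_u]) auto
  have eq: "(J (x - y) \<bullet> X t x) / ?q x = h t x * mollifier \<epsilon> (x - y) - (u' (axis 1 1) x (axis 1 1) + u' (axis 2 1) x (axis 2 1))" for x
  proof -
    define z where "z = x - y"
    define Q where "Q = z \<bullet> z + \<epsilon>\<^sup>2"
    have Q: "0 < Q"
      unfolding Q_def by (rule denominator_pos[OF \<epsilon>])
    have ax: "(axis 1 1 :: plane) $ 1 = 1" "(axis 1 1 :: plane) $ 2 = 0"
      "(axis 2 1 :: plane) $ 1 = 0" "(axis 2 1 :: plane) $ 2 = 1"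
      by (simp_all add: axis_def)
    have "u' (axis 1 1) x (axis 1 1) + u' (axis 2 1) x (axis 2 1) =
        (z $ 1 * G1 t x + z $ 2 * G2 t x) / Q + h t x * (2 / Q - 2 * (z $ 1 * z $ 1 + z $ 2 * z $ 2) / Q\<^sup>2)"
      unfolding u'_def z_def[symmetric] Q_def[symmetric]
      by (simp add: inner_plane ax add_divide_distrib algebra_simps power2_eq_square)
    moreover have "2 / Q - 2 * (z $ 1 * z $ 1 + z $ 2 * z $ 2) / Q\<^sup>2 = mollifier \<epsilon> z"
    proof -
      have "z $ 1 * z $ 1 + z $ 2 * z $ 2 = Q - \<epsilon>\<^sup>2"
        by (simp add: Q_def inner_plane)
      then have "2 / Q - 2 * (z $ 1 * z $ 1 + z $ 2 * z $ 2) / Q\<^sup>2 = 2 / Q - 2 * (Q - \<epsilon>\<^sup>2) / Q\<^sup>2"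
        by simp
      also have "\<dots> = 2 * \<epsilon>\<^sup>2 / Q\<^sup>2"
        using Q by (simp add: field_simps power2_eq_square)
      finally show ?thesis
        by (simp add: mollifier_def Q_def)
    qed
    moreover have "J z \<bullet> X t x = - (z $ 1 * G1 t x + z $ 2 * G2 t x)"
      by (simp add: inner_plane)
    ultimately show ?thesis
      unfolding z_def[symmetric] Q_def[symmetric] by (simp add: minus_divide_left)
  qed
  have cm: "continuous_on UNIV (\<lambda>x. h t x * mollifier \<epsilon> (x - y))"
    by (intro continuous_intros continuous_on_mollifier contG \<epsilon>)
  have "(\<lambda>x. h t x * mollifier \<epsilon> (x - y)) integrable_on disc" "(\<lambda>x. u' e x v) integrable_on disc" for e v
    using cm cont continuous_on_subset by (blast intro: integrable_continuous_compact(1) compact_cball)+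
  then show ?thesis
    unfolding eq by (simp add: Henstock_Kurzweil_Integration.integral_diff Henstock_Kurzweil_Integration.integral_add
        integrable_add I)
qed

text \<open>As J is odd, \<open>spin\<close> splits into k x y + k y x with k containing the field
  at its first point only. Fubini makes the two parts equal, hence the factor 2.\<close>

lemma spin_integral:
  assumes t: "t \<in> {0..1}" and \<epsilon>: "0 < \<epsilon>"
  shows "integral disc (\<lambda>x. integral disc (\<lambda>y. spin \<epsilon> t x y)) =
    2 * integral disc (\<lambda>x. h t x * integral disc (\<lambda>y. mollifier \<epsilon> (x - y)))"
proof -
  define k where "k x y = (J (x - y) \<bullet> X t x) / ((x - y) \<bullet> (x - y) + \<epsilon>\<^sup>2)" for x y
  have spin_eq: "spin \<epsilon> t x y = k x y + k y x" for x y
  proof -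
    have "J (x - y) \<bullet> (X t x - X t y) = J (x - y) \<bullet> X t x + J (y - x) \<bullet> X t y"
      by (simp add: inner_plane algebra_simps)
    moreover have "(y - x) \<bullet> (y - x) = (x - y) \<bullet> (x - y)"
      by (simp add: inner_plane algebra_simps)
    ultimately show ?thesis
      by (simp add: spin_def k_def add_divide_distrib)
  qed
  have q0: "z \<bullet> z + \<epsilon>\<^sup>2 \<noteq> 0" for z :: plane
    using denominator_pos[OF \<epsilon>, of z] by simp
  have ck: "continuous_on S (\<lambda>z. k (f z) (g z))" if "continuous_on S f" "continuous_on S g" "f ` S \<subseteq> disc" for S f g
    unfolding k_def using that t q0
    by (intro continuous_intros bounded_linear.continuous_on[OF bounded_linear_J] continuous_on_X) auto
  have k2: "continuous_on (disc \<times> disc) (\<lambda>(x, y). k x y)" "continuous_on (disc \<times> disc) (\<lambda>(x, y). k y x)"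
    unfolding case_prod_beta by (intro ck continuous_intros; auto)+
  have int: "k x integrable_on disc" "(\<lambda>y. k y x) integrable_on disc" if "x \<in> disc" for x
    using that by (intro integrable_continuous_compact(1) ck continuous_intros; auto)+
  have int2: "(\<lambda>x. integral disc (k x)) integrable_on disc" "(\<lambda>x. integral disc (\<lambda>y. k y x)) integrable_on disc"
    by (intro integrable_continuous_compact(1) continuous_on_integral_compact k2 compact_cball)+
  have chm: "continuous_on (disc \<times> disc) (\<lambda>(y, x). h t x * mollifier \<epsilon> (x - y))"
  proof -
    have "continuous_on UNIV (h t)"
      using has_derivative_continuous[OF h_deriv[OF t]] by (simp add: continuous_on_eq_continuous_at)
    then have "continuous_on (disc \<times> disc) (\<lambda>z. h t (snd z))"
      by (rule continuous_on_compose2) (auto intro!: continuous_intros)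
    then show ?thesis
      unfolding case_prod_beta by (intro continuous_intros continuous_on_mollifier \<epsilon>)
  qed
  have "integral disc (\<lambda>x. integral disc (\<lambda>y. spin \<epsilon> t x y)) =
      integral disc (\<lambda>x. integral disc (k x) + integral disc (\<lambda>y. k y x))"
    unfolding spin_eq
    by (intro Henstock_Kurzweil_Integration.integral_cong Henstock_Kurzweil_Integration.integral_add int)
  also have "\<dots> = integral disc (\<lambda>x. integral disc (k x)) + integral disc (\<lambda>x. integral disc (\<lambda>y. k y x))"
    by (rule Henstock_Kurzweil_Integration.integral_add[OF int2])
  also have "integral disc (\<lambda>x. integral disc (k x)) = integral disc (\<lambda>x. integral disc (\<lambda>y. k y x))"
    by (rule iterated_integral(2)[OF compact_cball compact_cball k2(1)])
  also have "integral disc (\<lambda>x. integral disc (\<lambda>y. k y x)) =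
      integral disc (\<lambda>y. integral disc (\<lambda>x. h t x * mollifier \<epsilon> (x - y)))"
    unfolding k_def by (simp only: half_spin_integral[OF t \<epsilon>])
  also have "\<dots> = integral disc (\<lambda>x. integral disc (\<lambda>y. h t x * mollifier \<epsilon> (x - y)))"
    by (rule iterated_integral(2)[OF compact_cball compact_cball chm])
  finally show ?thesis
    by simp
qed

end

lemma abs_integral_disc_le:
  fixes f :: "plane \<Rightarrow> real"
  assumes "continuous_on disc f" "\<And>x. x \<in> disc \<Longrightarrow> \<bar>f x\<bar> \<le> c"
  shows "\<bar>integral disc f\<bar> \<le> pi * c"
proof -
  have "norm (integral disc f) \<le> integral disc (\<lambda>x::plane. c)"
    using assms by (intro integral_norm_bound_integral integrable_continuous_compact(1)) auto
  also have "\<dots> = pi * c"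
    using lmeasure_integral[OF lmeasurable_cball, of "0::plane" 1] measure_disc
      integral_mult_right[of disc c "\<lambda>x. 1"] by simp
  finally show ?thesis
    by simp
qed

lemma angular_speed_minus: "angular_speed (- z) (- w) = angular_speed z w"
  by (simp add: angular_speed_def inner_plane)

lemma (in motion) winding_commute: "winding x y = winding y x"
  unfolding winding_def using angular_speed_minus[of "g _ y - g _ x" "g' _ y - g' _ x"] by simp

lemma (in motion) winding_boundary_boundary:
  assumes "norm x = 1" "norm y = 1"
  shows "winding x y = 0"
proof -
  have g': "g' t z = 0" if z: "norm z = 1" and t: "t \<in> {0..1}" for t z
  proof -
    have zd: "z \<in> disc"
      using z by simp
    have "((\<lambda>s. g s z) has_vector_derivative 0) (at t within {0..1})"
      by (rule has_vector_derivative_transform[OF t _ has_vector_derivative_const]) (use z boundary in auto)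
    then have D2: "((\<lambda>s. g s z) has_vector_derivative 0) (at t within cbox 0 1)"
      by (simp only: box_real)
    have D1: "((\<lambda>s. g s z) has_vector_derivative g' t z) (at t within cbox 0 1)"
      using deriv[OF t zd] by (simp only: box_real)
    show ?thesis
      by (rule vector_derivative_unique_within_closed_interval[OF _ _ D1 D2]) (use t in auto)
  qed
  have "integral {0..1} (\<lambda>t. angular_speed (g t x - g t y) (g' t x - g' t y)) = integral {0..1} (\<lambda>t::real. 0)"
    by (rule Henstock_Kurzweil_Integration.integral_cong) (use g' assms in \<open>auto simp: angular_speed_def\<close>)
  then show ?thesis
    by (simp add: winding_def)
qed

text \<open>An interior first point is covered by \<open>winding_unique\<close>, an interior second
  point by symmetry of the winding, and for two boundary points nothing moves.\<close>

lemma winding_unique_disc: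
  assumes m: "motion g g'" "motion k k'" and e: "\<And>x. x \<in> disc \<Longrightarrow> g 1 x = k 1 x"
    and x: "x \<in> disc" and y: "y \<in> disc"
  shows "motion.winding g g' x y = motion.winding k k' x y"
proof -
  interpret g: motion g g' by fact
  interpret k: motion k k' by fact
  consider "x = y" | "x \<noteq> y" "norm x < 1" | "x \<noteq> y" "norm y < 1" | "norm x = 1" "norm y = 1"
    using x y by fastforce
  then show ?thesis
  proof cases
    case 2
    then show ?thesis
      using winding_unique[OF m e] y by blast
  next
    case 3
    then show ?thesis
      using winding_unique[OF m e, of y x] x g.winding_commute k.winding_commute by metis
  qed (simp_all add: g.winding_boundary_boundary k.winding_boundary_boundary)
qed

section \<open>The integral of the winding in terms of the Hamiltonian\<close>

context hamiltonian_motion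
begin

definition total :: real where
  "total = integral {0..1} (\<lambda>t. integral disc (h t))"

text \<open>The radius 1 - r is what \<open>mollified_disc\<close> allows at points with |x| \<le>
  r, where h may be nonzero. The value depends on r and \<epsilon> only.\<close>

abbreviation (input) mass :: "real \<Rightarrow> real" where
  "mass \<epsilon> \<equiv> integral (cball 0 (1 - r)) (mollifier \<epsilon>)"

lemma continuous_on_h:
  assumes "continuous_on S p" "continuous_on S q" "p ` S \<subseteq> {0..1}" "q ` S \<subseteq> disc"
  shows "continuous_on S (\<lambda>x. h (p x) (q x))"
proof -
  have "continuous_on S (\<lambda>x. case (p x, q x) of (t, x) \<Rightarrow> h t x)"
    by (rule continuous_on_compose2[OF cont_h continuous_on_Pair[OF assms(1,2)]]) (use assms(3,4) in auto)
  then show ?thesis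
    by simp
qed

lemma continuous_on_mollified:
  assumes "0 < \<epsilon>"
  shows "continuous_on disc (\<lambda>x. integral disc (\<lambda>y. mollifier \<epsilon> (x - y)))"
  by (rule continuous_on_integral_compact)
    (auto simp: case_prod_beta intro!: continuous_on_mollifier assms continuous_intros)

lemma continuous_on_weighted:
  assumes "0 < \<epsilon>"
  shows "continuous_on {0..1} (\<lambda>t. 2 * integral disc (\<lambda>x. h t x * integral disc (\<lambda>y. mollifier \<epsilon> (x - y))))"
proof -
  have "continuous_on ({0..1} \<times> disc) (\<lambda>z. integral disc (\<lambda>y. mollifier \<epsilon> (snd z - y)))"
    by (rule continuous_on_compose2[OF continuous_on_mollified[OF assms] continuous_on_snd]) (auto intro: continuous_on_id)
  then have "continuous_on ({0..1} \<times> disc) (\<lambda>(t, x). h t x * integral disc (\<lambda>y. mollifier \<epsilon> (x - y)))"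
    unfolding case_prod_beta by (intro continuous_on_mult continuous_on_h continuous_on_fst continuous_on_snd continuous_on_id) auto
  then show ?thesis
    by (intro continuous_on_mult_left continuous_on_integral_compact) auto
qed

text \<open>The flow preserves integrals, so \<phi> t can be removed from y and then from x.\<close>

lemma spin_flow_integral:
  assumes t: "t \<in> {0..1}" and \<epsilon>: "0 < \<epsilon>"
  shows "integral\<^sup>L (lborel_on disc \<Otimes>\<^sub>M lborel_on disc) (\<lambda>(x, y). spin \<epsilon> t (\<phi> t x) (\<phi> t y)) =
    2 * integral disc (\<lambda>x. h t x * integral disc (\<lambda>y. mollifier \<epsilon> (x - y)))"
proof -
  have c\<phi>: "continuous_on disc (\<phi> t)"
    using t by (intro continuous_on_g continuous_on_const continuous_on_id) auto
  have c1: "continuous_on (disc \<times> disc) (\<lambda>(x, y). spin \<epsilon> t (\<phi> t x) (\<phi> t y))"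
    unfolding case_prod_beta using t stays \<epsilon>
    by (intro continuous_on_spin continuous_on_g continuous_on_const continuous_on_fst continuous_on_snd continuous_on_id) auto
  have c2: "continuous_on disc (\<lambda>y. spin \<epsilon> t x y)" if "x \<in> disc" for x
    using t \<epsilon> that by (intro continuous_on_spin continuous_on_const continuous_on_id) auto
  have c3: "continuous_on disc (\<lambda>x. integral disc (\<lambda>y. spin \<epsilon> t x y))"
    using t \<epsilon> unfolding case_prod_beta
    by (intro continuous_on_integral_compact compact_cball, unfold case_prod_beta)
      (intro continuous_on_spin continuous_on_const continuous_on_fst continuous_on_snd continuous_on_id; auto)
  have "integral\<^sup>L (lborel_on disc \<Otimes>\<^sub>M lborel_on disc) (\<lambda>(x, y). spin \<epsilon> t (\<phi> t x) (\<phi> t y)) =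
      integral disc (\<lambda>x. integral disc (\<lambda>y. spin \<epsilon> t (\<phi> t x) (\<phi> t y)))"
    by (rule iterated_integral(1)[OF compact_cball compact_cball c1])
  also have "\<dots> = integral disc (\<lambda>x. integral disc (\<lambda>y. spin \<epsilon> t (\<phi> t x) y))"
    by (intro Henstock_Kurzweil_Integration.integral_cong flow_preserves_integral t c2 stays)
  also have "\<dots> = integral disc (\<lambda>x. integral disc (\<lambda>y. spin \<epsilon> t x y))"
    by (rule flow_preserves_integral[OF t c3])
  also have "\<dots> = 2 * integral disc (\<lambda>x. h t x * integral disc (\<lambda>y. mollifier \<epsilon> (x - y)))"
    by (rule spin_integral[OF t \<epsilon>])
  finally show ?thesis .
qed

text \<open>Where h is nonzero, |x| < r, and the mollified disc differs from \<open>mass\<close> by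
  a multiple of \<epsilon>^2, uniformly in x and t.\<close>

lemma weighted_estimate:
  "\<exists>K. \<forall>\<epsilon>>0. \<bar>integral {0..1} (\<lambda>t. 2 * integral disc (\<lambda>x. h t x * integral disc (\<lambda>y. mollifier \<epsilon> (x - y)))) -
     2 * mass \<epsilon> * total\<bar> \<le> K * \<epsilon>\<^sup>2"
proof -
  have "compact ({0..1::real} \<times> disc)"
    by (intro compact_Times) auto
  from compact_imp_bounded[OF compact_continuous_image[OF cont_h this]]
  obtain H where H: "\<And>z. z \<in> {0..1} \<times> disc \<Longrightarrow> norm (case z of (t, x) \<Rightarrow> h t x) \<le> H"
    unfolding bounded_iff by blast
  then have H: "\<bar>h t x\<bar> \<le> H" if "t \<in> {0..1}" "x \<in> disc" for t x
    using H[of "(t, x)"] that by simp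
  have "0 \<le> H"
    using H[of 0 0] by (auto intro: order_trans[OF abs_ge_zero])
  define \<rho> where "\<rho> = 1 - r"
  have \<rho>: "0 < \<rho>"
    using r by (simp add: \<rho>_def)
  \<comment> \<open>The factors are the 2 of the weighted integral, the area pi of the disc, the
    bound H of |h| and the constant of \<open>mollified_disc\<close>.\<close>
  define K where "K = 2 * (pi * (H * (2 * pi / \<rho> ^ 4)))"
  show ?thesis
  proof (intro exI[of _ K] allI impI)
    fix \<epsilon> :: real assume \<epsilon>: "0 < \<epsilon>"
    define D where "D x = integral disc (\<lambda>y. mollifier \<epsilon> (x - y))" for x
    have cD: "continuous_on disc D"
      unfolding D_def[abs_def] by (rule continuous_on_mollified[OF \<epsilon>])
    have ch: "continuous_on disc (h t)" if "t \<in> {0..1}" for t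
      using that by (intro continuous_on_h continuous_on_const continuous_on_id) auto
    have est: "\<bar>2 * integral disc (\<lambda>x. h t x * D x) - 2 * mass \<epsilon> * integral disc (h t)\<bar> \<le> K * \<epsilon>\<^sup>2" if t: "t \<in> {0..1}" for t
    proof -
      have "integral disc (\<lambda>x. h t x * D x) - mass \<epsilon> * integral disc (h t) = integral disc (\<lambda>x. h t x * D x - mass \<epsilon> * h t x)"
        by (subst Henstock_Kurzweil_Integration.integral_diff)
          (auto intro!: integrable_continuous_compact(1) continuous_on_mult_left continuous_on_mult ch[OF t] cD)
      also have "\<bar>\<dots>\<bar> \<le> pi * (H * (2 * pi * \<epsilon>\<^sup>2 / \<rho> ^ 4))"
      proof (rule abs_integral_disc_le)
        show "continuous_on disc (\<lambda>x. h t x * D x - mass \<epsilon> * h t x)"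
          by (intro continuous_on_diff continuous_on_mult_left continuous_on_mult ch[OF t] cD)
        fix x assume x: "x \<in> disc"
        show "\<bar>h t x * D x - mass \<epsilon> * h t x\<bar> \<le> H * (2 * pi * \<epsilon>\<^sup>2 / \<rho> ^ 4)"
        proof (cases "r \<le> norm x")
          case True
          then show ?thesis
            using zero[OF t] \<open>0 \<le> H\<close> \<rho> by simp
        next
          case False
          then have "\<bar>D x - mass \<epsilon>\<bar> \<le> 2 * pi * \<epsilon>\<^sup>2 / \<rho> ^ 4"
            unfolding D_def \<rho>_def[symmetric] by (intro mollified_disc \<epsilon> \<rho>) (simp add: \<rho>_def)
          then have "\<bar>h t x\<bar> * \<bar>D x - mass \<epsilon>\<bar> \<le> H * (2 * pi * \<epsilon>\<^sup>2 / \<rho> ^ 4)"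
            using H[OF t x] \<open>0 \<le> H\<close> by (intro mult_mono) auto
          moreover have "h t x * D x - mass \<epsilon> * h t x = h t x * (D x - mass \<epsilon>)"
            by (simp add: algebra_simps)
          ultimately show ?thesis
            by (simp add: abs_mult)
        qed
      qed
      finally have "\<bar>integral disc (\<lambda>x. h t x * D x) - mass \<epsilon> * integral disc (h t)\<bar> \<le> pi * (H * (2 * pi * \<epsilon>\<^sup>2 / \<rho> ^ 4))" .
      moreover have "2 * integral disc (\<lambda>x. h t x * D x) - 2 * mass \<epsilon> * integral disc (h t) =
          2 * (integral disc (\<lambda>x. h t x * D x) - mass \<epsilon> * integral disc (h t))"
        by (simp only: right_diff_distrib mult.assoc)
      moreover have "K * \<epsilon>\<^sup>2 = 2 * (pi * (H * (2 * pi * \<epsilon>\<^sup>2 / \<rho> ^ 4)))"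
        by (simp add: K_def)
      ultimately show ?thesis
        by linarith
    qed
    let ?f = "\<lambda>t. 2 * integral disc (\<lambda>x. h t x * D x)" and ?g = "\<lambda>t. integral disc (h t)"
    have cf: "continuous_on {0..1} ?f"
      unfolding D_def using \<epsilon> by (rule continuous_on_weighted)
    have cg: "continuous_on {0..1} ?g"
      by (intro continuous_on_integral_compact cont_h) auto
    have "integral {0..1} ?f - 2 * mass \<epsilon> * total = integral {0..1} (\<lambda>t. ?f t - 2 * mass \<epsilon> * ?g t)"
      unfolding total_def
      using Henstock_Kurzweil_Integration.integral_diff[OF integrable_continuous_real[OF cf]
          integrable_continuous_real[OF continuous_on_mult_left[OF cg]], of "2 * mass \<epsilon>"] by simp
    also have "norm \<dots> \<le> integral {0..1} (\<lambda>t::real. K * \<epsilon>\<^sup>2)"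
      using est by (intro integral_norm_bound_integral integrable_continuous_real continuous_on_diff
          continuous_on_mult_left cf cg continuous_on_const) auto
    also have "\<dots> = K * \<epsilon>\<^sup>2"
      by simp
    finally show "\<bar>integral {0..1} (\<lambda>t. 2 * integral disc (\<lambda>x. h t x * integral disc (\<lambda>y. mollifier \<epsilon> (x - y)))) -
        2 * mass \<epsilon> * total\<bar> \<le> K * \<epsilon>\<^sup>2"
      by (simp add: D_def)
  qed
qed

text \<open>Fathi's formula. The regularised angular speed is integrated over time and pairs of
  points: integration over the pairs at fixed time gives 2 * \<open>mass\<close> *
  \<open>total\<close> up to O(\<epsilon>^2), and as \<epsilon> tends to 0 the integrand converges
  to the true angular speed, whose time integral is the winding.\<close>

lemma total_tendsto_winding:
  "(\<lambda>n. 2 * mass (inverse (Suc n)) * total) \<longlonglongrightarrow>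
     integral\<^sup>L (lborel_on disc \<Otimes>\<^sub>M lborel_on disc) (\<lambda>(x, y). winding x y)"
proof -
  define M :: "plane measure" where "M = lborel_on disc"
  define T :: "real measure" where "T = lborel_on {0..1}"
  have spM: "space M = disc" and spT: "space T = {0..1}"
    by (simp_all add: M_def T_def)
  interpret M: finite_measure M
    unfolding M_def by (intro finite_measure_lborel_on compact_cball)
  interpret T: finite_measure T
    unfolding T_def by (intro finite_measure_lborel_on compact_Icc)
  interpret MM: pair_sigma_finite M M ..
  interpret MMf: finite_measure "M \<Otimes>\<^sub>M M"
    by (rule finite_measure_pair_measure) unfold_locales
  interpret TMM: pair_sigma_finite T "M \<Otimes>\<^sub>M M" ..
  interpret TMMf: finite_measure "T \<Otimes>\<^sub>M (M \<Otimes>\<^sub>M M)"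
    by (rule finite_measure_pair_measure) unfold_locales
  have sp: "space (T \<Otimes>\<^sub>M (M \<Otimes>\<^sub>M M)) = {0..1} \<times> disc \<times> disc"
    by (simp add: space_pair_measure spM spT)
  define e where "e n = inverse (real (Suc n))" for n
  have e: "0 < e n" for n
    by (simp add: e_def)
  have e0: "e \<longlonglongrightarrow> 0"
    unfolding e_def by (rule LIMSEQ_inverse_real_of_nat)
  define F where "F n z = (case z of (t, x, y) \<Rightarrow> spin (e n) t (\<phi> t x) (\<phi> t y))" for n z
  define F0 where "F0 z = (case z of (t, x, y) \<Rightarrow> angular_speed (\<phi> t x - \<phi> t y) (X t (\<phi> t x) - X t (\<phi> t y)))" for z
  have Fm: "F n \<in> borel_measurable (T \<Otimes>\<^sub>M (M \<Otimes>\<^sub>M M))" for n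
    unfolding F_def[abs_def] case_prod_beta T_def M_def
    by (intro borel_measurable_time_disc_disc continuous_on_spin e continuous_on_g
        continuous_on_fst continuous_on_snd continuous_on_id)
      (use stays in auto)
  have lim: "(\<lambda>n. F n z) \<longlonglongrightarrow> F0 z" for z
  proof -
    obtain t x y where z: "z = (t, x, y)"
      by (metis prod.exhaust)
    \<comment> \<open>Off the diagonal the denominators converge; for p = 0 both expressions are
      0.\<close>
    define p q where "p = \<phi> t x - \<phi> t y" and "q = X t (\<phi> t x) - X t (\<phi> t y)"
    show ?thesis
    proof (cases "p = 0")
      case True
      moreover have "J 0 = 0"
        by (simp add: plane_eq_iff)
      ultimately show ?thesis
        by (simp add: z F_def F0_def spin_def angular_speed_def flip: p_def q_def)
    next
      case False
      have "(\<lambda>n. (J p \<bullet> q) / (p \<bullet> p + (e n)\<^sup>2)) \<longlonglongrightarrow> (J p \<bullet> q) / (p \<bullet> p + 0\<^sup>2)"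
        using False by (intro tendsto_divide tendsto_add tendsto_const tendsto_power e0) auto
      then show ?thesis
        by (simp add: z F_def F0_def spin_def angular_speed_def flip: p_def q_def)
    qed
  qed
  have F0m: "F0 \<in> borel_measurable (T \<Otimes>\<^sub>M (M \<Otimes>\<^sub>M M))"
    by (rule borel_measurable_LIMSEQ_real[OF lim Fm])
  have bound: "norm (F n z) \<le> 2 * L" if "z \<in> {0..1} \<times> disc \<times> disc" for n z
    using that stays by (auto simp: F_def intro!: spin_bound)
  have AEb: "AE z in T \<Otimes>\<^sub>M (M \<Otimes>\<^sub>M M). norm (F n z) \<le> 2 * L" for n
    by (rule AE_I2) (simp only: sp bound)
  have c: "integrable (T \<Otimes>\<^sub>M (M \<Otimes>\<^sub>M M)) (\<lambda>z. 2 * L)"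
    by simp
  note dom = F0m Fm c AE_I2[OF lim] AEb
  have conv: "(\<lambda>n. integral\<^sup>L (T \<Otimes>\<^sub>M (M \<Otimes>\<^sub>M M)) (F n)) \<longlonglongrightarrow> integral\<^sup>L (T \<Otimes>\<^sub>M (M \<Otimes>\<^sub>M M)) F0"
    by (rule integral_dominated_convergence[OF dom])
  have F0i: "integrable (T \<Otimes>\<^sub>M (M \<Otimes>\<^sub>M M)) F0" and Fi: "integrable (T \<Otimes>\<^sub>M (M \<Otimes>\<^sub>M M)) (F n)" for n
    by (rule integrable_dominated_convergence[OF dom], rule integrable_dominated_convergence2[OF dom])
  have F0_eq: "integral\<^sup>L (T \<Otimes>\<^sub>M (M \<Otimes>\<^sub>M M)) F0 = integral\<^sup>L (M \<Otimes>\<^sub>M M) (\<lambda>(x, y). winding x y)"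
  proof -
    have "integral\<^sup>L (T \<Otimes>\<^sub>M (M \<Otimes>\<^sub>M M)) F0 = (LINT z|(M \<Otimes>\<^sub>M M). LINT t|T. F0 (t, z))"
      using TMM.integral_snd[of "\<lambda>t z. F0 (t, z)"] F0i by simp
    also have "\<dots> = integral\<^sup>L (M \<Otimes>\<^sub>M M) (\<lambda>(x, y). winding x y)"
    proof (rule Bochner_Integration.integral_cong[OF refl])
      fix z assume "z \<in> space (M \<Otimes>\<^sub>M M)"
      then obtain x y where z: "z = (x, y)" "x \<in> disc" "y \<in> disc"
        by (auto simp: space_pair_measure spM)
      show "(LINT t|T. F0 (t, z)) = (case z of (x, y) \<Rightarrow> winding x y)"
      proof (cases "x = y")
        case True
        then show ?thesis
          by (simp add: z F0_def angular_speed_def)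
      next
        case False
        have "continuous_on {0..1} (\<lambda>t. angular_speed (\<phi> t x - \<phi> t y) (X t (\<phi> t x) - X t (\<phi> t y)))"
          using z separated[OF _ z(2,3) False]
          by (intro continuous_on_angular_speed continuous_on_diff continuous_on_g continuous_on_g'
              continuous_on_const continuous_on_id) auto
        then show ?thesis
          by (simp add: z F0_def winding_def T_def integrable_continuous_compact(3)[OF compact_Icc])
      qed
    qed
    finally show ?thesis .
  qed
  have F_eq: "integral\<^sup>L (T \<Otimes>\<^sub>M (M \<Otimes>\<^sub>M M)) (F n) =
      integral {0..1} (\<lambda>t. 2 * integral disc (\<lambda>x. h t x * integral disc (\<lambda>y. mollifier (e n) (x - y))))" for n
  proof -
    have "integral\<^sup>L (T \<Otimes>\<^sub>M (M \<Otimes>\<^sub>M M)) (F n) = (LINT t|T. LINT z|(M \<Otimes>\<^sub>M M). F n (t, z))"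
      by (rule TMM.integral_fst'[OF Fi, symmetric])
    also have "\<dots> = (LINT t|T. 2 * integral disc (\<lambda>x. h t x * integral disc (\<lambda>y. mollifier (e n) (x - y))))"
    proof (rule Bochner_Integration.integral_cong[OF refl])
      fix t assume "t \<in> space T"
      then show "(LINT z|(M \<Otimes>\<^sub>M M). F n (t, z)) = 2 * integral disc (\<lambda>x. h t x * integral disc (\<lambda>y. mollifier (e n) (x - y)))"
        using spin_flow_integral[of t "e n"] e by (simp add: F_def M_def spT)
    qed
    also have "\<dots> = integral {0..1} (\<lambda>t. 2 * integral disc (\<lambda>x. h t x * integral disc (\<lambda>y. mollifier (e n) (x - y))))"
      unfolding T_def by (rule integrable_continuous_compact(3)[OF compact_Icc continuous_on_weighted[OF e]])
    finally show ?thesis .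
  qed
  obtain K where K: "\<And>\<epsilon>. 0 < \<epsilon> \<Longrightarrow> \<bar>integral {0..1} (\<lambda>t. 2 * integral disc (\<lambda>x. h t x * integral disc (\<lambda>y. mollifier \<epsilon> (x - y)))) -
     2 * mass \<epsilon> * total\<bar> \<le> K * \<epsilon>\<^sup>2"
    using weighted_estimate by blast
  have "(\<lambda>n. integral\<^sup>L (T \<Otimes>\<^sub>M (M \<Otimes>\<^sub>M M)) (F n) - 2 * mass (e n) * total) \<longlonglongrightarrow> 0"
  proof (rule Lim_null_comparison)
    show "\<forall>\<^sub>F n in sequentially. norm (integral\<^sup>L (T \<Otimes>\<^sub>M (M \<Otimes>\<^sub>M M)) (F n) - 2 * mass (e n) * total) \<le> K * (e n)\<^sup>2"
      using K[OF e] by (intro always_eventually allI) (simp only: F_eq real_norm_def)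
    show "(\<lambda>n. K * (e n)\<^sup>2) \<longlonglongrightarrow> 0"
      using tendsto_mult_left[OF tendsto_power[OF e0, of 2], of K] by simp
  qed
  from tendsto_diff[OF conv this] show ?thesis
    unfolding F0_eq by (simp add: M_def e_def)
qed

end

text \<open>Equal end maps have equal windings, so the two sequences of
  \<open>total_tendsto_winding\<close> have the same limit. The common r gives them the same mass
  factor, at least pi/2 eventually, and so the totals agree.\<close>

lemma total_hamiltonian_unique:
  assumes 1: "hamiltonian_motion h G1 G2 A B r L \<phi>" and 2: "hamiltonian_motion h' G1' G2' A' B' r L' \<phi>'"
    and e: "\<And>x. x \<in> disc \<Longrightarrow> \<phi> 1 x = \<phi>' 1 x"
  shows "integral {0..1} (\<lambda>t. integral disc (h t)) = integral {0..1} (\<lambda>t. integral disc (h' t))"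
proof -
  interpret H1: hamiltonian_motion h G1 G2 A B r L \<phi> by fact
  interpret H2: hamiltonian_motion h' G1' G2' A' B' r L' \<phi>' by fact
  let ?m = "\<lambda>n. integral (cball 0 (1 - r)) (mollifier (inverse (real (Suc n))))"
  have "integral\<^sup>L (lborel_on disc \<Otimes>\<^sub>M lborel_on disc) (\<lambda>(x, y). H1.winding x y) =
    integral\<^sup>L (lborel_on disc \<Otimes>\<^sub>M lborel_on disc) (\<lambda>(x, y). H2.winding x y)"
    by (rule Bochner_Integration.integral_cong[OF refl])
      (use winding_unique_disc[OF H1.motion_axioms H2.motion_axioms e] in \<open>auto simp: space_pair_measure\<close>)
  then have "(\<lambda>n. 2 * ?m n * H1.total - 2 * ?m n * H2.total) \<longlonglongrightarrow> 0"
    using tendsto_diff[OF H1.total_tendsto_winding H2.total_tendsto_winding] by simp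
  then have lim: "(\<lambda>n. \<bar>2 * ?m n * (H1.total - H2.total)\<bar>) \<longlonglongrightarrow> 0"
    by (simp add: tendsto_rabs_zero algebra_simps)
  have "\<forall>\<^sub>F n in sequentially. inverse (real (Suc n)) < 1 - r"
    using order_tendstoD(2)[OF LIMSEQ_inverse_real_of_nat, of "1 - r"] H1.r by simp
  then have ev: "\<forall>\<^sub>F n in sequentially. pi * \<bar>H1.total - H2.total\<bar> \<le> \<bar>2 * ?m n * (H1.total - H2.total)\<bar>"
  proof eventually_elim
    case (elim n)
    then have "pi / 2 \<le> ?m n"
      by (intro mollifier_mass_lower_bound) auto
    then have "pi * \<bar>H1.total - H2.total\<bar> \<le> \<bar>2 * ?m n\<bar> * \<bar>H1.total - H2.total\<bar>"
      by (intro mult_right_mono) auto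
    then show ?case
      by (simp only: abs_mult)
  qed
  have "pi * \<bar>H1.total - H2.total\<bar> \<le> 0"
    by (rule tendsto_lowerbound[OF lim ev]) simp
  then have "\<bar>H1.total - H2.total\<bar> \<le> 0"
    using mult_le_cancel_left_pos[OF pi_gt_zero, of "\<bar>H1.total - H2.total\<bar>" 0] by simp
  then show ?thesis
    unfolding H1.total_def H2.total_def by simp
qed

section \<open>Well-definedness of the Calabi value\<close>

lemma hamiltonian_exists:
  assumes "hamiltonian_on_disc H"
  shows "\<exists>r0<1. \<forall>r. r0 \<le> r \<longrightarrow> r < 1 \<longrightarrow> (\<exists>h G1 G2 A B L. hamiltonian h G1 G2 A B r L \<and>
    (\<forall>t\<in>{0..1}. \<forall>x\<in>disc. h t x = H t x \<and> hamiltonian_field (H t) x = vector [G2 t x, - G1 t x]))"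
proof -
  obtain q where q: "q < 1" and Hz: "\<And>t x. t \<in> {0..1} \<Longrightarrow> x \<in> disc \<Longrightarrow> q \<le> norm x \<Longrightarrow> H t x = 0"
    and Hs: "smooth_family H"
    using assms unfolding hamiltonian_on_disc_def by blast
  \<comment> \<open>Each differentiation costs some radius: h vanishes from q0 on, its first
    derivatives from q1 on, the second ones from q2 on.\<close>
  define q0 where "q0 = max q 0"
  define q1 where "q1 = (q0 + 1) / 2"
  define q2 where "q2 = (q1 + 1) / 2"
  have qs: "q \<le> q0" "0 \<le> q0" "q0 < q1" "q1 < 1" "q1 < q2" "q2 < 1"
    using q by (auto simp: q0_def q1_def q2_def)
  let ?S = "{0..1::real} \<times> disc"
  \<comment> \<open>H may take any values outside the disc; h replaces them by 0.\<close>
  define h where "h t x = (if x \<in> disc then H t x else 0)" for t x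
  \<comment> \<open>Three orders: after two differentiations one is left, and the first derivatives
    are smooth enough to be Lipschitz.\<close>
  have "C_k_on (Suc (Suc 1)) ?S (\<lambda>(t, x). H t x)"
    using Hs by (simp add: smooth_family_def smooth_on_def del: C_k_on.simps)
  then have hC: "C_k_on (Suc (Suc 1)) ?S (\<lambda>(t, x). h t x)"
    by (subst C_k_on_cong[of _ _ "\<lambda>(t, x). H t x"]) (auto simp: h_def)
  have hz: "h t x = 0" if "t \<in> {0..1}" "q0 \<le> norm x" for t x
    using Hz[OF that(1), of x] that qs by (auto simp: h_def)
  obtain D where D: "\<And>t x. t \<in> {0..1} \<Longrightarrow> (h t has_derivative (\<lambda>v. D v t x)) (at x)"
    and DC: "\<And>v. C_k_on (Suc 1) ?S (\<lambda>(t, x). D v t x)"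
    and Dz: "\<And>v t x. t \<in> {0..1} \<Longrightarrow> q1 \<le> norm x \<Longrightarrow> D v t x = 0"
    using vanishing_family_derivative[OF hC hz qs(3,4)] by blast
  have "\<exists>E. (\<forall>t\<in>{0..1}. \<forall>x. (D v t has_derivative (\<lambda>w. E w t x)) (at x)) \<and>
     (\<forall>w. C_k_on 1 ?S (\<lambda>(t, x). E w t x)) \<and> (\<forall>w. \<forall>t\<in>{0..1}. \<forall>x. q2 \<le> norm x \<longrightarrow> E w t x = 0)" for v
    by (rule vanishing_family_derivative[OF DC Dz qs(5,6)])
  then obtain E where E: "\<And>v t x. t \<in> {0..1} \<Longrightarrow> (D v t has_derivative (\<lambda>w. E v w t x)) (at x)"
    and EC: "\<And>v w. C_k_on 1 ?S (\<lambda>(t, x). E v w t x)"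
    by metis
  have "\<exists>L\<ge>0. \<forall>z\<in>?S. \<forall>w\<in>?S. \<bar>(case z of (t, x) \<Rightarrow> D v t x) - (case w of (t, x) \<Rightarrow> D v t x)\<bar> \<le> L * norm (z - w)" for v
    using C_k_on_Suc_imp[OF DC] by (intro C1_lipschitz C_k_on_Suc_imp[OF DC] compact_Times convex_Times) auto
  then obtain l where l: "\<And>v. 0 \<le> l v"
    and lip: "\<And>v z w. z \<in> ?S \<Longrightarrow> w \<in> ?S \<Longrightarrow> \<bar>(case z of (t, x) \<Rightarrow> D v t x) - (case w of (t, x) \<Rightarrow> D v t x)\<bar> \<le> l v * norm (z - w)"
    by metis
  define L where "L = l (axis 1 1) + l (axis 2 1)"
  have lip': "\<bar>D v t x - D v s y\<bar> \<le> L * (\<bar>t - s\<bar> + norm (x - y))"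
    if v: "v = axis 1 1 \<or> v = axis 2 1" and "s \<in> {0..1}" "t \<in> {0..1}" "x \<in> disc" "y \<in> disc" for v s t x y
  proof -
    have "\<bar>D v t x - D v s y\<bar> \<le> l v * norm ((t, x) - (s, y))"
      using lip[of "(t, x)" "(s, y)" v] that by simp
    also have "norm ((t, x) - (s, y)) \<le> \<bar>t - s\<bar> + norm (x - y)"
      using norm_Pair_le[of "t - s" "x - y"] by simp
    also have "l v * (\<bar>t - s\<bar> + norm (x - y)) \<le> L * (\<bar>t - s\<bar> + norm (x - y))"
      using v l by (intro mult_right_mono) (auto simp: L_def)
    finally show ?thesis
      using l[of v] by (simp add: mult_left_mono)
  qed
  have lin: "D v t x = v $ 1 * D (axis 1 1) t x + v $ 2 * D (axis 2 1) t x" if "t \<in> {0..1}" for v t x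
  proof -
    have linD: "linear (\<lambda>v. D v t x)"
      using D[OF that] by (rule has_derivative_linear)
    have "v = v $ 1 *\<^sub>R axis 1 1 + v $ 2 *\<^sub>R axis 2 1"
      by (auto simp: plane_eq_iff axis_def)
    then have "D v t x = D (v $ 1 *\<^sub>R axis 1 1 + v $ 2 *\<^sub>R axis 2 1) t x"
      by simp
    also have "\<dots> = v $ 1 * D (axis 1 1) t x + v $ 2 * D (axis 2 1) t x"
      using linear_add[OF linD] linear_scale[OF linD] by simp
    finally show ?thesis .
  qed
  have ham: "hamiltonian h (D (axis 1 1)) (D (axis 2 1)) (\<lambda>t x v. E (axis 1 1) v t x) (\<lambda>t x v. E (axis 2 1) v t x) r L"
    if r: "q1 \<le> r" "r < 1" for r
  proof
    show "0 \<le> r" "r < 1" "0 \<le> L"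
      using qs r l by (auto simp: L_def add_nonneg_nonneg)
    show "(h t has_derivative (\<lambda>v. v $ 1 * D (axis 1 1) t x + v $ 2 * D (axis 2 1) t x)) (at x)" if "t \<in> {0..1}" for t x
      using D[OF that, of x] unfolding lin[OF that, of _ x, symmetric] .
    show "(D (axis 1 1) t has_derivative (\<lambda>v. E (axis 1 1) v t x)) (at x)"
      "(D (axis 2 1) t has_derivative (\<lambda>v. E (axis 2 1) v t x)) (at x)" if "t \<in> {0..1}" for t x
      using E[OF that] by auto
    show "continuous_on ?S (\<lambda>(t, x). h t x)"
      using C_k_on_Suc_imp[OF C_k_on_Suc_imp[OF hC]] C_k_on_Suc_imp[of 0] by (metis C_k_on.simps(1) One_nat_def)
    show "continuous_on ?S (\<lambda>(t, x). E (axis 1 1) v t x)" "continuous_on ?S (\<lambda>(t, x). E (axis 2 1) v t x)" for v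
      using EC C_k_on_Suc_imp[of 0] by (metis C_k_on.simps(1) One_nat_def)+
    show "h t x = 0 \<and> D (axis 1 1) t x = 0 \<and> D (axis 2 1) t x = 0" if "t \<in> {0..1}" "r \<le> norm x" for t x
      using hz[OF that(1)] Dz[OF that(1)] that qs r by auto
  qed (use lip' in auto)
  have field: "hamiltonian_field (H t) x = vector [D (axis 2 1) t x, - D (axis 1 1) t x]"
    if t: "t \<in> {0..1}" and x: "x \<in> disc" for t x
  proof (rule hamiltonian_field_eq[OF _ x])
    have "(h t has_derivative (\<lambda>v. D v t x)) (at x within disc)"
      by (rule has_derivative_at_withinI[OF D[OF t]])
    then show "(H t has_derivative (\<lambda>v. D v t x)) (at x within disc)"
      by (rule has_derivative_transform[OF x, rotated]) (simp add: h_def)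
  qed
  show ?thesis
  proof (intro exI[of _ q1] conjI allI impI)
    fix r assume r: "q1 \<le> r" "r < 1"
    show "\<exists>h G1 G2 A B L. hamiltonian h G1 G2 A B r L \<and>
      (\<forall>t\<in>{0..1}. \<forall>x\<in>disc. h t x = H t x \<and> hamiltonian_field (H t) x = vector [G2 t x, - G1 t x])"
      by (rule exI[of _ h], rule exI[of _ "D (axis 1 1)"], rule exI[of _ "D (axis 2 1)"],
          rule exI[of _ "\<lambda>t x v. E (axis 1 1) v t x"], rule exI[of _ "\<lambda>t x v. E (axis 2 1) v t x"],
          rule exI[of _ L], intro conjI ballI ham r field) (simp add: h_def)
  qed (rule qs(4))
qed

lemma generates_motion:
  assumes "generates H g"
  shows "\<exists>r0<1. \<forall>r. r0 \<le> r \<longrightarrow> r < 1 \<longrightarrow> (\<exists>h G1 G2 A B L \<phi>. hamiltonian_motion h G1 G2 A B r L \<phi> \<and>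
    (\<forall>t\<in>{0..1}. \<forall>x\<in>disc. h t x = H t x) \<and> (\<forall>x\<in>disc. \<phi> 1 x = g x))"
proof -
  obtain \<phi> where \<phi>: "hamiltonian_flow H \<phi>" "\<And>x. x \<in> disc \<Longrightarrow> \<phi> 1 x = g x"
    using assms unfolding generates_def by blast
  obtain r0 where r0: "r0 < 1" "\<And>r. r0 \<le> r \<Longrightarrow> r < 1 \<Longrightarrow> (\<exists>h G1 G2 A B L. hamiltonian h G1 G2 A B r L \<and>
    (\<forall>t\<in>{0..1}. \<forall>x\<in>disc. h t x = H t x \<and> hamiltonian_field (H t) x = vector [G2 t x, - G1 t x]))"
    using hamiltonian_exists[of H] assms unfolding generates_def by blast
  show ?thesis
  proof (intro exI[of _ r0] conjI allI impI)
    fix r assume "r0 \<le> r" "r < 1"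
    then obtain h G1 G2 A B L where h: "hamiltonian h G1 G2 A B r L"
      and hH: "\<And>t x. t \<in> {0..1} \<Longrightarrow> x \<in> disc \<Longrightarrow> h t x = H t x \<and> hamiltonian_field (H t) x = vector [G2 t x, - G1 t x]"
      using r0(2) by blast
    have "hamiltonian_motion h G1 G2 A B r L \<phi>"
      using h
    proof (rule hamiltonian_motion.intro, unfold_locales)
      show "\<phi> 0 x = x" if "x \<in> disc" for x
        using \<phi>(1) that unfolding hamiltonian_flow_def by blast
      show st: "\<phi> t x \<in> disc" if "t \<in> {0..1}" "x \<in> disc" for t x
        using \<phi>(1) that unfolding hamiltonian_flow_def by blast
      show "((\<lambda>s. \<phi> s x) has_vector_derivative hamiltonian.X G1 G2 t (\<phi> t x)) (at t within {0..1})"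
        if "t \<in> {0..1}" "x \<in> disc" for t x
      proof -
        have "((\<lambda>s. \<phi> s x) has_vector_derivative hamiltonian_field (H t) (\<phi> t x)) (at t within {0..1})"
          using \<phi>(1) that unfolding hamiltonian_flow_def by blast
        then show ?thesis
          using hH[OF that(1) st[OF that]] by (simp add: hamiltonian.X_def[OF h])
      qed
    qed
    moreover have "\<forall>t\<in>{0..1}. \<forall>x\<in>disc. h t x = H t x" "\<forall>x\<in>disc. \<phi> 1 x = g x"
      using hH \<phi>(2) by blast+
    ultimately show "\<exists>h G1 G2 A B L \<phi>. hamiltonian_motion h G1 G2 A B r L \<phi> \<and>
      (\<forall>t\<in>{0..1}. \<forall>x\<in>disc. h t x = H t x) \<and> (\<forall>x\<in>disc. \<phi> 1 x = g x)"
      by blast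
  qed (rule r0(1))
qed

lemma generated_hamiltonian_unique:
  assumes "generates H g" "generates K g"
  shows "integral {0..1} (\<lambda>t. integral disc (H t)) = integral {0..1} (\<lambda>t. integral disc (K t))"
proof -
  obtain rH where rH: "rH < 1" "\<And>r. rH \<le> r \<Longrightarrow> r < 1 \<Longrightarrow> (\<exists>h G1 G2 A B L \<phi>. hamiltonian_motion h G1 G2 A B r L \<phi> \<and>
    (\<forall>t\<in>{0..1}. \<forall>x\<in>disc. h t x = H t x) \<and> (\<forall>x\<in>disc. \<phi> 1 x = g x))"
    using generates_motion[OF assms(1)] by blast
  obtain rK where rK: "rK < 1" "\<And>r. rK \<le> r \<Longrightarrow> r < 1 \<Longrightarrow> (\<exists>h G1 G2 A B L \<phi>. hamiltonian_motion h G1 G2 A B r L \<phi> \<and>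
    (\<forall>t\<in>{0..1}. \<forall>x\<in>disc. h t x = K t x) \<and> (\<forall>x\<in>disc. \<phi> 1 x = g x))"
    using generates_motion[OF assms(2)] by blast
  \<comment> \<open>The comparison of two Hamiltonians needs the same radius for both; this is why
    the preceding existence results hold for all r close to 1.\<close>
  define r where "r = max rH rK"
  have r: "rH \<le> r" "rK \<le> r" "r < 1"
    using rH(1) rK(1) by (auto simp: r_def)
  obtain h G1 G2 A B L \<phi> where 1: "hamiltonian_motion h G1 G2 A B r L \<phi>"
    and hH: "\<forall>t\<in>{0..1}. \<forall>x\<in>disc. h t x = H t x" and \<phi>: "\<forall>x\<in>disc. \<phi> 1 x = g x"
    using rH(2)[OF r(1,3)] by blast
  obtain k G1' G2' A' B' L' \<psi> where 2: "hamiltonian_motion k G1' G2' A' B' r L' \<psi>"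
    and kK: "\<forall>t\<in>{0..1}. \<forall>x\<in>disc. k t x = K t x" and \<psi>: "\<forall>x\<in>disc. \<psi> 1 x = g x"
    using rK(2)[OF r(2,3)] by blast
  have "integral {0..1} (\<lambda>t. integral disc (h t)) = integral {0..1} (\<lambda>t. integral disc (k t))"
    by (rule total_hamiltonian_unique[OF 1 2]) (simp add: \<phi> \<psi>)
  moreover have "integral {0..1} (\<lambda>t. integral disc (h t)) = integral {0..1} (\<lambda>t. integral disc (H t))"
    by (intro Henstock_Kurzweil_Integration.integral_cong) (use hH in blast)
  moreover have "integral {0..1} (\<lambda>t. integral disc (k t)) = integral {0..1} (\<lambda>t. integral disc (K t))"
    by (intro Henstock_Kurzweil_Integration.integral_cong) (use kK in blast)
  ultimately show ?thesis
    by simp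
qed

text \<open>Uniqueness of the integral over all generating Hamiltonians makes the description in
  \<open>calabi\<close> denote a value.\<close>

lemma calabi_eq:
  assumes "generates H g"
  shows "calabi g = 2 * integral {0..1} (\<lambda>t. integral disc (H t))"
  unfolding calabi_def
proof (rule the_equality)
  show "\<exists>K. generates K g \<and> 2 * integral {0..1} (\<lambda>t. integral disc (H t)) = 2 * integral {0..1} (\<lambda>t. integral disc (\<lambda>x. K t x))"
    using assms by blast
  show "c = 2 * integral {0..1} (\<lambda>t. integral disc (H t))"
    if "\<exists>K. generates K g \<and> c = 2 * integral {0..1} (\<lambda>t. integral disc (\<lambda>x. K t x))" for c
    using that generated_hamiltonian_unique[OF _ assms] by force
qed

section \<open>The embedding\<close>

lemma deriv_eq_0_outside:
  fixes f :: "real \<Rightarrow> real"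
  assumes "\<And>x. x \<notin> {a..b} \<Longrightarrow> f x = 0" "x \<notin> {a..b}"
  shows "deriv f x = 0"
proof -
  have "((\<lambda>x. 0) has_real_derivative 0) (at x)"
    by simp
  then have "(f has_real_derivative 0) (at x)"
    by (rule has_field_derivative_transform_within_open[where S = "- {a..b}"]) (use assms in auto)
  then show ?thesis
    by (rule DERIV_imp_deriv)
qed

lemma continuous_on_radial:
  fixes f :: "real \<Rightarrow> real"
  assumes "smooth_on UNIV f"
  shows "continuous_on S (\<lambda>x::plane. f (x \<bullet> x))"
proof (rule continuous_on_compose2[OF smooth_on_imp_continuous_on[OF assms]])
  show "continuous_on S (\<lambda>x::plane. x \<bullet> x)"
    by (intro continuous_intros)
qed simp

text \<open>F is the derivative of \<rho> m(\<rho>) for a bump m. In polar coordinates the integral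
  over the disc is pi times the integral of F over \<rho>, which is 0; the proof uses instead that 2
  F(|x|^2) is the divergence of m(|x|^2) x.\<close>

lemma zero_mean_profile:
  assumes ab: "0 < a" "a < b" "b < 1"
  shows "\<exists>F. smooth_on UNIV F \<and> (\<forall>\<rho>. \<rho> \<notin> {a..b} \<longrightarrow> F \<rho> = 0) \<and> (\<exists>\<rho>. deriv F \<rho> \<noteq> 0) \<and>
    integral disc (\<lambda>x. F (x \<bullet> x)) = 0"
proof -
  define m where "m = bump a b"
  define F where "F \<rho> = m \<rho> + \<rho> * deriv m \<rho>" for \<rho>
  have m: "smooth_on UNIV m"
    unfolding m_def by (rule smooth_on_bump)
  note m' = smooth_on_deriv(1)[OF m]
  have F: "smooth_on UNIV F"
    unfolding F_def[abs_def]
    by (intro smooth_on_add smooth_on_mult smooth_on_deriv(2) m smooth_on_linear bounded_linear_ident)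
  have m0: "m \<rho> = 0" if "\<rho> \<notin> {a..b}" for \<rho>
    using that by (auto simp: m_def bump_eq_0_iff)
  have F0: "F \<rho> = 0" if "\<rho> \<notin> {a..b}" for \<rho>
    using m0[OF that] deriv_eq_0_outside[OF m0 that] by (simp add: F_def)
  \<comment> \<open>Otherwise F is constantly 0, so \<rho> m(\<rho>) is constant, against its values
    at 0 and at the midpoint.\<close>
  have "\<exists>\<rho>. deriv F \<rho> \<noteq> 0"
  proof (rule ccontr)
    assume "\<not> ?thesis"
    then have "(F has_real_derivative 0) (at \<rho>)" for \<rho>
      using smooth_on_deriv(1)[OF F, of \<rho>] by simp
    then have "F \<rho> = F 0" for \<rho>
      using DERIV_isconst_all[of F \<rho> 0] by blast
    moreover have "F 0 = 0"
      using ab by (intro F0) simp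
    moreover have "((\<lambda>\<rho>. \<rho> * m \<rho>) has_real_derivative F \<rho>) (at \<rho>)" for \<rho>
      unfolding F_def by (rule derivative_eq_intros m' refl)+ simp
    ultimately have "((\<lambda>\<rho>. \<rho> * m \<rho>) has_real_derivative 0) (at \<rho>)" for \<rho>
      by metis
    then have "(a + b) / 2 * m ((a + b) / 2) = 0 * m 0"
      by (intro DERIV_isconst_all[of "\<lambda>\<rho>. \<rho> * m \<rho>"]) blast
    then show False
      using ab by (simp add: m_def bump_eq_0_iff)
  qed
  moreover have "integral disc (\<lambda>x. F (x \<bullet> x)) = 0"
  proof -
    define u' where "u' e x v = (v \<bullet> e) * m (x \<bullet> x) + (x \<bullet> e) * (deriv m (x \<bullet> x) * (2 * (x \<bullet> v)))" for e x v :: plane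
    have D: "((\<lambda>x. (x \<bullet> e) * m (x \<bullet> x)) has_derivative u' e x) (at x)" for e x
    proof -
      have 1: "((\<lambda>x. x \<bullet> x) has_derivative (\<lambda>v. 2 * (x \<bullet> v))) (at x)"
        by (auto intro!: derivative_eq_intros simp: inner_commute)
      have 2: "((\<lambda>x. m (x \<bullet> x)) has_derivative (\<lambda>v. deriv m (x \<bullet> x) * (2 * (x \<bullet> v)))) (at x)"
        using has_derivative_compose[OF 1, of m "(*) (deriv m (x \<bullet> x))"] m' by (simp add: has_field_derivative_def)
      have 3: "((\<lambda>x. x \<bullet> e) has_derivative (\<lambda>v. v \<bullet> e)) (at x)"
        by (auto intro!: derivative_eq_intros)
      show ?thesis
        using has_derivative_mult[OF 3 2] by (simp add: u'_def[abs_def] add.commute)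
    qed
    have cm: "continuous_on UNIV (\<lambda>x::plane. m (x \<bullet> x))" "continuous_on UNIV (\<lambda>x::plane. deriv m (x \<bullet> x))"
      by (intro continuous_on_radial m smooth_on_deriv(2))+
    have cont: "continuous_on UNIV (\<lambda>x. u' e x v)" for e v
      unfolding u'_def by (intro continuous_intros cm)
    have zero: "(x \<bullet> e) * m (x \<bullet> x) = 0" if "1 < norm x" for x e :: plane
    proof -
      have "1 < (norm x)\<^sup>2"
        using that by (simp add: one_less_power)
      then have "m (x \<bullet> x) = 0"
        using ab by (intro m0) (simp add: power2_norm_eq_inner)
      then show ?thesis
        by simp
    qed
    have I: "integral disc (\<lambda>x. u' e x v) = 0" for e v
      by (rule integral_derivative_eq_0[OF D cont zero]) auto
    have Int: "(\<lambda>x. u' e x v) integrable_on disc" for e v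
      by (intro integrable_continuous_compact(1) compact_cball continuous_on_subset[OF cont] subset_UNIV)
    have ax: "(axis 1 1 :: plane) $ 1 = 1" "(axis 1 1 :: plane) $ 2 = 0"
      "(axis 2 1 :: plane) $ 1 = 0" "(axis 2 1 :: plane) $ 2 = 1"
      by (simp_all add: axis_def)
    have "F (x \<bullet> x) = (u' (axis 1 1) x (axis 1 1) + u' (axis 2 1) x (axis 2 1)) * (1 / 2)" for x
      unfolding u'_def F_def by (simp add: inner_plane ax algebra_simps)
    then have "integral disc (\<lambda>x. F (x \<bullet> x)) =
        integral disc (\<lambda>x. u' (axis 1 1) x (axis 1 1) + u' (axis 2 1) x (axis 2 1)) * (1 / 2)"
      by (simp only: integral_mult_left)
    also have "integral disc (\<lambda>x. u' (axis 1 1) x (axis 1 1) + u' (axis 2 1) x (axis 2 1)) = 0"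
      by (simp add: Henstock_Kurzweil_Integration.integral_add Int I)
    finally show ?thesis
      by simp
  qed
  ultimately show ?thesis
    using F F0 by blast
qed

text \<open>The interval of squared radii from 1/4 to 1/2 is cut into N cells of length 1 / (4 N),
  and each profile occupies the first half of its cell. The gaps make even the closed supports
  disjoint, and starting at 1/4 leaves the disc of radius 1/2 unmoved.\<close>

lemma zero_mean_profiles:
  "\<exists>F :: 'n::finite \<Rightarrow> real \<Rightarrow> real. (\<forall>i. smooth_on UNIV (F i)) \<and> (\<forall>i \<rho>. \<rho> \<notin> {1/4..1/2} \<longrightarrow> F i \<rho> = 0) \<and>
    (\<forall>i. \<exists>\<rho>. deriv (F i) \<rho> \<noteq> 0) \<and> (\<forall>i j \<rho>. i \<noteq> j \<longrightarrow> deriv (F i) \<rho> = 0 \<or> deriv (F j) \<rho> = 0) \<and>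
    (\<forall>i. integral disc (\<lambda>x. F i (x \<bullet> x)) = 0)"
proof -
  define N where "N = real (card (UNIV :: 'n set))"
  have "0 < N"
    by (simp add: N_def card_gt_0_iff)
  obtain k where k: "bij_betw k (UNIV :: 'n set) {0..<card (UNIV :: 'n set)}"
    using ex_bij_betw_finite_nat[of "UNIV :: 'n set"] by auto
  have kN: "real (k i) + 1 \<le> N" for i
    using bij_betwE[OF k] by (simp add: N_def) (metis Suc_leI atLeastLessThan_iff of_nat_Suc of_nat_le_iff add.commute)
  define a where "a i = 1 / 4 + real (k i) / (4 * N)" for i
  define b where "b i = 1 / 4 + (real (k i) + 1 / 2) / (4 * N)" for i
  have ab: "1 / 4 \<le> a i" "a i < b i" "b i \<le> 1 / 2" for i
    using \<open>0 < N\<close> kN[of i] by (auto simp: a_def b_def divide_simps)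
  have sep: "b i < a j" if "k i < k j" for i j
  proof -
    have "real (k i) + 1 \<le> real (k j)"
      using that by linarith
    then show ?thesis
      using \<open>0 < N\<close> by (simp add: a_def b_def divide_strict_right_mono)
  qed
  have disj: "\<rho> \<notin> {a i..b i} \<or> \<rho> \<notin> {a j..b j}" if "i \<noteq> j" for i j \<rho>
  proof -
    have "k i \<noteq> k j"
      using k that by (auto simp: bij_betw_def inj_on_def)
    then show ?thesis
      using sep[of i j] sep[of j i] by (cases "k i < k j") auto
  qed
  have "\<forall>i. \<exists>F. smooth_on UNIV F \<and> (\<forall>\<rho>. \<rho> \<notin> {a i..b i} \<longrightarrow> F \<rho> = 0) \<and> (\<exists>\<rho>. deriv F \<rho> \<noteq> 0) \<and>
    integral disc (\<lambda>x. F (x \<bullet> x)) = 0"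
  proof
    fix i
    have "0 < a i" "b i < 1"
      using ab[of i] by linarith+
    then show "\<exists>F. smooth_on UNIV F \<and> (\<forall>\<rho>. \<rho> \<notin> {a i..b i} \<longrightarrow> F \<rho> = 0) \<and> (\<exists>\<rho>. deriv F \<rho> \<noteq> 0) \<and>
      integral disc (\<lambda>x. F (x \<bullet> x)) = 0"
      using ab(2)[of i] by (intro zero_mean_profile)
  qed
  from choice[OF this] obtain F where
    *: "\<forall>i. smooth_on UNIV (F i) \<and> (\<forall>\<rho>. \<rho> \<notin> {a i..b i} \<longrightarrow> F i \<rho> = 0) \<and> (\<exists>\<rho>. deriv (F i) \<rho> \<noteq> 0) \<and>
      integral disc (\<lambda>x. F i (x \<bullet> x)) = 0" ..
  then have F: "\<And>i. smooth_on UNIV (F i)" "\<And>i \<rho>. \<rho> \<notin> {a i..b i} \<Longrightarrow> F i \<rho> = 0"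
    "\<And>i. \<exists>\<rho>. deriv (F i) \<rho> \<noteq> 0" "\<And>i. integral disc (\<lambda>x. F i (x \<bullet> x)) = 0"
    by simp_all
  have "deriv (F i) \<rho> = 0 \<or> deriv (F j) \<rho> = 0" if "i \<noteq> j" for i j \<rho>
    using disj[OF that, of \<rho>] deriv_eq_0_outside[of "a i" "b i" "F i", OF F(2)]
      deriv_eq_0_outside[of "a j" "b j" "F j", OF F(2)] by blast
  moreover have "F i \<rho> = 0" if "\<rho> \<notin> {1/4..1/2}" for i \<rho>
  proof (rule F(2))
    show "\<rho> \<notin> {a i..b i}"
      using that ab[of i] by auto
  qed
  ultimately show ?thesis
    using F by (intro exI[of _ F] conjI allI impI)
qed

text \<open>Holds for arbitrary \<open>g\<close>, since a function that is not integrable has gauge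
  integral 0.\<close>

lemma Lp_length_nonneg: "0 \<le> Lp_length p g"
proof -
  have "0 \<le> integral S f" if "\<And>x. x \<in> S \<Longrightarrow> 0 \<le> f x" for S and f :: "real \<Rightarrow> real"
    using that integral_nonneg[of f S] by (cases "f integrable_on S") (auto simp: not_integrable_integral)
  then show ?thesis
    unfolding Lp_length_def by simp
qed

lemma Lp_norm_le:
  assumes "isotopy g" "g 0 = id"
  shows "Lp_norm p (g 1) \<le> Lp_length p g"
  unfolding Lp_norm_def Lp_dist_def
  by (rule cInf_lower) (use assms Lp_length_nonneg in \<open>auto intro!: bdd_belowI[of _ 0]\<close>)

text \<open>The isotopy \<open>g0\<close> witnesses that the infimum is taken over a nonempty
  set.\<close>

lemma Lp_norm_ge:
  assumes "isotopy g0" "g0 0 = id" "g0 1 = f"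
    and "\<And>g. isotopy g \<Longrightarrow> g 0 = id \<Longrightarrow> g 1 = f \<Longrightarrow> c \<le> Lp_length p g"
  shows "c \<le> Lp_norm p f"
  unfolding Lp_norm_def Lp_dist_def
  by (rule cInf_greatest) (use assms in auto)

section \<open>Lower and upper length bounds for twists\<close>

lemma vector_derivative_twist:
  assumes "t \<in> {0..1}"
  shows "vector_derivative (\<lambda>s. twist (\<lambda>\<rho>. s * a \<rho>) x) (at t within {0..1}) = a (x \<bullet> x) *\<^sub>R J (twist (\<lambda>\<rho>. t * a \<rho>) x)"
  using vector_derivative_within_cbox[of 0 1 t, unfolded box_real, OF _ assms twist_has_vector_derivative] by simp

text \<open>For \<open>\<bar>x\<bar> < \<bar>z\<bar>\<close>, rotating \<open>z\<close> about the origin turns \<open>z - x\<close> at least half as fast.\<close>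

lemma twist_winding_ge:
  assumes a: "smooth_on UNIV a" "b < 1" "\<And>\<rho>. b \<le> \<rho> \<Longrightarrow> a \<rho> = 0" and inner: "\<And>\<rho>. \<rho> < s \<Longrightarrow> a \<rho> = 0"
    and x: "x \<bullet> x < s" "x \<in> disc" and y: "y \<in> disc"
  shows "\<bar>a (y \<bullet> y)\<bar> / 2 \<le> \<bar>motion.winding (\<lambda>t. twist (\<lambda>\<rho>. t * a \<rho>))
     (\<lambda>t x. vector_derivative (\<lambda>s. twist (\<lambda>\<rho>. s * a \<rho>) x) (at t within {0..1})) x y\<bar>"
proof (cases "a (y \<bullet> y) = 0")
  case False
  define A where "A = a (y \<bullet> y)"
  have "A \<noteq> 0"
    using False by (simp add: A_def)
  have xy: "x \<bullet> x < y \<bullet> y"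
    using inner[of "y \<bullet> y"] False x by force
  let ?g = "\<lambda>t. twist (\<lambda>\<rho>. t * a \<rho>)"
  let ?g' = "\<lambda>t x. vector_derivative (\<lambda>s. ?g s x) (at t within {0..1})"
  have "?g 0 = id"
    by (auto simp: twist_eq_self)
  then interpret motion ?g ?g'
    using isotopy_motion[OF isotopy_twist[OF a]] by blast
  have "x \<noteq> y"
    using xy by auto
  let ?w = "\<lambda>t. angular_speed (?g t x - ?g t y) (?g' t x - ?g' t y)"
  have cont: "continuous_on {0..1} ?w"
    using x y separated[OF _ x(2) y \<open>x \<noteq> y\<close>]
    by (intro continuous_on_angular_speed continuous_on_diff continuous_on_g continuous_on_g' continuous_on_const continuous_on_id) auto
  \<comment> \<open>Dividing by A removes the sense of rotation, so the quotient stays at least 1/2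
    and angles of opposite sign cannot cancel over time.\<close>
  have w: "1 / 2 \<le> ?w t / A" if t: "t \<in> {0..1}" for t
  proof -
    define z where "z = ?g t y"
    have z: "z \<bullet> z = y \<bullet> y"
      by (simp add: z_def)
    have gx: "?g t x = x" "?g' t x = 0"
      unfolding vector_derivative_twist[OF t] using inner[OF x(1)] by (simp_all add: twist_eq_self)
    have gy: "?g' t y = A *\<^sub>R J z"
      unfolding vector_derivative_twist[OF t] by (simp add: z_def A_def)
    have "J (x - z) \<bullet> (0 - A *\<^sub>R J z) = A * (z \<bullet> z - x \<bullet> z)"
      by (simp add: inner_plane algebra_simps)
    then have eq: "?w t / A = (z \<bullet> z - x \<bullet> z) / ((x - z) \<bullet> (x - z))"
      using \<open>A \<noteq> 0\<close> unfolding angular_speed_def gx gy z_def[symmetric] by simp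
    have "x \<noteq> z"
      using xy z by auto
    then have pos: "0 < (x - z) \<bullet> (x - z)"
      by simp
    have "(x - z) \<bullet> (x - z) = x \<bullet> x - 2 * (x \<bullet> z) + z \<bullet> z"
      by (simp add: inner_diff_left inner_diff_right inner_commute)
    moreover have "x \<bullet> x \<le> z \<bullet> z"
      using xy z by simp
    ultimately have "(x - z) \<bullet> (x - z) \<le> 2 * (z \<bullet> z - x \<bullet> z)"
      by (simp add: algebra_simps)
    then show ?thesis
      unfolding eq using pos by (simp add: field_simps)
  qed
  have int: "?w integrable_on {0..1}"
    using cont by (rule integrable_continuous_real)
  have "integral {0..1} (\<lambda>t::real. 1 / 2 :: real) \<le> integral {0..1} (\<lambda>t. ?w t / A)"
    using w int by (intro integral_le integrable_on_divide) auto
  then have "1 / 2 \<le> winding x y / A"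
    by (simp add: winding_def)
  then have "1 / 2 \<le> \<bar>winding x y\<bar> / \<bar>A\<bar>"
    using abs_ge_self[of "winding x y / A"] unfolding abs_divide by linarith
  then show ?thesis
    using \<open>A \<noteq> 0\<close> by (simp add: A_def field_simps)
qed simp

text \<open>Points x with |x| < 1/2 fill an area of pi/4, and for them the winding with y is at
  least half the angle at y. This gives pi/8 times the integral on the left, against 16 pi (pi + 1)
  times the length; 128 is 16 * 8.\<close>

lemma Lp_length_ge_twist:
  assumes a: "smooth_on UNIV a" "b < 1" "\<And>\<rho>. b \<le> \<rho> \<Longrightarrow> a \<rho> = 0" and inner: "\<And>\<rho>. \<rho> < 1 / 4 \<Longrightarrow> a \<rho> = 0"
    and g: "isotopy g" "g 0 = id" "g 1 = twist a" and p: "1 \<le> p"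
  shows "integral disc (\<lambda>y. \<bar>a (y \<bullet> y)\<bar>) \<le> 128 * (pi + 1) * Lp_length p g"
proof -
  let ?g' = "\<lambda>t x. vector_derivative (\<lambda>s. g s x) (at t within {0..1})"
  let ?k = "\<lambda>t. twist (\<lambda>\<rho>. t * a \<rho>)"
  let ?k' = "\<lambda>t x. vector_derivative (\<lambda>s. ?k s x) (at t within {0..1})"
  have "?k 0 = id"
    by (auto simp: twist_eq_self)
  then have k: "motion ?k ?k'"
    using isotopy_motion[OF isotopy_twist[OF a]] by blast
  have w: "\<bar>a (y \<bullet> y)\<bar> / 2 \<le> \<bar>motion.winding g ?g' x y\<bar>"
    if x: "x \<in> ball 0 (1 / 2)" and y: "y \<in> disc" for x y
  proof -
    have xd: "x \<in> disc"
      using x by simp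
    \<comment> \<open>Radius 1/2 corresponds to the squared radius 1/4 below which the angle
      vanishes.\<close>
    have "(norm x)\<^sup>2 < (1 / 2)\<^sup>2"
      using x by (intro power_strict_mono) auto
    then have "x \<bullet> x < (1 / 2)\<^sup>2"
      by (simp only: power2_norm_eq_inner)
    then have "x \<bullet> x < 1 / 4"
      by (simp add: power2_eq_square)
    from twist_winding_ge[OF a inner this xd y] show ?thesis
      using winding_unique_disc[OF isotopy_motion[OF g(1,2)] k _ xd y] by (simp add: g)
  qed
  let ?I = "integral disc (\<lambda>y. \<bar>a (y \<bullet> y)\<bar>)"
  have ca: "continuous_on disc (\<lambda>y::plane. \<bar>a (y \<bullet> y)\<bar>)"
    by (intro continuous_on_rabs continuous_on_radial a(1))
  have I: "0 \<le> ?I"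
    by (intro integral_nonneg integrable_continuous_compact(1) ca compact_cball) simp
  have "(\<integral>\<^sup>+y. ennreal (\<bar>a (y \<bullet> y)\<bar> / 2) \<partial>lborel_on disc) = ennreal (integral disc (\<lambda>y. \<bar>a (y \<bullet> y)\<bar> / 2))"
    using ca by (intro nn_integral_continuous_compact continuous_on_divide continuous_on_const) auto
  then have inner_int: "(\<integral>\<^sup>+y. ennreal (\<bar>a (y \<bullet> y)\<bar> / 2) \<partial>lborel_on disc) = ennreal (?I / 2)"
    by simp
  have "emeasure (lborel_on disc) (ball 0 (1 / 2) :: plane set) = emeasure lborel (ball 0 (1 / 2) :: plane set)"
    by (rule emeasure_restrict_space) auto
  also have "\<dots> = ennreal (pi / 4)"
    by (subst emeasure_ball) (auto simp: unit_ball_vol_2 power2_eq_square)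
  finally have eb: "emeasure (lborel_on disc) (ball 0 (1 / 2) :: plane set) = ennreal (pi / 4)" .
  have bs: "(ball 0 (1 / 2) :: plane set) \<in> sets (lborel_on disc)"
    by (auto simp: sets_restrict_space intro!: image_eqI[of _ _ "ball 0 (1 / 2)"])
  have "ennreal (pi / 8 * ?I) = ennreal (?I / 2) * ennreal (pi / 4)"
    using I by (simp flip: ennreal_mult add: mult.commute)
  also have "\<dots> = (\<integral>\<^sup>+x. ennreal (?I / 2) * indicator (ball 0 (1 / 2)) x \<partial>lborel_on disc)"
    by (simp only: nn_integral_cmult_indicator[OF bs] eb)
  also have "\<dots> \<le> (\<integral>\<^sup>+x. \<integral>\<^sup>+y. ennreal \<bar>motion.winding g ?g' x y\<bar> \<partial>lborel_on disc \<partial>lborel_on disc)"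
  proof (rule nn_integral_mono)
    fix x :: plane
    show "ennreal (?I / 2) * indicator (ball 0 (1 / 2)) x \<le> (\<integral>\<^sup>+y. ennreal \<bar>motion.winding g ?g' x y\<bar> \<partial>lborel_on disc)"
    proof (cases "x \<in> ball 0 (1 / 2)")
      case True
      have "(\<integral>\<^sup>+y. ennreal (\<bar>a (y \<bullet> y)\<bar> / 2) \<partial>lborel_on disc) \<le> (\<integral>\<^sup>+y. ennreal \<bar>motion.winding g ?g' x y\<bar> \<partial>lborel_on disc)"
        by (intro nn_integral_mono ennreal_leI w True) simp
      then show ?thesis
        using True by (simp only: inner_int) simp
    qed simp
  qed
  also have "\<dots> \<le> ennreal (16 * pi * (pi + 1) * Lp_length p g)"
    by (rule nn_integral_winding_le_Lp_length[OF g(1,2) p])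
  finally have "pi / 8 * ?I \<le> 16 * pi * (pi + 1) * Lp_length p g"
    using Lp_length_nonneg[of p g] by (subst (asm) ennreal_le_iff) (auto intro!: mult_nonneg_nonneg add_nonneg_nonneg)
  then have "pi * ?I \<le> pi * (128 * (pi + 1) * Lp_length p g)"
    by (simp add: mult_ac)
  then show ?thesis
    by (simp only: mult_le_cancel_left_pos[OF pi_gt_zero])
qed

text \<open>Along the straight isotopy of angles the speed at x is |a(|x|^2)| |x| at all times,
  hence at most S. The area contributes pi^(1/p), which is at most pi.\<close>

lemma Lp_length_twist_le:
  assumes a: "smooth_on UNIV a" and S: "\<And>\<rho>. 0 \<le> \<rho> \<Longrightarrow> \<rho> \<le> 1 \<Longrightarrow> \<bar>a \<rho>\<bar> \<le> S" and p: "1 \<le> p"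
  shows "Lp_length p (\<lambda>t. twist (\<lambda>\<rho>. t * a \<rho>)) \<le> pi * S"
proof -
  have "0 \<le> S"
    using S[of 0] by simp
  let ?f = "\<lambda>x::plane. (\<bar>a (x \<bullet> x)\<bar> * norm x) powr p"
  have ca: "continuous_on disc (\<lambda>x::plane. a (x \<bullet> x))"
    by (rule continuous_on_radial[OF a])
  have cf: "continuous_on disc ?f"
    using p by (intro continuous_on_powr' continuous_intros ca) auto
  have "?f x \<le> S powr p" if x: "x \<in> disc" for x
  proof -
    have "x \<bullet> x \<le> 1"
      using x by (simp flip: power2_norm_eq_inner add: power_le_one)
    then have "\<bar>a (x \<bullet> x)\<bar> * norm x \<le> S * 1"
      using x S[of "x \<bullet> x"] \<open>0 \<le> S\<close> by (intro mult_mono) auto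
    then show ?thesis
      using p by (intro powr_mono2) auto
  qed
  then have "\<bar>integral disc ?f\<bar> \<le> pi * S powr p"
    using cf by (intro abs_integral_disc_le) auto
  then have "(integral disc ?f) powr (1 / p) \<le> (pi * S powr p) powr (1 / p)"
    using p integral_nonneg[OF integrable_continuous_compact(1)[OF compact_cball cf]]
    by (intro powr_mono2) auto
  also have "\<dots> = pi powr (1 / p) * S"
    using p \<open>0 \<le> S\<close> by (simp add: powr_mult powr_powr)
  also have "\<dots> \<le> pi powr 1 * S"
    using p pi_ge_two \<open>0 \<le> S\<close> by (intro mult_right_mono powr_mono) auto
  finally have le: "(integral disc ?f) powr (1 / p) \<le> pi * S"
    by simp
  have "Lp_length p (\<lambda>t. twist (\<lambda>\<rho>. t * a \<rho>)) = integral {0..1} (\<lambda>t::real. (integral disc ?f) powr (1 / p))"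
    unfolding Lp_length_def
    by (intro Henstock_Kurzweil_Integration.integral_cong arg_cong2[of _ _ _ _ "(powr)"] refl) (simp add: vector_derivative_twist)
  then show ?thesis
    using le by simp
qed

text \<open>If the integral were 0, so would be that over a box around z, and a continuous
  nonnegative function with integral 0 over a box vanishes there.\<close>

lemma integral_pos_of_nonzero:
  fixes f :: "plane \<Rightarrow> real"
  assumes f: "continuous_on disc f" and nonneg: "\<And>x. x \<in> disc \<Longrightarrow> 0 \<le> f x" and z: "norm z < 1" "f z \<noteq> 0"
  shows "0 < integral disc f"
proof (rule ccontr)
  assume "\<not> 0 < integral disc f"
  have int: "f integrable_on disc"
    by (rule integrable_continuous_compact(1)[OF compact_cball f])
  have zb: "z \<in> ball 0 1"
    using z by simp
  obtain a b where ab: "cbox a b \<subseteq> ball (0::plane) 1" "z \<in> box a b" "\<forall>i\<in>Basis. a \<bullet> i < b \<bullet> i"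
    by (rule open_contains_cbox[OF open_ball zb])
  then have sub: "cbox a b \<subseteq> disc"
    using ball_subset_cball by (meson order_trans)
  have cb: "continuous_on (cbox a b) f"
    by (rule continuous_on_subset[OF f sub])
  then have intb: "f integrable_on cbox a b"
    by (rule integrable_continuous)
  have "integral (cbox a b) f \<le> integral disc f"
    using sub intb int nonneg by (intro integral_subset_le) auto
  moreover have "0 \<le> integral (cbox a b) f"
    using intb nonneg sub by (intro integral_nonneg) auto
  ultimately have "integral (cbox a b) f = 0"
    using \<open>\<not> 0 < integral disc f\<close> by linarith
  then have "(f has_integral 0) (cbox a b)"
    using intb by (simp add: has_integral_iff)
  then have "f z = 0"
  proof (rule has_integral_0_cbox_imp_0[OF cb, rotated])
    show "0 \<le> f x" if "x \<in> box a b" for x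
      using that sub box_subset_cbox by (intro nonneg) blast
    show "box a b \<noteq> {}" "z \<in> cbox a b"
      using ab(2) box_subset_cbox by blast+
  qed
  with z show False
    by simp
qed

theorem theorem4:
  fixes p :: real
  assumes "1 \<le> p"
  shows "(\<exists>\<Psi> :: real ^ 'n \<Rightarrow> plane \<Rightarrow> plane. bi_lipschitz_embedding p disc_group \<Psi>) \<and>
         (\<exists>\<Psi> :: real ^ 'n \<Rightarrow> plane \<Rightarrow> plane. bi_lipschitz_embedding p calabi_kernel_group \<Psi>)"
proof -
  obtain F :: "'n \<Rightarrow> real \<Rightarrow> real" where F: "\<And>i. smooth_on UNIV (F i)" "\<And>i \<rho>. \<rho> \<notin> {1/4..1/2} \<Longrightarrow> F i \<rho> = 0"
    "\<And>i. \<exists>\<rho>. deriv (F i) \<rho> \<noteq> 0" "\<And>i j \<rho>. i \<noteq> j \<Longrightarrow> deriv (F i) \<rho> = 0 \<or> deriv (F j) \<rho> = 0"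
    "\<And>i. integral disc (\<lambda>x. F i (x \<bullet> x)) = 0"
    using zero_mean_profiles[where 'n = 'n] by (elim exE conjE) blast
  \<comment> \<open>The angle of the twist generated by the Hamiltonian F i (|x|^2).\<close>
  define f where "f i \<rho> = - 2 * deriv (F i) \<rho>" for i \<rho>
  define a where "a v \<rho> = (\<Sum>i\<in>UNIV. v $ i * f i \<rho>)" for v :: "real ^ 'n" and \<rho>
  define \<Psi> where "\<Psi> v = twist (a v)" for v
  have f_smooth: "smooth_on UNIV (f i)" for i
    unfolding f_def[abs_def] by (intro smooth_on_mult smooth_on_const smooth_on_deriv(2) F)
  have f_zero: "f i \<rho> = 0" if "\<rho> \<notin> {1/4..1/2}" for i \<rho>
    using deriv_eq_0_outside[of "1/4" "1/2" "F i", OF F(2) that] by (simp add: f_def)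
  have a_smooth: "smooth_on UNIV (a v)" for v
    unfolding a_def[abs_def] by (intro smooth_on_sum smooth_on_mult smooth_on_const f_smooth)
  have a_zero: "a v \<rho> = 0" if "\<rho> \<notin> {1/4..1/2}" for v \<rho>
    using f_zero[OF that] by (simp add: a_def)
  \<comment> \<open>Any number between 1/2 and 1 separates the supports from the boundary
    circle.\<close>
  have a_outer: "a v \<rho> = 0" if "3 / 4 \<le> \<rho>" for v \<rho>
    using that by (intro a_zero) auto
  have a_inner: "a v \<rho> = 0" if "\<rho> < 1 / 4" for v \<rho>
    using that by (intro a_zero) auto
  have lt1: "3 / 4 < (1 :: real)"
    by simp
  have iso: "isotopy (\<lambda>t. twist (\<lambda>\<rho>. t * a v \<rho>))" for v
    by (rule isotopy_twist[OF a_smooth lt1 a_outer])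
  have iso0: "(\<lambda>t. twist (\<lambda>\<rho>. t * a v \<rho>)) 0 = id" for v
    by (auto simp: twist_eq_self)
  have \<Psi>_in: "\<Psi> v \<in> disc_diffeos" for v
    unfolding \<Psi>_def by (rule twist_in_disc_diffeos[OF a_smooth lt1 a_outer])
  have \<Psi>_add: "\<Psi> (v + w) = \<Psi> v \<circ> \<Psi> w" for v w
  proof -
    have "a (v + w) = (\<lambda>\<rho>. a v \<rho> + a w \<rho>)"
      by (simp add: a_def fun_eq_iff distrib_right sum.distrib)
    then show ?thesis
      unfolding \<Psi>_def by (intro ext) (simp only: twist_add o_apply)
  qed
  have \<Psi>_0: "\<Psi> 0 = id"
    by (auto simp: \<Psi>_def a_def twist_eq_self)
  have calabi: "calabi (\<Psi> v) = 0" for v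
  proof -
    \<comment> \<open>The twist with angle \<open>a v\<close> is generated by the same combination
      of the profiles, so the mean stays 0.\<close>
    define Fv where "Fv \<rho> = (\<Sum>i\<in>UNIV. v $ i * F i \<rho>)" for \<rho>
    have Fv: "smooth_on UNIV Fv"
      unfolding Fv_def[abs_def] by (intro smooth_on_sum smooth_on_mult smooth_on_const F)
    have "(Fv has_real_derivative (\<Sum>i\<in>UNIV. v $ i * deriv (F i) \<rho>)) (at \<rho>)" for \<rho>
      unfolding Fv_def[abs_def] by (intro DERIV_sum DERIV_cmult smooth_on_deriv(1) F)
    then have "deriv Fv \<rho> = (\<Sum>i\<in>UNIV. v $ i * deriv (F i) \<rho>)" for \<rho>
      by (rule DERIV_imp_deriv)
    then have eq: "(\<lambda>\<rho>. - 2 * deriv Fv \<rho>) = a v"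
      by (simp add: a_def f_def fun_eq_iff sum_distrib_left mult_ac flip: sum_negf)
    have "generates (\<lambda>t x. Fv (x \<bullet> x)) (twist (\<lambda>\<rho>. - 2 * deriv Fv \<rho>))"
      by (rule generates_twist[OF Fv lt1]) (simp add: Fv_def F(2))
    then have "calabi (\<Psi> v) = 2 * integral {0..1} (\<lambda>t::real. integral disc (\<lambda>x. Fv (x \<bullet> x)))"
      unfolding eq \<Psi>_def by (rule calabi_eq)
    moreover have "integral disc (\<lambda>x. Fv (x \<bullet> x)) = 0"
    proof -
      have "continuous_on disc (\<lambda>x. F i (x \<bullet> x))" for i
        by (rule continuous_on_radial[OF F(1)])
      then have "integral disc (\<lambda>x. Fv (x \<bullet> x)) = (\<Sum>i\<in>UNIV. integral disc (\<lambda>x. v $ i * F i (x \<bullet> x)))"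
        unfolding Fv_def
        by (intro integral_sum integrable_continuous_compact(1) continuous_on_mult_left) auto
      then show ?thesis
        by (simp add: F(5))
    qed
    ultimately show ?thesis
      by simp
  qed

  have cf: "continuous_on S (\<lambda>x::plane. f i (x \<bullet> x))" for i S
    by (rule continuous_on_radial[OF f_smooth])
  define \<kappa> where "\<kappa> i = integral disc (\<lambda>y. \<bar>f i (y \<bullet> y)\<bar>)" for i
  have \<kappa>_pos: "0 < \<kappa> i" for i
  proof -
    obtain \<rho> where \<rho>: "deriv (F i) \<rho> \<noteq> 0"
      using F(3) by blast
    then have "\<rho> \<in> {1/4..1/2}"
      using deriv_eq_0_outside[of "1/4" "1/2" "F i", OF F(2)] by blast
    \<comment> \<open>A point of squared norm \<rho>, where the angle profile is nonzero.\<close>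
    define z :: plane where "z = sqrt \<rho> *\<^sub>R axis 1 1"
    have z: "z \<bullet> z = \<rho>" "norm z < 1"
      using \<open>\<rho> \<in> _\<close> by (auto simp: z_def inner_axis_axis)
    show ?thesis
      unfolding \<kappa>_def
    proof (rule integral_pos_of_nonzero[OF _ _ z(2)])
      show "continuous_on disc (\<lambda>y. \<bar>f i (y \<bullet> y)\<bar>)"
        by (intro continuous_on_rabs cf)
      show "\<bar>f i (z \<bullet> z)\<bar> \<noteq> 0"
        using \<rho> by (simp add: z f_def)
    qed simp
  qed
  \<comment> \<open>The index type is finite and nonempty, so the smallest of the positive L1 norms
    exists and is positive.\<close>
  define c where "c = Min (range \<kappa>)"
  have c: "0 < c" "\<And>i. c \<le> \<kappa> i"
    using \<kappa>_pos by (auto simp: c_def)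
  \<comment> \<open>At each \<rho> at most one profile is nonzero, so the triangle inequality is an
    equality. This is how the l1 norm enters.\<close>
  have abs_a: "\<bar>a v \<rho>\<bar> = (\<Sum>i\<in>UNIV. \<bar>v $ i\<bar> * \<bar>f i \<rho>\<bar>)" for v \<rho>
  proof (cases "\<exists>i. f i \<rho> \<noteq> 0")
    case True
    then obtain i where i: "f i \<rho> \<noteq> 0"
      by blast
    then have "f j \<rho> = 0" if "j \<noteq> i" for j
      using F(4)[OF that, of \<rho>] by (auto simp: f_def)
    then have "a v \<rho> = v $ i * f i \<rho>" "(\<Sum>i\<in>UNIV. \<bar>v $ i\<bar> * \<bar>f i \<rho>\<bar>) = \<bar>v $ i\<bar> * \<bar>f i \<rho>\<bar>"
      unfolding a_def by (subst sum.remove[of _ i]; auto)+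
    then show ?thesis
      by (simp add: abs_mult)
  qed (simp add: a_def)
  have lower: "c * l1_norm v \<le> integral disc (\<lambda>y. \<bar>a v (y \<bullet> y)\<bar>)" for v
  proof -
    have "c * l1_norm v \<le> (\<Sum>i\<in>UNIV. \<bar>v $ i\<bar> * \<kappa> i)"
      unfolding l1_norm_def sum_distrib_left
      by (intro sum_mono) (simp add: mult.commute[of c] mult_left_mono[OF c(2)])
    also have "\<dots> = integral disc (\<lambda>y. \<bar>a v (y \<bullet> y)\<bar>)"
      unfolding abs_a \<kappa>_def
      by (subst integral_sum) (auto intro!: integrable_continuous_compact(1) continuous_intros cf)
    finally show ?thesis .
  qed
  have "\<exists>K. \<forall>\<rho>\<in>{0..1}. \<bar>f i \<rho>\<bar> \<le> K" for i
    using compact_imp_bounded[OF compact_continuous_image[OF continuous_on_subset[OF smooth_on_imp_continuous_on[OF f_smooth]] compact_Icc]]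
    by (simp add: bounded_iff)
  then obtain K where K: "\<And>i \<rho>. \<rho> \<in> {0..1} \<Longrightarrow> \<bar>f i \<rho>\<bar> \<le> K i"
    by metis
  define k where "k = Max (range K)"
  have upper: "\<bar>a v \<rho>\<bar> \<le> k * l1_norm v" if "0 \<le> \<rho>" "\<rho> \<le> 1" for v \<rho>
  proof -
    have "\<bar>f i \<rho>\<bar> \<le> k" for i
      using K[of \<rho> i] that by (auto simp: k_def intro: order_trans Max_ge)
    then show ?thesis
      unfolding abs_a l1_norm_def sum_distrib_left
      by (intro sum_mono) (simp add: mult.commute[of k] mult_left_mono)
  qed

  \<comment> \<open>The two entries besides 1 are the constants of the lower and of the upper
    estimate.\<close>
  define A where "A = max 1 (max (128 * (pi + 1) / c) (pi * k))"
  have A: "1 \<le> A" "128 * (pi + 1) / c \<le> A" "pi * k \<le> A"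
    by (auto simp: A_def)
  have l1: "0 \<le> l1_norm v" for v :: "real ^ 'n"
    by (simp add: l1_norm_def sum_nonneg)
  have bound1: "inverse A * l1_norm v \<le> Lp_norm p (\<Psi> v)" for v
  proof (rule Lp_norm_ge[OF iso iso0, of v])
    show "twist (\<lambda>\<rho>. 1 * a v \<rho>) = \<Psi> v"
      by (simp add: \<Psi>_def)
    fix g assume g: "isotopy g" "g 0 = id" "g 1 = \<Psi> v"
    have "g 1 = twist (a v)"
      using g(3) by (simp add: \<Psi>_def)
    from Lp_length_ge_twist[OF a_smooth lt1 a_outer a_inner g(1,2) this assms]
    have "integral disc (\<lambda>y. \<bar>a v (y \<bullet> y)\<bar>) \<le> 128 * (pi + 1) * Lp_length p g" .
    then have "c * l1_norm v \<le> 128 * (pi + 1) * Lp_length p g"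
      using lower[of v] by linarith
    then have "l1_norm v \<le> 128 * (pi + 1) / c * Lp_length p g"
      using c(1) by (simp add: field_simps)
    also have "\<dots> \<le> A * Lp_length p g"
      using A Lp_length_nonneg by (intro mult_right_mono)
    finally show "inverse A * l1_norm v \<le> Lp_length p g"
      using A(1) by (simp add: field_simps)
  qed
  have bound2: "Lp_norm p (\<Psi> v) \<le> A * l1_norm v" for v
  proof -
    have "Lp_norm p (\<Psi> v) \<le> Lp_length p (\<lambda>t. twist (\<lambda>\<rho>. t * a v \<rho>))"
      using Lp_norm_le[OF iso iso0, of p v] by (simp add: \<Psi>_def)
    also have "\<dots> \<le> pi * (k * l1_norm v)"
      by (rule Lp_length_twist_le[OF a_smooth upper assms])
    also have "\<dots> \<le> A * l1_norm v"
      using A(3) l1[of v] by (simp add: mult_right_mono flip: mult.assoc)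
    finally show ?thesis .
  qed
  have inj: "inj \<Psi>"
  proof (rule injI)
    fix v w assume eq: "\<Psi> v = \<Psi> w"
    have "\<Psi> (v - w) \<circ> \<Psi> w = \<Psi> (- w + w) \<circ> \<Psi> w"
      by (simp add: eq \<Psi>_0 flip: \<Psi>_add)
    then have "\<Psi> (v - w) \<circ> (\<Psi> w \<circ> \<Psi> (- w)) = \<Psi> w \<circ> \<Psi> (- w)"
      by (simp add: \<Psi>_0 o_assoc)
    then have "\<Psi> (v - w) = \<Psi> 0"
      by (simp add: \<Psi>_0 flip: \<Psi>_add)
    \<comment> \<open>The upper bound at 0 makes the norm of the identity nonpositive; the lower
      bound then forces v = w.\<close>
    then have "Lp_norm p (\<Psi> (v - w)) \<le> 0"
      using bound2[of 0] by (simp add: l1_norm_def)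
    then have "inverse A * l1_norm (v - w) \<le> 0"
      using bound1[of "v - w"] by linarith
    then have "l1_norm (v - w) \<le> 0"
      using A(1) by (simp add: mult_le_0_iff)
    with l1[of "v - w"] have "l1_norm (v - w) = 0"
      by linarith
    then have "(\<Sum>i\<in>UNIV. \<bar>(v - w) $ i\<bar>) = 0"
      by (simp only: l1_norm_def)
    then show "v = w"
      by (simp add: sum_nonneg_eq_0_iff vec_eq_iff)
  qed
  \<comment> \<open>The isotopies measured by \<open>Lp_norm\<close> run in the whole group, so one
    map and one pair of estimates serve both groups.\<close>
  have "\<Psi> \<in> mon additive_group disc_group" "\<Psi> \<in> mon additive_group calabi_kernel_group"
    using inj \<Psi>_in \<Psi>_add calabi
    by (auto simp: mon_def hom_def additive_group_def disc_group_def calabi_kernel_group_def kernel_def)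
  then have "bi_lipschitz_embedding p disc_group \<Psi>" "bi_lipschitz_embedding p calabi_kernel_group \<Psi>"
    unfolding bi_lipschitz_embedding_def using A(1) bound1 bound2 by blast+
  then show ?thesis
    by blast
qed

end
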